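(* Let $\mathcal{F}_n$ be the fireproof forest resulting from the fire dynamics with firing rate $n^{-1/2}$ (the critical case $\alpha=1/2$) on a uniform Cayley tree $\mathbf{t}_n$ on $[n]$. For every $\varepsilon>0$, the probability that there exist tree-components of $\mathcal{F}_n$ with size greater than $n^{1-\varepsilon}$ converges to $1$ as $n\to\infty$.
   Context: For $n\ge1$, $[n]=\{1,\dots,n\}$. A uniform Cayley tree $\mathbf{t}_n$ is a tree picked uniformly at random among the $n^{n-2}$ trees on the labeled vertex set $[n]$. Fire dynamics with firing rate $r>0$ on a finite tree: this is a continuous-time Markov process in which each edge is in one of three states: inflammable, fireproof, or burnt. Initially every edge is inflammable. The only transitions are from inflammable to fireproof or burnt. Each inflammable edge becomes fireproof at rate $1$, independently of the other edges. Each inflammable edge is also set on fire at rate $r$; when this happens, the fire propagates instantaneously through neighboring inflammable edges (edges sharing a vertex) and is stopped only at fireproof edges, so that all edges in the connected cluster of inflammable edges containing the edge set on fire become burnt. After a finite time all edges are either burnt or fireproof; this is the terminal state. Given the random tree $\mathbf{t}_n$, the dynamics are run on $\mathbf{t}_n$ with $r=n^{-1/2}$. A vertex is called fireproof if all its adjacent edges are fireproof in the terminal state, and burnt otherwise. The fireproof forest $\mathcal{F}_n$ is the graph whose vertices are the fireproof vertices and whose edges are the fireproof edges with both end-points fireproof. Its tree-components are its connected components, and the size of a tree-component is its number of vertices. *)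

theory Defs
  imports "HOL-Probability.Probability"
begin

text \<open>
  A simple graph is given by a set of vertices and a set of edges, an edge being a two-element
  set of vertices.
\<close>

type_synonym edge = "nat set"

definition all_edges :: "nat set \<Rightarrow> edge set" where
  "all_edges V = {e. e \<subseteq> V \<and> card e = 2}"

definition adjacency :: "edge set \<Rightarrow> (nat \<times> nat) set" where
  "adjacency E = {(u, v). {u, v} \<in> E}"

definition connected_graph :: "nat set \<Rightarrow> edge set \<Rightarrow> bool" where
  "connected_graph V E \<longleftrightarrow> V \<noteq> {} \<and> (\<forall>u\<in>V. \<forall>v\<in>V. (u, v) \<in> (adjacency E)\<^sup>*)"

definition graph_cycle :: "edge set \<Rightarrow> nat list \<Rightarrow> bool" where
  "graph_cycle E vs \<longleftrightarrow> length vs \<ge> 3 \<and> distinct vs \<and>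
     (\<forall>i<length vs. {vs ! i, vs ! (Suc i mod length vs)} \<in> E)"

definition is_tree :: "nat set \<Rightarrow> edge set \<Rightarrow> bool" where
  "is_tree V E \<longleftrightarrow> E \<subseteq> all_edges V \<and> connected_graph V E \<and> (\<nexists>vs. graph_cycle E vs)"

definition cayley_trees :: "nat \<Rightarrow> edge set set" where
  "cayley_trees n = {T. is_tree {1..n} T}"

definition components :: "nat set \<Rightarrow> edge set \<Rightarrow> nat set set" where
  "components V E = {{w \<in> V. (v, w) \<in> (adjacency E)\<^sup>*} |v. v \<in> V}"

datatype edge_state = Inflammable | Fireproof | Burnt

type_synonym config = "edge \<Rightarrow> edge_state"

definition inflammable_edges :: "edge set \<Rightarrow> config \<Rightarrow> edge set" where
  "inflammable_edges T x = {e \<in> T. x e = Inflammable}"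

definition fire_cluster :: "edge set \<Rightarrow> config \<Rightarrow> edge \<Rightarrow> edge set" where
  "fire_cluster T x e =
     {f. (e, f) \<in> {(g, h). g \<in> inflammable_edges T x \<and> h \<in> inflammable_edges T x \<and>
                          g \<inter> h \<noteq> {}}\<^sup>*}"

text \<open>
  The Markov process is realised by its graphical construction. Every edge carries two independent
  exponential clocks, one of parameter \<open>1\<close> for becoming fireproof (\<open>Protect\<close>) and one of
  parameter \<open>r\<close> for being set on fire (\<open>Ignite\<close>). A clock that rings on an edge which is no
  longer inflammable has no effect; since an edge never becomes inflammable again, only the first
  ring of each clock can matter. By lack of memory, whatever the past, each inflammable edge becomes
  fireproof at rate \<open>1\<close> and is set on fire at rate \<open>r\<close>.
\<close>

datatype fire_event = Protect edge | Ignite edge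

fun apply_event :: "edge set \<Rightarrow> fire_event \<Rightarrow> config \<Rightarrow> config" where
  "apply_event T (Protect e) x = (if x e = Inflammable then x(e := Fireproof) else x)"
| "apply_event T (Ignite e) x =
     (if x e = Inflammable then (\<lambda>f. if f \<in> fire_cluster T x e then Burnt else x f) else x)"

definition fire_events :: "edge set \<Rightarrow> fire_event set" where
  "fire_events T = Protect ` T \<union> Ignite ` T"

text \<open>
  The configuration at time \<open>t\<close>, when the event \<open>a\<close> rings at time \<open>c a\<close>: the events that
  have rung by time \<open>t\<close> are carried out in chronological order. The ringing times are almost
  surely distinct, and the sorted list is meaningful in that case only.
\<close>

definition fire_process :: "edge set \<Rightarrow> (fire_event \<Rightarrow> real) \<Rightarrow> real \<Rightarrow> config" where
  "fire_process T c t =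
     fold (apply_event T) (sorted_key_list_of_set c {a \<in> fire_events T. c a \<le> t})
       (\<lambda>_. Inflammable)"

definition terminal_state :: "edge set \<Rightarrow> (fire_event \<Rightarrow> real) \<Rightarrow> edge \<Rightarrow> edge_state \<Rightarrow> bool" where
  "terminal_state T c e s \<longleftrightarrow> (\<forall>\<^sub>F t in at_top. fire_process T c t e = s)"

definition fireproof_vertices ::
    "nat \<Rightarrow> edge set \<Rightarrow> (fire_event \<Rightarrow> real) \<Rightarrow> nat set" where
  "fireproof_vertices n T c =
     {v \<in> {1..n}. \<forall>e\<in>T. v \<in> e \<longrightarrow> terminal_state T c e Fireproof}"

definition forest_edges ::
    "nat \<Rightarrow> edge set \<Rightarrow> (fire_event \<Rightarrow> real) \<Rightarrow> edge set" where
  "forest_edges n T c =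
     {e \<in> T. terminal_state T c e Fireproof \<and> e \<subseteq> fireproof_vertices n T c}"

definition forest_components ::
    "nat \<Rightarrow> edge set \<Rightarrow> (fire_event \<Rightarrow> real) \<Rightarrow> nat set set" where
  "forest_components n T c = components (fireproof_vertices n T c) (forest_edges n T c)"

fun clock_rate :: "real \<Rightarrow> fire_event \<Rightarrow> real" where
  "clock_rate r (Protect e) = 1"
| "clock_rate r (Ignite e) = r"

definition clock_space :: "nat \<Rightarrow> real \<Rightarrow> (fire_event \<Rightarrow> real) measure" where
  "clock_space n r =
     (\<Pi>\<^sub>M a\<in>fire_events (all_edges {1..n}).
        density lborel (exponential_density (clock_rate r a)))"

text \<open>
  All edges of the complete graph receive clocks, independent of each other and of the uniform
  tree; only the clocks on the edges of the tree are used. So, given the tree, the clocks on its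
  edges are independent exponential variables. The points are pairs \<open>(T, c)\<close> of a
  tree and a family of clocks.
\<close>

definition fire_space :: "nat \<Rightarrow> real \<Rightarrow> (edge set \<times> (fire_event \<Rightarrow> real)) measure" where
  "fire_space n r = uniform_count_measure (cayley_trees n) \<Otimes>\<^sub>M clock_space n r"

end

theory Submission
  imports Defs "HOL-Real_Asymp.Real_Asymp"
begin

text \<open>
  Trees containing a given forest are counted exactly, by adding one edge at a time. This bounds all
  moments of the volume of balls and the tail of the heights, hence with high probability all balls
  of radius \<open>\<rho>\<close> have at most \<open>n\<^sup>\<delta> \<rho>\<^sup>2\<close> vertices and every subtree of size \<open>k\<close> hanging below a vertex has
  height at most \<open>k\<^bsup>1/2\<^esup> n\<^sup>\<delta>\<close>. On such a tree, rooted at \<open>1\<close>, more than \<open>n\<^bsup>1/2+30\<delta>\<^esup>\<close> vertices \<open>x\<close> have a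
  subtree of size between \<open>n\<^bsup>1-150\<delta>\<^esup>\<close> and \<open>n\<^bsup>1-60\<delta>\<^esup>\<close>. By time \<open>s = n\<^bsup>-1/2-10\<delta>\<^esup>\<close> nothing has burnt, but the edge
  above one of these vertices \<open>x\<close> has become fireproof. From then on no fire enters the subtree of
  \<open>x\<close> from outside. A fire that starts inside it at distance \<open>d\<close> from the path between \<open>x\<close> and \<open>v\<close> has
  to ring before \<open>d\<close> protecting clocks in order to reach that path, which has probability at most
  \<open>n\<^bsup>-1/2\<^esup> / d\<close>. Summed over the subtree, by the volume bound this is of order \<open>n\<^bsup>-1/2\<^esup>\<close> times the height, so
  most vertices \<open>v\<close> of the subtree end up in the same fireproof component as \<open>x\<close>.
\<close>

subsection \<open>Paths and forests\<close>

text \<open>The clocks decide which \<open>x\<close> is protected in time, so the scorching estimate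
  must hold for all candidates at once. Forbidding every fire before \<open>s\<close> forces
  \<open>n * r * s\<close> to 0, hence \<open>s\<close> below \<open>n^(-1/2)\<close>, and then more
  than \<open>n^(1/2)\<close> candidates are needed for one to be protected. A plain union bound
  over so many would be too expensive. But protection of the edge above \<open>x\<close> by time
  \<open>s\<close> and scorching below \<open>x\<close> concern different clocks, so their joint
  event carries a factor \<open>s\<close>, and \<open>q\<close> candidates cost only
  \<open>q * s = n^(20 \<delta>)\<close>. Taking subtrees of size at most
  \<open>n^(1 - 60 \<delta>)\<close> rather than of order \<open>n\<close> lowers their height by
  about \<open>n^(-30 \<delta>)\<close>, which pays for this cost, for the volume constant and for a
  logarithm. Every estimate on trees may lose a power \<open>n^\<delta>\<close>, so high moments and
  union bounds over vertices suffice.\<close>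

lemma sym_adjacency: "(u, v) \<in> adjacency E \<longleftrightarrow> (v, u) \<in> adjacency E"
  by (simp add: adjacency_def insert_commute)

lemma reach_sym: "(u, v) \<in> (adjacency E)\<^sup>* \<Longrightarrow> (v, u) \<in> (adjacency E)\<^sup>*"
  using sym_adjacency[of _ _ E] sym_rtrancl[of "adjacency E"] by (meson symD symI)

lemma reach_mono: "E \<subseteq> F \<Longrightarrow> (u, v) \<in> (adjacency E)\<^sup>* \<Longrightarrow> (u, v) \<in> (adjacency F)\<^sup>*"
  using rtrancl_mono[of "adjacency E" "adjacency F"] by (auto simp: adjacency_def)

lemma adjacency_insert: "adjacency (insert {x, y} E) = insert (x, y) (insert (y, x) (adjacency E))"
  by (auto simp: adjacency_def doubleton_eq_iff)

lemma reach_insert: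
  "(u, v) \<in> (adjacency (insert {x, y} E))\<^sup>* \<longleftrightarrow>
     (u, v) \<in> (adjacency E)\<^sup>* \<or>
     (u, x) \<in> (adjacency E)\<^sup>* \<and> (y, v) \<in> (adjacency E)\<^sup>* \<or>
     (u, y) \<in> (adjacency E)\<^sup>* \<and> (x, v) \<in> (adjacency E)\<^sup>*"
proof -
  let ?R = "(adjacency E)\<^sup>*"
  have sym: "(p, q) \<in> ?R \<Longrightarrow> (q, p) \<in> ?R" for p q by (rule reach_sym)
  have trans: "(p, q) \<in> ?R \<Longrightarrow> (q, t) \<in> ?R \<Longrightarrow> (p, t) \<in> ?R" for p q t by (rule rtrancl_trans)
  show ?thesis
    unfolding adjacency_insert rtrancl_insert mem_Collect_eq prod.case
    using sym trans by blast
qed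

text \<open>Acyclicity in the form that every edge is a bridge: it passes to subsets and to the
  insertion of an edge between two components by reachability alone, without cycles as lists.
  \<open>acyclic_iff_forest\<close> links it to \<open>graph_cycle\<close>.\<close>

definition forest :: "edge set \<Rightarrow> bool" where
  "forest E \<longleftrightarrow> (\<forall>x y. {x, y} \<in> E \<longrightarrow> (x, y) \<notin> (adjacency (E - {{x, y}}))\<^sup>*)"

lemma forestD: "forest E \<Longrightarrow> {x, y} \<in> E \<Longrightarrow> (x, y) \<notin> (adjacency (E - {{x, y}}))\<^sup>*"
  by (auto simp: forest_def)

lemma forest_empty: "forest {}"
  by (simp add: forest_def)

lemma forest_mono:
  assumes "forest F" "E \<subseteq> F"
  shows "forest E"
  unfolding forest_def
proof (intro allI impI notI)
  fix x y assume "{x, y} \<in> E" "(x, y) \<in> (adjacency (E - {{x, y}}))\<^sup>*"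
  moreover from this have "(x, y) \<in> (adjacency (F - {{x, y}}))\<^sup>*"
    using assms(2) reach_mono[of "E - {{x, y}}" "F - {{x, y}}"] by blast
  ultimately show False
    using assms forestD by blast
qed

text \<open>A detour around an old edge \<open>{a, b}\<close> would have to use the new edge; the
  rest of the detour together with \<open>{a, b}\<close> would then join \<open>x\<close> to
  \<open>y\<close> inside \<open>F\<close>.\<close>

lemma forest_insert:
  assumes F: "forest F" and xy: "(x, y) \<notin> (adjacency F)\<^sup>*"
  shows "forest (insert {x, y} F)"
  unfolding forest_def
proof (intro allI impI notI)
  fix a b assume ab: "{a, b} \<in> insert {x, y} F" and r: "(a, b) \<in> (adjacency (insert {x, y} F - {{a, b}}))\<^sup>*"
  show False
  proof (cases "{a, b} = {x, y}")
    case True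
    then have "(a, b) \<in> (adjacency F)\<^sup>*"
      using r reach_mono[of "insert {x, y} F - {{a, b}}" F] by blast
    with True xy show False
      by (metis doubleton_eq_iff reach_sym)
  next
    case False
    then have abF: "{a, b} \<in> F" using ab by simp
    let ?G = "F - {{a, b}}"
    have "(a, b) \<in> (adjacency (insert {x, y} ?G))\<^sup>*"
      using r False by (simp add: insert_Diff_if)
    moreover have "(a, b) \<notin> (adjacency ?G)\<^sup>*"
      using F abF by (rule forestD)
    ultimately have "(a, x) \<in> (adjacency F)\<^sup>* \<and> (y, b) \<in> (adjacency F)\<^sup>* \<or>
        (a, y) \<in> (adjacency F)\<^sup>* \<and> (x, b) \<in> (adjacency F)\<^sup>*"
      unfolding reach_insert using reach_mono[of ?G F] by blast
    moreover have "(a, b) \<in> (adjacency F)\<^sup>*"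
      using abF by (auto simp: adjacency_def)
    ultimately show False
      using xy by (meson reach_sym rtrancl_trans)
  qed
qed

text \<open>The start is kept apart from the list because in the counting it already belongs to the
  current subtree, while the list holds the new vertices.\<close>

fun path_edges :: "nat \<Rightarrow> nat list \<Rightarrow> edge set" where
  "path_edges a [] = {}"
| "path_edges a (x # xs) = insert {a, x} (path_edges x xs)"

lemma path_edges_append:
  "path_edges a (xs @ ys) = path_edges a xs \<union> path_edges (last (a # xs)) ys"
  by (induction xs arbitrary: a) auto

lemma path_edges_reach: "(a, last (a # xs)) \<in> (adjacency (path_edges a xs))\<^sup>*"
proof (induction xs arbitrary: a)
  case (Cons x xs)
  have "(x, last (x # xs)) \<in> (adjacency (path_edges a (x # xs)))\<^sup>*"
    using reach_mono[OF subset_insertI Cons[of x], of "{a, x}"] by simp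
  moreover have "(a, x) \<in> adjacency (path_edges a (x # xs))"
    by (simp add: adjacency_def)
  ultimately show ?case
    by (simp add: converse_rtrancl_into_rtrancl)
qed simp

lemma path_edges_nth:
  "path_edges a xs = (\<lambda>i. {(a # xs) ! i, (a # xs) ! Suc i}) ` {..<length xs}"
proof (induction xs arbitrary: a)
  case (Cons x xs)
  have "{..<length (x # xs)} = insert 0 (Suc ` {..<length xs})"
    by (auto simp: lessThan_Suc_eq_insert_0)
  then show ?case
    unfolding path_edges.simps(2) Cons by (auto simp: image_image)
qed simp

text \<open>Loops are erased on the fly, so that a walk from a vertex of \<open>A\<close> yields a simple path that
  leaves \<open>A\<close> immediately.\<close>

lemma walk_imp_path:
  assumes "x \<in> A" "(x, v) \<in> (adjacency T) ^^ k"
  shows "\<exists>a\<in>A. \<exists>xs. length xs \<le> k \<and> distinct xs \<and> set xs \<inter> A = {} \<and> last (a # xs) = v \<and>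
           path_edges a xs \<subseteq> T"
  using assms(2)
proof (induction k arbitrary: v)
  case 0
  then show ?case using assms(1) by (intro bexI[of _ x] exI[of _ "[]"]) auto
next
  case (Suc k)
  then obtain w where w: "(x, w) \<in> (adjacency T) ^^ k" "{w, v} \<in> T"
    by (auto simp: adjacency_def)
  then obtain a xs where IH: "a \<in> A" "length xs \<le> k" "distinct xs" "set xs \<inter> A = {}"
      "last (a # xs) = w" "path_edges a xs \<subseteq> T"
    using Suc.IH by blast
  consider "v \<in> A" | "v \<notin> A" "v \<in> set xs" | "v \<notin> A" "v \<notin> set xs" by blast
  then show ?case
  proof cases
    case 1
    then show ?thesis by (intro bexI[of _ v] exI[of _ "[]"]) auto
  next
    case 2
    then obtain ys zs where "xs = (ys @ [v]) @ zs"
      by (metis split_list append.assoc append_Cons append_Nil)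
    then show ?thesis using IH
      by (intro bexI[of _ a] exI[of _ "ys @ [v]"]) (auto simp: path_edges_append)
  next
    case 3
    then show ?thesis using IH w
      by (intro bexI[of _ a] exI[of _ "xs @ [v]"]) (auto simp: path_edges_append)
  qed
qed

lemma graph_cycle_path:
  assumes "length xs \<ge> 2" "distinct (a # xs)" "path_edges a xs \<subseteq> E" "{last xs, a} \<in> E"
  shows "graph_cycle E (a # xs)"
  unfolding graph_cycle_def
proof (intro conjI allI impI)
  fix i assume i: "i < length (a # xs)"
  show "{(a # xs) ! i, (a # xs) ! (Suc i mod length (a # xs))} \<in> E"
  proof (cases "i < length xs")
    case True
    then have "Suc i mod length (a # xs) = Suc i" by simp
    with True assms(3) show ?thesis
      unfolding path_edges_nth by (simp add: image_subset_iff)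
  next
    case False
    with i have "i = length xs" by simp
    moreover have "xs \<noteq> []" using assms(1) by auto
    ultimately show ?thesis
      using assms(4) by (simp add: last_conv_nth nth_Cons')
  qed
qed (use assms in auto)

text \<open>A simple path around a non-bridge closes up to a cycle with that edge; conversely, a
  cycle without its first edge is a detour around it.\<close>

lemma acyclic_iff_forest:
  assumes "E \<subseteq> all_edges V"
  shows "(\<nexists>vs. graph_cycle E vs) \<longleftrightarrow> forest E"
proof
  assume acyc: "\<nexists>vs. graph_cycle E vs"
  show "forest E"
    unfolding forest_def
  proof (intro allI impI notI)
    fix x y assume xy: "{x, y} \<in> E" and r: "(x, y) \<in> (adjacency (E - {{x, y}}))\<^sup>*"
    have ne: "x \<noteq> y" using xy assms by (auto simp: all_edges_def)
    obtain k where "(x, y) \<in> (adjacency (E - {{x, y}})) ^^ k"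
      using r rtrancl_imp_relpow by blast
    then obtain xs where xs: "distinct xs" "set xs \<inter> {x} = {}" "last (x # xs) = y"
        "path_edges x xs \<subseteq> E - {{x, y}}"
      using walk_imp_path[of x "{x}"] by (metis singletonD singletonI)
    have "xs \<noteq> []" using ne xs(3) by auto
    moreover have "length xs \<noteq> 1"
      using xs(3,4) by (auto simp: length_Suc_conv)
    ultimately have "length xs \<ge> 2"
      by (cases xs) (auto simp: Suc_le_eq)
    moreover have "{last xs, x} \<in> E"
      using xs(3) \<open>xs \<noteq> []\<close> xy by (simp add: insert_commute)
    ultimately have "graph_cycle E (x # xs)"
      using xs by (intro graph_cycle_path) auto
    then show False using acyc by blast
  qed
next
  assume F: "forest E"
  show "\<nexists>vs. graph_cycle E vs"
  proof
    assume "\<exists>vs. graph_cycle E vs"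
    then obtain vs where vs: "graph_cycle E vs" ..
    then obtain a b xs where vs_eq: "vs = a # b # xs" and xs: "xs \<noteq> []" and d: "distinct (a # b # xs)"
      unfolding graph_cycle_def by (cases vs; cases "tl vs"; cases "tl (tl vs)") auto
    have edge: "i < length vs \<Longrightarrow> {vs ! i, vs ! (Suc i mod length vs)} \<in> E" for i
      using vs by (auto simp: graph_cycle_def)
    have ab: "{a, b} \<in> E"
      using edge[of 0] by (simp add: vs_eq)
    have last: "{last xs, a} \<in> E"
      using edge[of "length vs - 1"] xs by (simp add: vs_eq last_conv_nth)
    have path: "path_edges b xs \<subseteq> E - {{a, b}}"
    proof
      fix e assume "e \<in> path_edges b xs"
      then obtain i where i: "i < length xs" "e = {(b # xs) ! i, (b # xs) ! Suc i}"
        unfolding path_edges_nth by auto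
      have "a \<noteq> (b # xs) ! i" "a \<noteq> (b # xs) ! Suc i"
        using d i(1) by (metis distinct.simps(2) length_Cons less_Suc_eq not_less_eq nth_mem)+
      then have "a \<notin> e" using i by auto
      moreover have "e \<in> E"
        using edge[of "Suc i"] i by (simp add: vs_eq)
      ultimately show "e \<in> E - {{a, b}}" by auto
    qed
    have "(b, last xs) \<in> (adjacency (E - {{a, b}}))\<^sup>*"
      using path_edges_reach[of b xs] reach_mono[OF path] xs by simp
    moreover have "(last xs, a) \<in> adjacency (E - {{a, b}})"
      using last d xs by (auto simp: adjacency_def doubleton_eq_iff)
    ultimately have "(b, a) \<in> (adjacency (E - {{a, b}}))\<^sup>*"
      by (rule rtrancl_into_rtrancl)
    then show False
      using forestD[OF F ab] reach_sym by blast
  qed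
qed

lemma is_tree_iff:
  "is_tree V E \<longleftrightarrow> E \<subseteq> all_edges V \<and> connected_graph V E \<and> forest E"
  using acyclic_iff_forest unfolding is_tree_def by blast

subsection \<open>Counting the trees that contain a forest\<close>

definition component :: "nat set \<Rightarrow> edge set \<Rightarrow> nat \<Rightarrow> nat set" where
  "component V E v = {w \<in> V. (v, w) \<in> (adjacency E)\<^sup>*}"

lemma components_eq: "components V E = component V E ` V"
  by (auto simp: components_def component_def)

lemma finite_all_edges: "finite V \<Longrightarrow> finite (all_edges V)"
  by (rule finite_subset[of _ "Pow V"]) (auto simp: all_edges_def)

lemma all_edges_mono: "A \<subseteq> B \<Longrightarrow> all_edges A \<subseteq> all_edges B"
  by (auto simp: all_edges_def)

lemma insert_in_all_edges: "{x, y} \<in> all_edges V \<longleftrightarrow> x \<in> V \<and> y \<in> V \<and> x \<noteq> y"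
  by (auto simp: all_edges_def card_insert_if)

lemma adjacencyD: "E \<subseteq> all_edges V \<Longrightarrow> (x, y) \<in> adjacency E \<Longrightarrow> x \<in> V \<and> y \<in> V \<and> x \<noteq> y"
  using insert_in_all_edges by (auto simp: adjacency_def)

lemma reach_closed:
  assumes "E \<subseteq> all_edges V" "v \<in> V" "(v, w) \<in> (adjacency E)\<^sup>*"
  shows "w \<in> V"
  using assms(3,2) by (induction rule: rtrancl_induct) (use assms(1) adjacencyD in blast)+

lemma self_in_component: "v \<in> V \<Longrightarrow> v \<in> component V E v"
  by (simp add: component_def)

lemma component_eq: "(v, w) \<in> (adjacency E)\<^sup>* \<Longrightarrow> component V E v = component V E w"
  unfolding component_def by (auto dest: reach_sym intro: rtrancl_trans)

lemma component_eq_iff: "v \<in> V \<Longrightarrow> w \<in> V \<Longrightarrow> component V E v = component V E w \<longleftrightarrow> (v, w) \<in> (adjacency E)\<^sup>*"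
  using component_eq[of v w E V] self_in_component[of w V E] by (auto simp: component_def)

lemma component_subset: "component V E v \<subseteq> V"
  by (auto simp: component_def)

lemma card_component_pos: "finite V \<Longrightarrow> v \<in> V \<Longrightarrow> card (component V E v) > 0"
  using self_in_component[of v V E] finite_subset[OF component_subset] by (auto simp: card_gt_0_iff)

lemma finite_components: "finite V \<Longrightarrow> finite (components V E)"
  by (simp add: components_eq)

text \<open>Grouped by components, each class contributes \<open>card C\<close> terms equal to
  \<open>1 / card C\<close>. This evaluates the sum over joining edges in
  \<open>card_trees_containing_forest\<close>.\<close>

lemma sum_inverse_component:
  assumes "finite V"
  shows "(\<Sum>v\<in>V. 1 / real (card (component V E v))) = real (card (components V E))"
proof -
  have "(\<Sum>v\<in>V. 1 / real (card (component V E v))) =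
      (\<Sum>C\<in>component V E ` V. \<Sum>v\<in>{v\<in>V. component V E v = C}. 1 / real (card (component V E v)))"
    using assms by (rule sum.image_gen)
  also have "\<dots> = (\<Sum>C\<in>component V E ` V. 1)"
  proof (rule sum.cong)
    fix C assume "C \<in> component V E ` V"
    then obtain u where u: "u \<in> V" "C = component V E u" by auto
    have "{v\<in>V. component V E v = C} = {v\<in>V. (v, u) \<in> (adjacency E)\<^sup>*}"
      using u component_eq_iff[OF _ u(1), of _ E] by auto
    also have "\<dots> = C" using u reach_sym by (auto simp: component_def)
    finally have "{v\<in>V. component V E v = C} = C" .
    moreover have "(\<Sum>v\<in>{v\<in>V. component V E v = C}. 1 / real (card (component V E v))) =
        (\<Sum>v\<in>{v\<in>V. component V E v = C}. 1 / real (card C))"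
      by (rule sum.cong) auto
    ultimately show "(\<Sum>v\<in>{v\<in>V. component V E v = C}. 1 / real (card (component V E v))) = 1"
      using card_component_pos[OF assms u(1), of E] u by simp
  qed simp
  finally show ?thesis by (simp add: components_eq)
qed

lemma component_insert:
  assumes "x \<in> V" "y \<in> V" "v \<in> V"
  shows "component V (insert {x, y} E) v =
    (if v \<in> component V E x \<union> component V E y then component V E x \<union> component V E y else component V E v)"
proof -
  let ?R = "(adjacency E)\<^sup>*"
  have sym: "(p, q) \<in> ?R \<Longrightarrow> (q, p) \<in> ?R" for p q by (rule reach_sym)
  have trans: "(p, q) \<in> ?R \<Longrightarrow> (q, t) \<in> ?R \<Longrightarrow> (p, t) \<in> ?R" for p q t by (rule rtrancl_trans)
  show ?thesis
  proof (cases "v \<in> component V E x \<union> component V E y")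
    case True
    then have "(x, v) \<in> ?R \<or> (y, v) \<in> ?R" by (auto simp: component_def)
    then have "(v, w) \<in> (adjacency (insert {x, y} E))\<^sup>* \<longleftrightarrow> (x, w) \<in> ?R \<or> (y, w) \<in> ?R" for w
      unfolding reach_insert using sym trans by blast
    with True show ?thesis by (auto simp: component_def)
  next
    case False
    then have "(v, x) \<notin> ?R" "(v, y) \<notin> ?R" using assms sym by (auto simp: component_def)
    with False show ?thesis unfolding component_def reach_insert by auto
  qed
qed

lemma components_insert:
  assumes "x \<in> V" "y \<in> V"
  shows "components V (insert {x, y} E) =
    insert (component V E x \<union> component V E y) (components V E - {component V E x, component V E y})"
proof -
  let ?C = "component V E"
  have eq: "v \<in> ?C u \<longleftrightarrow> ?C v = ?C u" if "u \<in> V" "v \<in> V" for u v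
    using component_eq_iff[of v V u E] that reach_sym by (auto simp: component_def)
  have 1: "component V (insert {x, y} E) v = (if ?C v = ?C x \<or> ?C v = ?C y then ?C x \<union> ?C y else ?C v)"
    if "v \<in> V" for v
    using component_insert[OF assms that, of E] eq assms that by simp
  show ?thesis
    unfolding components_eq
  proof (intro equalityI subsetI)
    fix D assume "D \<in> component V (insert {x, y} E) ` V"
    then obtain v where "v \<in> V" "D = component V (insert {x, y} E) v" by auto
    then show "D \<in> insert (?C x \<union> ?C y) (?C ` V - {?C x, ?C y})"
      using 1[of v] by auto
  next
    fix D assume "D \<in> insert (?C x \<union> ?C y) (?C ` V - {?C x, ?C y})"
    then consider "D = ?C x \<union> ?C y" | v where "v \<in> V" "D = ?C v" "D \<noteq> ?C x" "D \<noteq> ?C y" by auto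
    then show "D \<in> component V (insert {x, y} E) ` V"
    proof cases
      case 1
      then show ?thesis using \<open>x \<in> V\<close> by (intro image_eqI[of _ _ x]) (simp_all add: \<open>\<And>v. v \<in> V \<Longrightarrow> component V (insert {x, y} E) v = _\<close>)
    next
      case 2
      then show ?thesis by (intro image_eqI[of _ _ v]) (simp_all add: \<open>\<And>v. v \<in> V \<Longrightarrow> component V (insert {x, y} E) v = _\<close>)
    qed
  qed
qed

text \<open>Merging blocks of sizes \<open>a\<close> and \<open>b\<close> replaces
  \<open>a * b\<close> by \<open>a + b = a * b * (1 / a + 1 / b)\<close>. The last form has one term
  per endpoint, so the recursion over added edges can be summed explicitly.\<close>

lemma components_insert_card_prod:
  assumes V: "finite V" "x \<in> V" "y \<in> V" and xy: "(x, y) \<notin> (adjacency E)\<^sup>*"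
  shows "card (components V E) = Suc (card (components V (insert {x, y} E)))"
    and "(\<Prod>C\<in>components V (insert {x, y} E). real (card C)) =
      (\<Prod>C\<in>components V E. real (card C)) *
      (1 / real (card (component V E x)) + 1 / real (card (component V E y)))"
proof -
  let ?X = "component V E x" and ?Y = "component V E y"
  let ?R = "components V E - {?X, ?Y}"
  have ne: "?X \<noteq> ?Y" using component_eq_iff[OF V(2,3)] xy by simp
  have disj: "?X \<inter> ?Y = {}"
    using xy unfolding component_def by (auto dest: reach_sym intro: rtrancl_trans)
  have in_C: "?X \<in> components V E" "?Y \<in> components V E" using V by (auto simp: components_eq)
  have fin: "finite (components V E)" "finite ?X" "finite ?Y"
    using V(1) finite_components finite_subset[OF component_subset] by auto
  have notin: "?X \<union> ?Y \<notin> ?R"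
  proof
    assume "?X \<union> ?Y \<in> ?R"
    then obtain v where v: "v \<in> V" "?X \<union> ?Y = component V E v" by (auto simp: components_eq)
    then have "x \<in> component V E v" "y \<in> component V E v" using self_in_component V by blast+
    then show False using xy unfolding component_def by (auto dest: reach_sym intro: rtrancl_trans)
  qed
  have C_eq: "components V E = insert ?X (insert ?Y ?R)" using in_C by auto
  have R: "?X \<notin> insert ?Y ?R" "?Y \<notin> ?R" "finite ?R" using ne fin by auto
  show "card (components V E) = Suc (card (components V (insert {x, y} E)))"
    unfolding components_insert[OF V(2,3)]
    by (subst C_eq) (use R notin in simp)
  have pos: "card ?X > 0" "card ?Y > 0" using card_component_pos V by auto
  have "(\<Prod>C\<in>components V E. real (card C)) = real (card ?X) * (real (card ?Y) * (\<Prod>C\<in>?R. real (card C)))"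
    by (subst C_eq) (use R in simp)
  moreover have "(\<Prod>C\<in>components V (insert {x, y} E). real (card C)) =
      (real (card ?X) + real (card ?Y)) * (\<Prod>C\<in>?R. real (card C))"
    unfolding components_insert[OF V(2,3)]
    using R notin fin disj by (simp add: card_Un_disjoint)
  ultimately show "(\<Prod>C\<in>components V (insert {x, y} E). real (card C)) =
      (\<Prod>C\<in>components V E. real (card C)) *
      (1 / real (card ?X) + 1 / real (card ?Y))"
    using pos by (simp add: field_simps)
qed

lemma component_empty: "v \<in> V \<Longrightarrow> component V {} v = {v}"
  by (auto simp: component_def adjacency_def)

lemma forest_card:
  assumes V: "finite V" and E: "E \<subseteq> all_edges V" "forest E"
  shows "card E + card (components V E) = card V"
proof -
  have "finite E" using E(1) finite_all_edges[OF V] by (rule finite_subset)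
  then show ?thesis using E
  proof (induction E rule: finite_induct)
    case empty
    have "components V {} = (\<lambda>v. {v}) ` V" by (simp add: components_eq component_empty)
    then show ?case by (simp add: card_image)
  next
    case (insert e F)
    then obtain x y where e: "e = {x, y}" by (auto simp: all_edges_def card_2_iff)
    then have xyV: "x \<in> V" "y \<in> V" using insert by (auto simp: insert_in_all_edges)
    have "(x, y) \<notin> (adjacency F)\<^sup>*"
      using forestD[OF insert.prems(2), of x y] insert.hyps e by simp
    then have "card (components V F) = Suc (card (components V (insert e F)))"
      unfolding e by (intro components_insert_card_prod V xyV)
    moreover have "card F + card (components V F) = card V"
      using insert forest_mono[of "insert e F" F] by auto
    ultimately show ?case using insert.hyps by simp
  qed
qed

lemma connected_iff_card_components:
  assumes "finite V"
  shows "connected_graph V E \<longleftrightarrow> card (components V E) = 1"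
proof
  assume c: "connected_graph V E"
  then obtain v where v: "v \<in> V" by (auto simp: connected_graph_def)
  have "component V E w = V" if "w \<in> V" for w
    using c that by (auto simp: connected_graph_def component_def)
  then have "components V E = {V}" using v by (auto simp: components_eq)
  then show "card (components V E) = 1" by simp
next
  assume "card (components V E) = 1"
  then obtain C where C: "component V E ` V = {C}" by (auto simp: components_eq card_1_singleton_iff)
  then have "component V E u = component V E v" if "u \<in> V" "v \<in> V" for u v using that by blast
  moreover have "V \<noteq> {}" using C by auto
  ultimately show "connected_graph V E" unfolding connected_graph_def using component_eq_iff by blast
qed

lemma is_tree_finite: "finite V \<Longrightarrow> is_tree V T \<Longrightarrow> finite T"
  using finite_all_edges finite_subset unfolding is_tree_def by blast

lemma finite_trees: "finite V \<Longrightarrow> finite {T. is_tree V T}"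
  by (rule finite_subset[of _ "Pow (all_edges V)"]) (auto simp: is_tree_def finite_all_edges)

lemma is_tree_card: "finite V \<Longrightarrow> is_tree V T \<Longrightarrow> card T + 1 = card V"
  using forest_card[of V T] connected_iff_card_components[of V T] by (auto simp: is_tree_iff)

lemma card_adjacency:
  assumes V: "finite V" and E: "E \<subseteq> all_edges V"
  shows "card (adjacency E) = 2 * card E"
proof -
  have "finite E" using E(1) finite_all_edges[OF V] by (rule finite_subset)
  then show ?thesis using E
  proof (induction E rule: finite_induct)
    case empty
    show ?case by (simp add: adjacency_def)
  next
    case (insert e F)
    then obtain x y where e: "e = {x, y}" "x \<noteq> y" by (auto simp: all_edges_def card_2_iff)
    have "(x, y) \<notin> adjacency F" "(y, x) \<notin> adjacency F"
      using insert.hyps e by (auto simp: adjacency_def insert_commute)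
    moreover have "finite (adjacency F)"
      using insert.prems V adjacencyD[of F V] by (intro finite_subset[of "adjacency F" "V \<times> V"]) auto
    ultimately show ?case using insert e by (simp add: adjacency_insert)
  qed
qed

lemma tree_containing_tree:
  assumes "finite V" "is_tree V T" "is_tree V F" "F \<subseteq> T"
  shows "T = F"
  using is_tree_card[OF assms(1,2)] is_tree_card[OF assms(1,3)] is_tree_finite[OF assms(1,2)]
    card_subset_eq[OF _ assms(4)] by simp

text \<open>The classical \<open>n^(c - 2)\<close> times the product of the block sizes, for
  \<open>c\<close> components, cleared of the denominator that appears for \<open>c = 1\<close>. The
  empty forest gives Cayley's formula. The induction on \<open>c\<close> counts in two ways the
  pairs of a tree containing \<open>F\<close> and a directed edge of it outside
  \<open>F\<close>.\<close>

theorem card_trees_containing_forest: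
  assumes V: "finite V" "V \<noteq> {}" and F: "F \<subseteq> all_edges V" "forest F"
  shows "real (card {T. is_tree V T \<and> F \<subseteq> T}) * real (card V) ^ 2 =
    real (card V) ^ card (components V F) * (\<Prod>C\<in>components V F. real (card C))"
  using F
proof (induction "card (components V F)" arbitrary: F rule: less_induct)
  case less
  let ?n = "real (card V)" and ?P = "\<Prod>C\<in>components V F. real (card C)"
  define TT where "TT F = {T. is_tree V T \<and> F \<subseteq> T}" for F
  have finTT: "finite (TT G)" for G
    unfolding TT_def by (rule finite_subset[OF _ finite_trees[OF V(1)]]) auto
  have npos: "?n > 0" using V by (simp add: card_gt_0_iff)
  have "components V F \<noteq> {}" using V by (simp add: components_eq)
  then have "card (components V F) \<noteq> 0" using finite_components[OF V(1)] by simp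
  then obtain k where k: "card (components V F) = Suc k" using not0_implies_Suc by blast
  show ?case
  proof (cases "k = 0")
    case True
    then have conn: "connected_graph V F"
      using k V connected_iff_card_components by simp
    then have "is_tree V F" using less.prems by (simp add: is_tree_iff)
    then have "TT F = {F}" using tree_containing_tree[OF V(1)] by (auto simp: TT_def)
    moreover have "components V F = {V}"
    proof -
      have "component V F w = V" if "w \<in> V" for w
        using conn that by (auto simp: connected_graph_def component_def)
      then show ?thesis using V by (auto simp: components_eq)
    qed
    ultimately show ?thesis
      unfolding TT_def by (simp add: power2_eq_square)
  next
    case False
    \<comment> \<open>Directed pairs between different components of \<open>F\<close>. A tree
      containing \<open>F\<close> has \<open>k\<close> further edges and so uses
      \<open>2 * k\<close> of these pairs; conversely, each pair extends \<open>F\<close> to a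
      forest with one component fewer.\<close>
    define X where "X = {(x, y). x \<in> V \<and> y \<in> V \<and> (x, y) \<notin> (adjacency F)\<^sup>*}"
    have finX: "finite X" unfolding X_def using V by (rule_tac finite_subset[of _ "V \<times> V"]) auto
    have card_diff: "card {p\<in>X. {fst p, snd p} \<in> T} = 2 * k" if "T \<in> TT F" for T
    proof -
      have T: "is_tree V T" "F \<subseteq> T" using that by (auto simp: TT_def)
      have "{p\<in>X. {fst p, snd p} \<in> T} = adjacency (T - F)"
      proof (intro equalityI subsetI)
        fix p assume "p \<in> {p\<in>X. {fst p, snd p} \<in> T}"
        then obtain x y where p: "p = (x, y)" "(x, y) \<in> X" "{x, y} \<in> T" by (cases p) auto
        then have "{x, y} \<notin> F" by (auto simp: X_def adjacency_def)
        then show "p \<in> adjacency (T - F)" using p by (auto simp: adjacency_def)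
      next
        fix p assume "p \<in> adjacency (T - F)"
        then obtain x y where p: "p = (x, y)" "{x, y} \<in> T" "{x, y} \<notin> F"
          by (cases p) (auto simp: adjacency_def)
        have "(x, y) \<notin> (adjacency (T - {{x, y}}))\<^sup>*"
          using T p forestD by (auto simp: is_tree_iff)
        then have "(x, y) \<notin> (adjacency F)\<^sup>*"
          using reach_mono[of F "T - {{x, y}}"] T p by blast
        moreover have "x \<in> V" "y \<in> V"
          using T p(2) unfolding is_tree_iff by (auto simp: all_edges_def)
        ultimately show "p \<in> {p\<in>X. {fst p, snd p} \<in> T}"
          using p by (auto simp: X_def)
      qed
      moreover have "T - F \<subseteq> all_edges V" using T by (auto simp: is_tree_iff)
      moreover have "card (T - F) = k"
      proof -
        have "card T + 1 = card V" using is_tree_card V T by blast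
        moreover have "card F + Suc k = card V" using forest_card[OF V(1) less.prems] k by simp
        moreover have "card (T - F) = card T - card F"
          using T finite_subset[OF less.prems(1) finite_all_edges[OF V(1)]] by (intro card_Diff_subset) auto
        ultimately show ?thesis by simp
      qed
      ultimately show ?thesis using card_adjacency[OF V(1)] by simp
    qed
    have step: "real (card (TT (insert {x, y} F))) * ?n ^ 2 =
        ?n ^ k * (?P * (1 / real (card (component V F x)) + 1 / real (card (component V F y))))"
      if xy: "(x, y) \<in> X" for x y
    proof -
      have V': "x \<in> V" "y \<in> V" "(x, y) \<notin> (adjacency F)\<^sup>*" using xy by (auto simp: X_def)
      note c = components_insert_card_prod[OF V(1) V']
      have "x \<noteq> y" using V' by auto
      then have "insert {x, y} F \<subseteq> all_edges V" using V' less.prems by (auto simp: insert_in_all_edges)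
      then show ?thesis
        unfolding TT_def
        using less.hyps[of "insert {x, y} F"] c k forest_insert[OF less.prems(2) V'(3)] by simp
    qed
    have "real (2 * k) * real (card (TT F)) = (\<Sum>T\<in>TT F. real (card {p\<in>X. {fst p, snd p} \<in> T}))"
      using card_diff by simp
    also have "\<dots> = (\<Sum>T\<in>TT F. \<Sum>p\<in>X. if {fst p, snd p} \<in> T then 1 else 0)"
      using finX by (simp add: sum.If_cases Int_def)
    also have "\<dots> = (\<Sum>p\<in>X. \<Sum>T\<in>TT F. if {fst p, snd p} \<in> T then 1 else 0)"
      by (rule sum.swap)
    also have "\<dots> = (\<Sum>p\<in>X. real (card (TT (insert {fst p, snd p} F))))"
    proof (rule sum.cong)
      fix p :: "nat \<times> nat"
      have "TT F \<inter> {T. {fst p, snd p} \<in> T} = TT (insert {fst p, snd p} F)" by (auto simp: TT_def)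
      then show "(\<Sum>T\<in>TT F. if {fst p, snd p} \<in> T then 1 else 0) = real (card (TT (insert {fst p, snd p} F)))"
        using finTT by (simp add: sum.If_cases)
    qed simp
    finally have "real (2 * k) * (real (card (TT F)) * ?n ^ 2) =
        (\<Sum>p\<in>X. real (card (TT (insert {fst p, snd p} F))) * ?n ^ 2)"
      by (simp only: sum_distrib_right[symmetric] mult.assoc[symmetric])
    also have "\<dots> = (\<Sum>p\<in>X. ?n ^ k * ?P * (1 / real (card (component V F (fst p))) + 1 / real (card (component V F (snd p)))))"
      using step by (intro sum.cong) (auto simp: mult.assoc)
    also have "\<dots> = ?n ^ k * ?P * ((\<Sum>p\<in>X. 1 / real (card (component V F (fst p)))) + (\<Sum>p\<in>X. 1 / real (card (component V F (snd p)))))"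
      by (simp only: sum_distrib_left[symmetric] sum.distrib)
    also have "(\<Sum>p\<in>X. 1 / real (card (component V F (snd p)))) = (\<Sum>p\<in>X. 1 / real (card (component V F (fst p))))"
      by (rule sum.reindex_bij_witness[of _ prod.swap prod.swap]) (auto simp: X_def dest: reach_sym)
    \<comment> \<open>A vertex in a block of size \<open>b\<close> has \<open>n - b\<close> partners
      and contributes \<open>n / b - 1\<close>; over all vertices this is
      \<open>n * (k + 1) - n\<close>.\<close>
    also have "(\<Sum>p\<in>X. 1 / real (card (component V F (fst p)))) = ?n * k"
    proof -
      have X_Sigma: "X = Sigma V (\<lambda>x. V - component V F x)" by (auto simp: X_def component_def)
      have "(\<Sum>p\<in>X. 1 / real (card (component V F (fst p)))) =
          (\<Sum>x\<in>V. \<Sum>y\<in>V - component V F x. 1 / real (card (component V F x)))"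
        unfolding X_Sigma using V by (subst sum.Sigma) (auto simp: case_prod_beta)
      also have "\<dots> = (\<Sum>x\<in>V. ?n * (1 / real (card (component V F x))) - 1)"
      proof (rule sum.cong)
        fix x assume x: "x \<in> V"
        have "real (card (V - component V F x)) = ?n - real (card (component V F x))"
          using V finite_subset[OF component_subset] card_mono[OF V(1) component_subset]
          by (subst card_Diff_subset) (auto simp: component_subset of_nat_diff)
        then show "(\<Sum>y\<in>V - component V F x. 1 / real (card (component V F x))) = ?n * (1 / real (card (component V F x))) - 1"
          using card_component_pos[OF V(1) x, of F] by (simp add: field_simps)
      qed simp
      also have "\<dots> = ?n * real (card (components V F)) - ?n"
        by (simp only: sum_subtractf sum_distrib_left[symmetric] sum_inverse_component[OF V(1)]) simp
      finally show ?thesis using k by (simp add: algebra_simps)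
    qed
    finally have "real (2 * k) * (real (card (TT F)) * ?n ^ 2) = real (2 * k) * (?n ^ Suc k * ?P)"
      by (simp add: algebra_simps)
    then have "real (card (TT F)) * ?n ^ 2 = ?n ^ Suc k * ?P"
      using False by (metis mult_cancel_left mult_eq_0_iff of_nat_eq_0_iff zero_neq_numeral)
    then show ?thesis unfolding TT_def using k by simp
  qed
qed

subsection \<open>Volume and height of uniform trees\<close>

lemma is_tree_singleton: "is_tree {x} {}"
  by (simp add: is_tree_iff connected_graph_def forest_empty)

lemma is_tree_leaf:
  assumes T: "is_tree A F" and a: "a \<in> A" and x: "x \<notin> A"
  shows "is_tree (insert x A) (insert {a, x} F)"
proof -
  have F: "F \<subseteq> all_edges A" "connected_graph A F" "forest F" using T by (auto simp: is_tree_iff)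
  have "insert {a, x} F \<subseteq> all_edges (insert x A)"
    using F(1) a x all_edges_mono[of A "insert x A"] insert_in_all_edges[of a x "insert x A"] by blast
  moreover have "connected_graph (insert x A) (insert {a, x} F)"
  proof -
    have 1: "(a, u) \<in> (adjacency (insert {a, x} F))\<^sup>*" if "u \<in> insert x A" for u
      using that F(2) a unfolding reach_insert by (auto simp: connected_graph_def)
    then show ?thesis
      unfolding connected_graph_def using rtrancl_trans[OF reach_sym[OF 1] 1] by simp
  qed
  moreover have "forest (insert {a, x} F)"
    using F x reach_closed[OF F(1) a] by (intro forest_insert) auto
  ultimately show ?thesis by (simp add: is_tree_iff)
qed

lemma is_tree_path:
  assumes "is_tree A F" "a \<in> A" "distinct xs" "set xs \<inter> A = {}"
  shows "is_tree (A \<union> set xs) (F \<union> path_edges a xs)"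
  using assms
proof (induction xs arbitrary: A F a)
  case (Cons x xs)
  have "is_tree (insert x A \<union> set xs) (insert {a, x} F \<union> path_edges x xs)"
    using Cons.prems by (intro Cons.IH is_tree_leaf) auto
  then show ?case by simp
qed simp

lemma path_edges_in_V: "path_edges a xs \<subseteq> all_edges V \<Longrightarrow> set xs \<subseteq> V"
  by (induction xs arbitrary: a) (auto simp: insert_in_all_edges)

text \<open>The components of \<open>F\<close> in \<open>V\<close> are \<open>A\<close> and
  singletons. Dividing by the count for the empty forest gives the probability
  \<open>j / n^(j - 1)\<close> that a uniform tree contains a fixed tree on \<open>j\<close>
  vertices.\<close>

lemma card_trees_containing_tree:
  assumes V: "finite V" "A \<subseteq> V" and F: "is_tree A F"
  shows "real (card {T. is_tree V T \<and> F \<subseteq> T}) =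
    real (card {T. is_tree V T}) * real (card A) / real (card V) ^ (card A - 1)"
proof -
  let ?n = "real (card V)" and ?j = "card A"
  have A: "A \<noteq> {}" "finite A" using F V by (auto simp: is_tree_iff connected_graph_def intro: finite_subset)
  then have V0: "V \<noteq> {}" using V by auto
  have npos: "?n > 0" using V V0 by (simp add: card_gt_0_iff)
  have j: "?j \<ge> 1" "?j \<le> card V" using A V by (auto simp: Suc_le_eq card_gt_0_iff intro: card_mono)
  have FA: "F \<subseteq> all_edges A" "F \<subseteq> all_edges V" "forest F" "connected_graph A F"
    using F all_edges_mono[OF V(2)] by (auto simp: is_tree_iff)
  have compA: "component V F v = A" if "v \<in> A" for v
  proof -
    have "(v, w) \<in> (adjacency F)\<^sup>* \<longleftrightarrow> w \<in> A" for w
      using FA(4) that reach_closed[OF FA(1) that] unfolding connected_graph_def by blast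
    then show ?thesis using V(2) by (auto simp: component_def)
  qed
  have compn: "component V F v = {v}" if "v \<in> V - A" for v
  proof -
    have "w = v" if "(v, w) \<in> (adjacency F)\<^sup>*" for w
      using that \<open>v \<in> V - A\<close> adjacencyD[OF FA(1)] by (auto elim: converse_rtranclE)
    then show ?thesis using that by (auto simp: component_def)
  qed
  have comps: "components V F = insert A ((\<lambda>v. {v}) ` (V - A))"
  proof -
    have "V = A \<union> (V - A)" using V by auto
    then have "components V F = component V F ` A \<union> component V F ` (V - A)"
      unfolding components_eq by blast
    moreover have "component V F ` A = {A}" using A compA by auto
    moreover have "component V F ` (V - A) = (\<lambda>v. {v}) ` (V - A)" using compn by auto
    ultimately show ?thesis by simp
  qed
  have notin: "A \<notin> (\<lambda>v. {v}) ` (V - A)" by auto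
  have "card (components V F) = card V - ?j + 1"
    unfolding comps using notin V A by (simp add: card_image card_Diff_subset)
  moreover have "(\<Prod>C\<in>components V F. real (card C)) = ?j"
    unfolding comps using notin V A by (simp add: prod.reindex)
  ultimately have 1: "real (card {T. is_tree V T \<and> F \<subseteq> T}) * ?n ^ 2 = ?n ^ (card V - ?j + 1) * ?j"
    using card_trees_containing_forest[OF V(1) V0 FA(2,3)] by simp
  have "components V {} = (\<lambda>v. {v}) ` V" by (auto simp: components_eq component_def adjacency_def)
  then have 2: "real (card {T. is_tree V T}) * ?n ^ 2 = ?n ^ card V"
    using card_trees_containing_forest[OF V(1) V0, of "{}"] by (simp add: forest_empty card_image prod.reindex)
  have "real (card {T. is_tree V T \<and> F \<subseteq> T}) * ?n ^ 2 * ?n ^ (?j - 1) = ?n ^ (card V - ?j + 1 + (?j - 1)) * ?j"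
    unfolding 1 by (simp add: power_add)
  also have "card V - ?j + 1 + (?j - 1) = card V" using j by simp
  also have "?n ^ card V * ?j = real (card {T. is_tree V T}) * ?n ^ 2 * ?j" using 2 by simp
  finally show ?thesis using npos by (simp add: field_simps)
qed

lemma card_trees_pos:
  assumes "finite V" "V \<noteq> {}"
  shows "card {T. is_tree V T} > 0"
proof -
  have "card V > 0" using assms by (simp add: card_gt_0_iff)
  have "(\<Prod>C\<in>components V {}. real (card C)) > 0"
    by (rule prod_pos) (auto simp: components_eq component_empty)
  then have "real (card {T. is_tree V T}) * real (card V) ^ 2 > 0"
    using card_trees_containing_forest[OF assms, of "{}"] \<open>card V > 0\<close> by (simp add: forest_empty)
  then show ?thesis by (metis mult_zero_left not_gr_zero of_nat_0 order_less_irrefl)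
qed

definition tree_ball :: "edge set \<Rightarrow> nat \<Rightarrow> nat \<Rightarrow> nat set" where
  "tree_ball T x \<rho> = {v. \<exists>k\<le>\<rho>. (x, v) \<in> (adjacency T) ^^ k}"

text \<open>There are \<open>n^l\<close> lists of length \<open>l\<close>, each of weight
  \<open>n^(-l)\<close>, so every length from 0 to \<open>\<rho>\<close> contributes 1.\<close>

lemma sum_lists_inverse_power:
  assumes V: "finite V" "V \<noteq> {}"
  shows "(\<Sum>xs\<in>{xs. set xs \<subseteq> V \<and> length xs \<le> \<rho>}. 1 / real (card V) ^ length xs) = real \<rho> + 1"
proof -
  let ?S = "{xs. set xs \<subseteq> V \<and> length xs \<le> \<rho>}"
  have fin: "finite ?S" by (rule finite_lists_length_le[OF V(1)])
  have npos: "real (card V) > 0" using V by (simp add: card_gt_0_iff)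
  have "(\<Sum>xs\<in>?S. 1 / real (card V) ^ length xs) =
      (\<Sum>l\<in>{..\<rho>}. \<Sum>xs\<in>{xs\<in>?S. length xs = l}. 1 / real (card V) ^ length xs)"
    by (rule sum.group[symmetric]) (use fin in auto)
  also have "\<dots> = (\<Sum>l\<in>{..\<rho>}. 1)"
  proof (rule sum.cong)
    fix l assume "l \<in> {..\<rho>}"
    then have "{xs\<in>?S. length xs = l} = {xs. set xs \<subseteq> V \<and> length xs = l}" by auto
    then show "(\<Sum>xs\<in>{xs\<in>?S. length xs = l}. 1 / real (card V) ^ length xs) = 1"
      using card_lists_length_eq[OF V(1), of l] npos by simp
  qed simp
  finally show ?thesis by simp
qed

text \<open>Expanding one factor of the \<open>p\<close>-th power, every point of the ball is reached from the current
  subtree \<open>F\<close> by a path of at most \<open>\<rho>\<close> new vertices, and this path is then added to \<open>F\<close>.\<close>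

lemma tree_ball_moment:
  assumes V: "finite V"
  shows "is_tree A F \<Longrightarrow> A \<subseteq> V \<Longrightarrow> x \<in> A \<Longrightarrow>
    (\<Sum>T\<in>{T. is_tree V T \<and> F \<subseteq> T}. real (card (tree_ball T x \<rho>)) ^ p) \<le>
      real (card {T. is_tree V T}) * (real \<rho> + 1) ^ p * (real (card A) + real p * real \<rho>) ^ Suc p /
      real (card V) ^ (card A - 1)"
proof (induction p arbitrary: A F)
  \<comment> \<open>With no factor left, the exact count gives the single factor
    \<open>card A\<close>. Each of the \<open>p\<close> expansions then adds a choice of the
    starting vertex in the current subtree, hence the exponent \<open>Suc p\<close>.\<close>
  case 0
  then show ?case using card_trees_containing_tree[OF V, of A F] by simp
next
  case (Suc p)
  let ?n = "real (card V)" and ?N = "real (card {T. is_tree V T})" and ?j = "card A"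
  define TT where "TT F = {T. is_tree V T \<and> F \<subseteq> T}" for F
  define B where "B T = real (card (tree_ball T x \<rho>))" for T
  \<comment> \<open>The start ranges over all of \<open>A\<close>, since the way from
    \<open>x\<close> to a point of the ball may run inside the current subtree before it leaves
    it.\<close>
  define X where "X = A \<times> {xs. set xs \<subseteq> V \<and> length xs \<le> \<rho>} \<inter> {(a, xs). distinct xs \<and> set xs \<inter> A = {}}"
  define c where "c = ?N * (real \<rho> + 1) ^ p * (real ?j + real (Suc p) * real \<rho>) ^ Suc p / ?n ^ (?j - 1)"
  have A: "finite A" "A \<noteq> {}" using Suc.prems V finite_subset by auto
  have V0: "V \<noteq> {}" using A Suc.prems by auto
  have npos: "?n > 0" using V V0 by (simp add: card_gt_0_iff)
  have finL: "finite {xs. set xs \<subseteq> V \<and> length xs \<le> \<rho>}" by (rule finite_lists_length_le[OF V])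
  have finX: "finite X" unfolding X_def using finL A by auto
  have finTT: "finite (TT G)" for G
    unfolding TT_def by (rule finite_subset[OF _ finite_trees[OF V(1)]]) auto
  have ball_le: "B T \<le> (\<Sum>p\<in>X. if path_edges (fst p) (snd p) \<subseteq> T then 1 else 0)"
    if T: "T \<in> TT F" for T
  proof -
    have TV: "T \<subseteq> all_edges V" using T by (auto simp: TT_def is_tree_iff)
    have "tree_ball T x \<rho> \<subseteq> (\<lambda>p. last (fst p # snd p)) ` {p \<in> X. path_edges (fst p) (snd p) \<subseteq> T}"
    proof
      fix v assume "v \<in> tree_ball T x \<rho>"
      then obtain k where k: "k \<le> \<rho>" "(x, v) \<in> (adjacency T) ^^ k" by (auto simp: tree_ball_def)
      then obtain a xs where xs: "a \<in> A" "length xs \<le> k" "distinct xs" "set xs \<inter> A = {}"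
          "last (a # xs) = v" "path_edges a xs \<subseteq> T"
        using walk_imp_path[OF Suc.prems(3) k(2)] by blast
      moreover have "set xs \<subseteq> V" using xs(6) TV path_edges_in_V by blast
      ultimately have "(a, xs) \<in> {p \<in> X. path_edges (fst p) (snd p) \<subseteq> T}"
        using k(1) by (auto simp: X_def)
      then show "v \<in> (\<lambda>p. last (fst p # snd p)) ` {p \<in> X. path_edges (fst p) (snd p) \<subseteq> T}"
        using xs(5) by (intro image_eqI[of _ _ "(a, xs)"]) auto
    qed
    then have "card (tree_ball T x \<rho>) \<le> card {p \<in> X. path_edges (fst p) (snd p) \<subseteq> T}"
      by (rule surj_card_le[rotated]) (use finX in simp)
    also have "real \<dots> = (\<Sum>p\<in>X. if path_edges (fst p) (snd p) \<subseteq> T then 1 else 0)"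
      using finX by (simp add: sum.If_cases Int_def)
    finally show ?thesis by (simp add: B_def)
  qed
  have B0: "B T \<ge> 0" for T by (simp add: B_def)
  have "(\<Sum>T\<in>TT F. B T ^ Suc p) \<le>
      (\<Sum>T\<in>TT F. \<Sum>q\<in>X. if path_edges (fst q) (snd q) \<subseteq> T then B T ^ p else 0)"
  proof (rule sum_mono)
    fix T assume "T \<in> TT F"
    have "B T ^ Suc p \<le> (\<Sum>q\<in>X. if path_edges (fst q) (snd q) \<subseteq> T then 1 else 0) * B T ^ p"
      using ball_le[OF \<open>T \<in> TT F\<close>] B0 by (auto intro: mult_right_mono)
    also have "\<dots> = (\<Sum>q\<in>X. if path_edges (fst q) (snd q) \<subseteq> T then B T ^ p else 0)"
      unfolding sum_distrib_right by (rule sum.cong) auto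
    finally show "B T ^ Suc p \<le> (\<Sum>q\<in>X. if path_edges (fst q) (snd q) \<subseteq> T then B T ^ p else 0)" .
  qed
  also have "\<dots> = (\<Sum>q\<in>X. \<Sum>T\<in>TT F. if path_edges (fst q) (snd q) \<subseteq> T then B T ^ p else 0)"
    by (rule sum.swap)
  also have "\<dots> \<le> (\<Sum>q\<in>X. c * (1 / ?n ^ length (snd q)))"
  proof (rule sum_mono)
    fix q assume q: "q \<in> X"
    obtain a xs where q_eq: "q = (a, xs)" by (cases q)
    then have xs: "a \<in> A" "set xs \<subseteq> V" "length xs \<le> \<rho>" "distinct xs" "set xs \<inter> A = {}"
      using q by (auto simp: X_def)
    have card: "card (A \<union> set xs) = ?j + length xs"
      using A xs by (subst card_Un_disjoint) (auto simp: distinct_card)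
    have "(\<Sum>T\<in>TT F. if path_edges a xs \<subseteq> T then B T ^ p else 0) =
        (\<Sum>T\<in>TT (F \<union> path_edges a xs). B T ^ p)"
      using finTT by (subst sum.inter_filter[symmetric]) (auto intro!: sum.cong simp: TT_def)
    also have "\<dots> \<le> ?N * (real \<rho> + 1) ^ p * (real (card (A \<union> set xs)) + real p * real \<rho>) ^ Suc p /
        ?n ^ (card (A \<union> set xs) - 1)"
      unfolding TT_def B_def using Suc.prems xs by (intro Suc.IH is_tree_path) auto
    \<comment> \<open>Enlarging the subtree by \<open>length xs\<close> vertices costs the weight
      \<open>n^(- length xs)\<close>, which is balanced by the number of such lists.\<close>
    also have "\<dots> = ?N * (real \<rho> + 1) ^ p * (real ?j + real (length xs) + real p * real \<rho>) ^ Suc p /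
        ?n ^ (?j - 1) * (1 / ?n ^ length xs)"
    proof -
      have "?j + length xs - 1 = (?j - 1) + length xs" using A by (cases ?j) auto
      then show ?thesis unfolding card by (simp add: power_add)
    qed
    also have "\<dots> \<le> c * (1 / ?n ^ length xs)"
      unfolding c_def using xs(3) npos
      by (intro mult_right_mono divide_right_mono mult_left_mono power_mono) (auto simp: algebra_simps)
    finally show "(\<Sum>T\<in>TT F. if path_edges (fst q) (snd q) \<subseteq> T then B T ^ p else 0) \<le>
        c * (1 / ?n ^ length (snd q))"
      by (simp add: q_eq)
  qed
  also have "\<dots> \<le> (\<Sum>q\<in>A \<times> {xs. set xs \<subseteq> V \<and> length xs \<le> \<rho>}. c * (1 / ?n ^ length (snd q)))"
    using A finL npos by (intro sum_mono2) (auto simp: X_def c_def)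
  also have "\<dots> = c * (real ?j * (\<Sum>xs\<in>{xs. set xs \<subseteq> V \<and> length xs \<le> \<rho>}. 1 / ?n ^ length xs))"
    by (simp add: sum.cartesian_product' sum_distrib_left mult_ac)
  also have "\<dots> = c * (real \<rho> + 1) * real ?j"
    unfolding sum_lists_inverse_power[OF V V0] by (simp add: mult_ac)
  also have "\<dots> \<le> c * (real \<rho> + 1) * (real ?j + real (Suc p) * real \<rho>)"
    using npos by (intro mult_left_mono) (auto simp: c_def)
  also have "\<dots> = ?N * (real \<rho> + 1) ^ Suc p * (real ?j + real (Suc p) * real \<rho>) ^ Suc (Suc p) / ?n ^ (?j - 1)"
    by (simp add: c_def)
  finally show ?case by (simp only: TT_def B_def)
qed

section \<open>Tail of the heights, by the estimate of the birthday problem\<close>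

lemma prod_le_exp:
  assumes "h < n"
  shows "real (\<Prod>{n - h..n - 1}) / real n ^ h \<le> exp (- (real h * (real h + 1) / (2 * real n)))"
proof -
  have n: "real n > 0" using assms by simp
  have eq: "real (\<Prod>{n - h..n - 1}) = (\<Prod>i\<in>{1..h}. real n - real i)"
    unfolding of_nat_prod
    by (rule prod.reindex_bij_witness[of _ "\<lambda>i. n - i" "\<lambda>i. n - i"]) (use assms in auto)
  have "real (\<Prod>{n - h..n - 1}) / real n ^ h = (\<Prod>i\<in>{1..h}. (real n - real i) / real n)"
    unfolding eq by (simp add: prod_dividef)
  also have "\<dots> \<le> (\<Prod>i\<in>{1..h}. exp (- (real i / real n)))"
  proof (rule prod_mono)
    fix i assume "i \<in> {1..h}"
    then have "(real n - real i) / real n = 1 + - (real i / real n)" "real n - real i \<ge> 0"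
      using n assms by (auto simp: field_simps)
    then show "0 \<le> (real n - real i) / real n \<and> (real n - real i) / real n \<le> exp (- (real i / real n))"
      using exp_ge_add_one_self[of "- (real i / real n)"] n by auto
  qed
  also have "\<dots> = exp (- (\<Sum>i\<in>{1..h}. real i) / real n)"
    by (simp add: exp_sum[symmetric] sum_negf sum_divide_distrib)
  also have "(\<Sum>i\<in>{1..h}. real i) = real h * (real h + 1) / 2"
    by (induction h) (auto simp: field_simps)
  finally show ?thesis by simp
qed

text \<open>A union bound over vertex sequences: there are \<open>(n - 1) ... (n - h)\<close> of
  them, and a uniform tree contains each with probability \<open>(h + 1) / n^h\<close>. Counting
  only sequences of distinct vertices is what produces the Gaussian factor.\<close>

lemma card_trees_with_path:
  assumes V: "finite V" "w \<in> V"
  shows "real (card {T. is_tree V T \<and> (\<exists>xs. length xs = h \<and> distinct (w # xs) \<and> path_edges w xs \<subseteq> T)}) \<le>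
    real (card {T. is_tree V T}) * ((real h + 1) * exp (- (real h * (real h + 1) / (2 * real (card V)))))"
proof -
  let ?n = "card V" and ?N = "real (card {T. is_tree V T})"
  define Y where "Y = {xs. length xs = h \<and> distinct xs \<and> set xs \<subseteq> V - {w}}"
  let ?S = "{T. is_tree V T \<and> (\<exists>xs. length xs = h \<and> distinct (w # xs) \<and> path_edges w xs \<subseteq> T)}"
  have npos: "?n > 0" using V by (auto simp: card_gt_0_iff)
  have "finite {xs. set xs \<subseteq> V \<and> length xs \<le> h}" by (rule finite_lists_length_le[OF V(1)])
  then have finY: "finite Y" by (rule rev_finite_subset) (auto simp: Y_def)
  have "?S \<subseteq> (\<Union>xs\<in>Y. {T. is_tree V T \<and> path_edges w xs \<subseteq> T})"
  proof
    fix T assume "T \<in> ?S"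
    then obtain xs where T: "is_tree V T" and xs: "length xs = h" "distinct (w # xs)" "path_edges w xs \<subseteq> T"
      by auto
    then have "set xs \<subseteq> V" using path_edges_in_V[of w xs V] by (auto simp: is_tree_iff)
    then show "T \<in> (\<Union>xs\<in>Y. {T. is_tree V T \<and> path_edges w xs \<subseteq> T})"
      using T xs by (auto simp: Y_def)
  qed
  then have "card ?S \<le> card (\<Union>xs\<in>Y. {T. is_tree V T \<and> path_edges w xs \<subseteq> T})"
    using finY finite_trees[OF V(1)] by (intro card_mono) auto
  also have "\<dots> \<le> (\<Sum>xs\<in>Y. card {T. is_tree V T \<and> path_edges w xs \<subseteq> T})"
    by (rule card_UN_le[OF finY])
  finally have "real (card ?S) \<le> (\<Sum>xs\<in>Y. real (card {T. is_tree V T \<and> path_edges w xs \<subseteq> T}))"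
    by (simp flip: of_nat_sum)
  also have "\<dots> = (\<Sum>xs\<in>Y. ?N * (real h + 1) / real ?n ^ h)"
  proof (rule sum.cong)
    fix xs assume xs: "xs \<in> Y"
    have "is_tree ({w} \<union> set xs) ({} \<union> path_edges w xs)"
      using xs is_tree_singleton by (intro is_tree_path) (auto simp: Y_def)
    moreover have "card ({w} \<union> set xs) = h + 1"
      using xs by (auto simp: Y_def distinct_card card_insert_if)
    ultimately show "real (card {T. is_tree V T \<and> path_edges w xs \<subseteq> T}) = ?N * (real h + 1) / real ?n ^ h"
      using card_trees_containing_tree[OF V(1), of "{w} \<union> set xs" "path_edges w xs"] xs V
      by (auto simp: Y_def add_ac)
  qed simp
  also have "\<dots> = real (card Y) * (?N * (real h + 1) / real ?n ^ h)" by simp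
  also have "\<dots> \<le> ?N * ((real h + 1) * exp (- (real h * (real h + 1) / (2 * real ?n))))"
  proof (cases "h < ?n")
    case True
    have "card (V - {w}) = ?n - 1" using V by simp
    then have "card Y = \<Prod>{?n - h..?n - 1}"
      unfolding Y_def using card_lists_distinct_length_eq[of "V - {w}" h] True V
      by (simp add: Suc_diff_Suc)
    then have "real (card Y) / real ?n ^ h \<le> exp (- (real h * (real h + 1) / (2 * real ?n)))"
      using prod_le_exp[OF True] by simp
    then have "(?N * (real h + 1)) * (real (card Y) / real ?n ^ h) \<le>
        (?N * (real h + 1)) * exp (- (real h * (real h + 1) / (2 * real ?n)))"
      by (intro mult_left_mono) auto
    then show ?thesis by (simp add: mult_ac)
  next
    \<comment> \<open>A path with \<open>h + 1\<close> distinct vertices does not fit into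
      \<open>V\<close>.\<close>
    case False
    have "Y = {}"
    proof (rule ccontr)
      assume "Y \<noteq> {}"
      then obtain xs where "length xs = h" "distinct xs" "set xs \<subseteq> V - {w}" by (auto simp: Y_def)
      then have "h \<le> card (V - {w})" using V card_mono[of "V - {w}" "set xs"] by (simp add: distinct_card)
      then show False using False V npos by simp
    qed
    then show ?thesis by simp
  qed
  finally show ?thesis .
qed

subsection \<open>Cutting a tree at an edge\<close>

lemma reach_Un_disjoint:
  assumes "G \<subseteq> all_edges A" "H \<subseteq> all_edges B" "A \<inter> B = {}" "a \<in> A"
    and "(a, b) \<in> (adjacency (G \<union> H))\<^sup>*"
  shows "(a, b) \<in> (adjacency G)\<^sup>*"
proof -
  have "(a, b) \<in> (adjacency G)\<^sup>* \<and> b \<in> A"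
    using assms(5)
  proof (induction rule: rtrancl_induct)
    case (step u v)
    then have "(u, v) \<in> adjacency G"
      using assms(2,3) insert_in_all_edges[of u v B] by (auto simp: adjacency_def)
    then show ?case using step adjacencyD[OF assms(1)] by (blast intro: rtrancl_into_rtrancl)
  qed (use assms in simp)
  then show ?thesis ..
qed

lemma forest_Un_disjoint:
  assumes "G \<subseteq> all_edges A" "H \<subseteq> all_edges B" "A \<inter> B = {}" "forest G" "forest H"
  shows "forest (G \<union> H)"
proof -
  have *: "(x, y) \<notin> (adjacency (G \<union> H - {{x, y}}))\<^sup>*"
    if "G \<subseteq> all_edges A" "H \<subseteq> all_edges B" "A \<inter> B = {}" "forest G" "{x, y} \<in> G" for G H A B x y
  proof
    assume r: "(x, y) \<in> (adjacency (G \<union> H - {{x, y}}))\<^sup>*"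
    have "x \<in> A" using that(1,5) insert_in_all_edges[of x y A] by blast
    moreover have "(x, y) \<in> (adjacency ((G - {{x, y}}) \<union> (H - {{x, y}})))\<^sup>*"
      using r by (simp add: Un_Diff)
    moreover have "G - {{x, y}} \<subseteq> all_edges A" "H - {{x, y}} \<subseteq> all_edges B"
      using that(1,2) by blast+
    ultimately have "(x, y) \<in> (adjacency (G - {{x, y}}))\<^sup>*"
      using reach_Un_disjoint that(3) by blast
    then show False using forestD[OF that(4,5)] by blast
  qed
  show ?thesis
    unfolding forest_def
  proof (intro allI impI)
    fix x y assume "{x, y} \<in> G \<union> H"
    then show "(x, y) \<notin> (adjacency (G \<union> H - {{x, y}}))\<^sup>*"
      using *[OF assms(1-4)] *[OF assms(2,1) _ assms(5)] assms(3) by (auto simp: Un_commute Int_commute)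
  qed
qed

lemma is_tree_glue:
  assumes A: "A \<subseteq> V" "w \<in> A" "y \<in> V - A" and T1: "is_tree A T1" and T2: "is_tree (V - A) T2"
  defines "T \<equiv> insert {w, y} (T1 \<union> T2)"
  shows "is_tree V T" "component V (T - {{w, y}}) w = A"
    "T \<inter> all_edges A = T1" "T \<inter> all_edges (V - A) = T2"
proof -
  have 1: "T1 \<subseteq> all_edges A" "connected_graph A T1" "forest T1" using T1 by (auto simp: is_tree_iff)
  have 2: "T2 \<subseteq> all_edges (V - A)" "connected_graph (V - A) T2" "forest T2" using T2 by (auto simp: is_tree_iff)
  have disj: "A \<inter> (V - A) = {}" by blast
  have wy: "{w, y} \<notin> all_edges A" "{w, y} \<notin> all_edges (V - A)" "{w, y} \<in> all_edges V"
    using A insert_in_all_edges by auto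
  have disj_e: "e \<notin> all_edges (V - A)" if "e \<in> all_edges A" for e
    using that by (auto simp: all_edges_def card_2_iff)
  show "T \<inter> all_edges A = T1" "T \<inter> all_edges (V - A) = T2"
    using 1(1) 2(1) wy disj_e unfolding T_def by auto
  have T_wy: "T - {{w, y}} = T1 \<union> T2" using wy 1 2 by (auto simp: T_def)
  have reach1: "(w, u) \<in> (adjacency (T1 \<union> T2))\<^sup>*" if "u \<in> A" for u
    using 1(2) A that reach_mono[of T1 "T1 \<union> T2"] by (auto simp: connected_graph_def)
  have reach2: "(y, u) \<in> (adjacency (T1 \<union> T2))\<^sup>*" if "u \<in> V - A" for u
    using 2(2) A that reach_mono[of T2 "T1 \<union> T2"] by (auto simp: connected_graph_def)
  have stay: "u \<in> A" if "(w, u) \<in> (adjacency (T1 \<union> T2))\<^sup>*" for u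
    using reach_Un_disjoint[OF 1(1) 2(1) disj A(2) that] reach_closed[OF 1(1) A(2)] by blast
  show "component V (T - {{w, y}}) w = A"
    unfolding T_wy component_def using stay reach1 A by blast
  have "(w, u) \<in> (adjacency T)\<^sup>*" if "u \<in> V" for u
    unfolding T_def reach_insert using reach1 reach2 that by blast
  then have "connected_graph V T"
    unfolding connected_graph_def using A reach_sym[of w _ T] rtrancl_trans[of _ w "adjacency T"] by blast
  moreover have "forest T"
    unfolding T_def using stay A forest_Un_disjoint[OF 1(1) 2(1) disj 1(3) 2(3)] by (intro forest_insert) auto
  moreover have "T \<subseteq> all_edges V"
    unfolding T_def using 1 2 wy A all_edges_mono[of A V] all_edges_mono[of "V - A" V] by blast
  ultimately show "is_tree V T" by (simp add: is_tree_iff)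
qed

lemma is_tree_cut:
  assumes T: "is_tree V T" and wy: "{w, y} \<in> T"
  defines "A \<equiv> component V (T - {{w, y}}) w"
  shows "A \<subseteq> V" "w \<in> A" "y \<in> V - A" "is_tree A (T \<inter> all_edges A)" "is_tree (V - A) (T \<inter> all_edges (V - A))"
    "T = insert {w, y} ((T \<inter> all_edges A) \<union> (T \<inter> all_edges (V - A)))"
proof -
  let ?F = "T - {{w, y}}"
  have TV: "T \<subseteq> all_edges V" and conn: "connected_graph V T" and F: "forest T"
    using T by (auto simp: is_tree_iff)
  then have wyV: "w \<in> V" "y \<in> V" using wy insert_in_all_edges by blast+
  have FV: "?F \<subseteq> all_edges V" using TV by blast
  show AV: "A \<subseteq> V" and wA: "w \<in> A" unfolding A_def using wyV by (auto simp: component_def)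
  have A_iff: "u \<in> A \<longleftrightarrow> (w, u) \<in> (adjacency ?F)\<^sup>*" for u
    unfolding A_def component_def using reach_closed[OF FV wyV(1)] by blast
  show yA: "y \<in> V - A" using forestD[OF F wy] A_iff wyV by blast
  have edge: "a \<in> A \<longleftrightarrow> b \<in> A" if "{a, b} \<in> ?F" for a b
  proof -
    have "(a, b) \<in> adjacency ?F" "(b, a) \<in> adjacency ?F"
      using that by (auto simp: adjacency_def insert_commute)
    then show ?thesis unfolding A_iff by (meson rtrancl_into_rtrancl)
  qed
  have part: "?F \<subseteq> (T \<inter> all_edges A) \<union> (T \<inter> all_edges (V - A))"
  proof
    fix e assume e: "e \<in> ?F"
    then have "e \<in> all_edges V" using FV by blast
    then obtain a b where ab: "e = {a, b}" by (auto simp: all_edges_def card_2_iff)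
    then have "a \<in> V" "b \<in> V" "a \<noteq> b" using e FV insert_in_all_edges by blast+
    then show "e \<in> (T \<inter> all_edges A) \<union> (T \<inter> all_edges (V - A))"
      using e edge ab insert_in_all_edges by auto
  qed
  then show "T = insert {w, y} ((T \<inter> all_edges A) \<union> (T \<inter> all_edges (V - A)))"
    using wy by blast
  have r1: "(w, u) \<in> (adjacency (T \<inter> all_edges A))\<^sup>*" if "u \<in> A" for u
  proof -
    have "(w, u) \<in> (adjacency ?F)\<^sup>*" using that A_iff by simp
    then show ?thesis
    proof (induction rule: rtrancl_induct)
      case (step a b)
      then have "a \<in> A" using A_iff by simp
      moreover have ab: "{a, b} \<in> ?F" using step by (simp add: adjacency_def)
      moreover have "a \<noteq> b" using ab FV insert_in_all_edges by blast
      ultimately have "(a, b) \<in> adjacency (T \<inter> all_edges A)"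
        using edge[OF ab] by (auto simp: adjacency_def insert_in_all_edges)
      then show ?case using step by simp
    qed simp
  qed
  have r2: "(y, u) \<in> (adjacency (T \<inter> all_edges (V - A)))\<^sup>*" if u: "u \<in> V - A" for u
  proof -
    have "insert {w, y} ?F = T" using wy by blast
    then have "(y, u) \<in> (adjacency (insert {w, y} ?F))\<^sup>*"
      using conn u wyV by (simp add: connected_graph_def)
    then have "(y, u) \<in> (adjacency ?F)\<^sup>*"
      unfolding reach_insert using u A_iff by blast
    then have "(y, u) \<in> (adjacency (T \<inter> all_edges (V - A)))\<^sup>* \<and> u \<in> V - A"
    proof (induction rule: rtrancl_induct)
      case (step a b)
      have ab: "{a, b} \<in> ?F" using step by (simp add: adjacency_def)
      moreover have "a \<noteq> b" "b \<in> V" using ab FV insert_in_all_edges by blast+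
      ultimately have "(a, b) \<in> adjacency (T \<inter> all_edges (V - A))" "b \<in> V - A"
        using edge[OF ab] step.IH by (auto simp: adjacency_def insert_in_all_edges)
      then show ?case using step by auto
    qed (use yA in simp)
    then show ?thesis ..
  qed
  have "connected_graph A (T \<inter> all_edges A)"
    unfolding connected_graph_def using wA rtrancl_trans[OF reach_sym[OF r1] r1] by blast
  then show "is_tree A (T \<inter> all_edges A)" using forest_mono[OF F] by (simp add: is_tree_iff)
  have "connected_graph (V - A) (T \<inter> all_edges (V - A))"
    unfolding connected_graph_def using yA rtrancl_trans[OF reach_sym[OF r2] r2] by blast
  then show "is_tree (V - A) (T \<inter> all_edges (V - A))" using forest_mono[OF F] by (simp add: is_tree_iff)
qed

text \<open>Gluing and cutting are inverse to each other. Since \<open>Q\<close> sees only the side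
  of \<open>w\<close>, comparison with the trivial \<open>Q\<close> expresses the independence of
  the two sides given the vertex set \<open>A\<close>.\<close>

lemma card_trees_cut:
  assumes A: "A \<subseteq> V" "w \<in> A" "y \<in> V - A"
  shows "card {T. is_tree V T \<and> {w, y} \<in> T \<and> component V (T - {{w, y}}) w = A \<and> Q (T \<inter> all_edges A)} =
    card {T. is_tree A T \<and> Q T} * card {T. is_tree (V - A) T}"
proof -
  let ?f = "\<lambda>(T1, T2). insert {w, y} (T1 \<union> T2)"
  let ?g = "\<lambda>T. (T \<inter> all_edges A, T \<inter> all_edges (V - A))"
  have "bij_betw ?f ({T. is_tree A T \<and> Q T} \<times> {T. is_tree (V - A) T})
      {T. is_tree V T \<and> {w, y} \<in> T \<and> component V (T - {{w, y}}) w = A \<and> Q (T \<inter> all_edges A)}"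
  proof (rule bij_betw_byWitness[where f' = ?g])
    show "\<forall>p\<in>{T. is_tree A T \<and> Q T} \<times> {T. is_tree (V - A) T}. ?g (?f p) = p"
      using is_tree_glue[OF A] by auto
    show "\<forall>T\<in>{T. is_tree V T \<and> {w, y} \<in> T \<and> component V (T - {{w, y}}) w = A \<and> Q (T \<inter> all_edges A)}. ?f (?g T) = T"
      using is_tree_cut(6)[of V _ w y] by auto
    show "?f ` ({T. is_tree A T \<and> Q T} \<times> {T. is_tree (V - A) T}) \<subseteq>
        {T. is_tree V T \<and> {w, y} \<in> T \<and> component V (T - {{w, y}}) w = A \<and> Q (T \<inter> all_edges A)}"
      using is_tree_glue[OF A] by auto
    show "?g ` {T. is_tree V T \<and> {w, y} \<in> T \<and> component V (T - {{w, y}}) w = A \<and> Q (T \<inter> all_edges A)} \<subseteq>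
        {T. is_tree A T \<and> Q T} \<times> {T. is_tree (V - A) T}"
      using is_tree_cut(4,5)[of V _ w y] by auto
  qed
  then show ?thesis by (simp add: bij_betw_same_card[symmetric] card_cartesian_product)
qed

text \<open>Cutting an edge of a uniform tree leaves two independent uniform trees, so that
  the bound for paths applies to the side of \<open>w\<close>.\<close>

lemma card_trees_with_tall_branch:
  assumes V: "finite V"
  shows "real (card {T. is_tree V T \<and> (\<exists>w y. {w, y} \<in> T \<and> card (component V (T - {{w, y}}) w) \<le> k \<and>
      (\<exists>xs. length xs = h \<and> distinct (w # xs) \<and>
        path_edges w xs \<subseteq> T \<inter> all_edges (component V (T - {{w, y}}) w)))}) \<le>
    real (card V) ^ 2 * (real (card {T. is_tree V T}) *
      ((real h + 1) * exp (- (real h * (real h + 1) / (2 * real k)))))" (is "real (card ?S) \<le> _")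
proof -
  let ?N = "card {T. is_tree V T}"
  define q where "q = (real h + 1) * exp (- (real h * (real h + 1) / (2 * real k)))"
  define P where "P w T \<longleftrightarrow> (\<exists>xs. length xs = h \<and> distinct (w # xs) \<and> path_edges w xs \<subseteq> T)" for w and T :: "edge set"
  define C where "C w y A = {T. is_tree V T \<and> {w, y} \<in> T \<and> component V (T - {{w, y}}) w = A}" for w y A
  define D where "D w y A = {T. is_tree V T \<and> {w, y} \<in> T \<and> component V (T - {{w, y}}) w = A \<and> P w (T \<inter> all_edges A)}" for w y A
  define Sets where "Sets w y = {A. A \<subseteq> V \<and> w \<in> A \<and> y \<in> V - A \<and> card A \<le> k}" for w y
  have finSets: "finite (Sets w y)" for w y
    unfolding Sets_def using V by (rule_tac finite_subset[of _ "Pow V"]) auto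
  have finD: "finite (D w y A)" "finite (C w y A)" for w y A
    unfolding D_def C_def by (rule finite_subset[OF _ finite_trees[OF V]]; auto)+
  have DC: "real (card (D w y A)) \<le> q * real (card (C w y A))" if "A \<in> Sets w y" for w y A
  proof -
    have A: "A \<subseteq> V" "w \<in> A" "y \<in> V - A" "card A \<le> k" using that by (auto simp: Sets_def)
    have fA: "finite A" "card A > 0" using A V finite_subset by (auto simp: card_gt_0_iff)
    have "real (card {T. is_tree A T \<and> P w T}) \<le>
        real (card {T. is_tree A T}) * ((real h + 1) * exp (- (real h * (real h + 1) / (2 * real (card A)))))"
      using card_trees_with_path[OF fA(1) A(2), of h] unfolding P_def by simp
    also have "\<dots> \<le> real (card {T. is_tree A T}) * q"
      unfolding q_def using A fA by (intro mult_left_mono) (auto intro!: divide_left_mono)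
    finally have "real (card {T. is_tree A T \<and> P w T}) * real (card {T. is_tree (V - A) T}) \<le>
        real (card {T. is_tree A T}) * q * real (card {T. is_tree (V - A) T})"
      by (rule mult_right_mono) simp
    moreover have "card (D w y A) = card {T. is_tree A T \<and> P w T} * card {T. is_tree (V - A) T}"
      unfolding D_def by (rule card_trees_cut[OF A(1-3)])
    moreover have "card (C w y A) = card {T. is_tree A T} * card {T. is_tree (V - A) T}"
      unfolding C_def using card_trees_cut[OF A(1-3), of "\<lambda>_. True"] by simp
    ultimately show ?thesis by (simp add: mult_ac)
  qed
  have q0: "q \<ge> 0" by (simp add: q_def)
  \<comment> \<open>For fixed \<open>w\<close> and \<open>y\<close> the classes for different
    \<open>A\<close> are disjoint, so the conditional bounds add up to one factor \<open>?N\<close>;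
    the choice of \<open>w\<close> and \<open>y\<close> costs the factor \<open>n^2\<close>.\<close>
  have sumC: "(\<Sum>A\<in>Sets w y. card (C w y A)) \<le> ?N" for w y
  proof -
    have "(\<Sum>A\<in>Sets w y. card (C w y A)) = card (\<Union>A\<in>Sets w y. C w y A)"
      using finSets finD by (intro card_UN_disjoint[symmetric]) (auto simp: C_def)
    also have "\<dots> \<le> ?N"
      using finite_trees[OF V] by (intro card_mono) (auto simp: C_def)
    finally show ?thesis .
  qed
  have "?S \<subseteq> (\<Union>w\<in>V. \<Union>y\<in>V. \<Union>A\<in>Sets w y. D w y A)"
  proof
    fix T assume "T \<in> ?S"
    then obtain w y where T: "is_tree V T" "{w, y} \<in> T" "card (component V (T - {{w, y}}) w) \<le> k"
        "P w (T \<inter> all_edges (component V (T - {{w, y}}) w))"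
      unfolding P_def by blast
    have "component V (T - {{w, y}}) w \<in> Sets w y" "w \<in> V" "y \<in> V"
      using is_tree_cut[OF T(1,2)] T(3) by (auto simp: Sets_def)
    moreover have "T \<in> D w y (component V (T - {{w, y}}) w)"
      using T by (simp add: D_def)
    ultimately show "T \<in> (\<Union>w\<in>V. \<Union>y\<in>V. \<Union>A\<in>Sets w y. D w y A)" by blast
  qed
  then have "card ?S \<le> card (\<Union>w\<in>V. \<Union>y\<in>V. \<Union>A\<in>Sets w y. D w y A)"
    using V finSets finD by (intro card_mono) auto
  also have "\<dots> \<le> (\<Sum>w\<in>V. \<Sum>y\<in>V. \<Sum>A\<in>Sets w y. card (D w y A))"
    by (intro order_trans[OF card_UN_le] sum_mono V finSets order_refl)
  finally have "real (card ?S) \<le> (\<Sum>w\<in>V. \<Sum>y\<in>V. \<Sum>A\<in>Sets w y. real (card (D w y A)))"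
    by (simp flip: of_nat_sum)
  also have "\<dots> \<le> (\<Sum>w\<in>V. \<Sum>y\<in>V. \<Sum>A\<in>Sets w y. q * real (card (C w y A)))"
    by (intro sum_mono DC)
  also have "\<dots> = (\<Sum>w\<in>V. \<Sum>y\<in>V. q * real (\<Sum>A\<in>Sets w y. card (C w y A)))"
    by (simp add: sum_distrib_left)
  also have "\<dots> \<le> (\<Sum>w\<in>V. \<Sum>y\<in>V. q * real ?N)"
    by (intro sum_mono mult_left_mono of_nat_mono sumC q0)
  also have "\<dots> = real (card V) ^ 2 * (real ?N * q)"
    by (simp add: power2_eq_square)
  finally show ?thesis by (simp add: q_def)
qed

subsection \<open>Rooted trees\<close>

text \<open>Because of \<open>par r = r\<close> the iterates of \<open>par\<close> stop at the root,
  in step with truncated subtraction: the depth after \<open>i\<close> steps is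
  \<open>dep v - i\<close> for every \<open>i\<close>.\<close>

locale rooted_tree =
  fixes V :: "nat set" and T :: "edge set" and r :: nat and par dep :: "nat \<Rightarrow> nat"
  assumes finV: "finite V" and rV: "r \<in> V" and par_r [simp]: "par r = r" and dep_r [simp]: "dep r = 0"
    and par_V: "v \<in> V \<Longrightarrow> par v \<in> V"
    and dep_par: "v \<in> V \<Longrightarrow> v \<noteq> r \<Longrightarrow> dep v = Suc (dep (par v))"
    and T_eq: "T = (\<lambda>v. {v, par v}) ` (V - {r})"

text \<open>\<open>dep\<close> is the graph distance from \<open>r\<close>, and \<open>par\<close>
  picks a neighbour one step closer. The parent edges are pairwise distinct, so there are
  \<open>card V - 1\<close> of them, which exhausts the edges of a tree.\<close>

lemma is_tree_imp_rooted_tree: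
  assumes V: "finite V" and T: "is_tree V T" and r: "r \<in> V"
  obtains par dep where "rooted_tree V T r par dep"
proof -
  define dep where "dep v = (LEAST k. (r, v) \<in> (adjacency T) ^^ k)" for v
  have TV: "T \<subseteq> all_edges V" and conn: "connected_graph V T" using T by (auto simp: is_tree_iff)
  have dep: "(r, v) \<in> (adjacency T) ^^ dep v" if v: "v \<in> V" for v
  proof -
    have "\<exists>k. (r, v) \<in> (adjacency T) ^^ k"
      using conn r v rtrancl_imp_relpow unfolding connected_graph_def by blast
    then show ?thesis unfolding dep_def by (rule LeastI_ex)
  qed
  have dep_le: "dep v \<le> k" if "(r, v) \<in> (adjacency T) ^^ k" for v k
    unfolding dep_def using that by (rule Least_le)
  have dep_r: "dep r = 0" using dep_le[of r 0] by simp
  have ex: "\<exists>u. u \<in> V \<and> {v, u} \<in> T \<and> dep v = Suc (dep u)" if v: "v \<in> V" "v \<noteq> r" for v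
  proof -
    have "dep v \<noteq> 0" using dep[OF v(1)] v(2) by (metis IdE pair_in_Id_conv relpow.simps(1))
    then obtain j where j: "dep v = Suc j" using not0_implies_Suc by blast
    then obtain u where u: "(r, u) \<in> (adjacency T) ^^ j" "(u, v) \<in> adjacency T"
      using dep[OF v(1)] by auto
    then have uV: "u \<in> V" using adjacencyD[OF TV] by blast
    have "(r, v) \<in> (adjacency T) ^^ Suc (dep u)" using dep[OF uV] u(2) by auto
    then have "dep v \<le> Suc (dep u)" by (rule dep_le)
    moreover have "dep u \<le> j" using u(1) by (rule dep_le)
    ultimately have "dep v = Suc (dep u)" using j by simp
    then show ?thesis using u uV by (auto simp: adjacency_def insert_commute)
  qed
  define par where "par v = (if v \<in> V \<and> v \<noteq> r then SOME u. u \<in> V \<and> {v, u} \<in> T \<and> dep v = Suc (dep u) else v)" for v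
  have par: "par v \<in> V \<and> {v, par v} \<in> T \<and> dep v = Suc (dep (par v))" if "v \<in> V" "v \<noteq> r" for v
    using someI_ex[OF ex[OF that]] that by (simp add: par_def)
  have "inj_on (\<lambda>v. {v, par v}) (V - {r})"
  proof (rule inj_onI, rule ccontr)
    fix v w assume vw: "v \<in> V - {r}" "w \<in> V - {r}" "{v, par v} = {w, par w}" "v \<noteq> w"
    then have "v = par w" "w = par v" by (auto simp: doubleton_eq_iff)
    then show False using par[of v] par[of w] vw by simp
  qed
  then have "card ((\<lambda>v. {v, par v}) ` (V - {r})) = card V - 1"
    using V r by (simp add: card_image)
  also have "\<dots> = card T" using is_tree_card[OF V T] by simp
  finally have T_eq: "(\<lambda>v. {v, par v}) ` (V - {r}) = T"
    using par is_tree_finite[OF V T] by (intro card_subset_eq) auto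
  have "rooted_tree V T r par dep"
  proof
    show "par r = r" by (simp add: par_def)
    show "par v \<in> V" if "v \<in> V" for v
      using par[of v] that r by (cases "v = r") (simp_all add: par_def)
    show "dep v = Suc (dep (par v))" if "v \<in> V" "v \<noteq> r" for v using par that by blast
    show "T = (\<lambda>v. {v, par v}) ` (V - {r})" using T_eq by simp
  qed (use V r dep_r in auto)
  then show ?thesis by (rule that)
qed

context rooted_tree
begin

lemma par_neq: "v \<in> V \<Longrightarrow> v \<noteq> r \<Longrightarrow> par v \<noteq> v"
  using dep_par by (metis n_not_Suc_n)

lemma edge_inj: "inj_on (\<lambda>v. {v, par v}) (V - {r})"
proof (rule inj_onI, rule ccontr)
  fix v w assume vw: "v \<in> V - {r}" "w \<in> V - {r}" "{v, par v} = {w, par w}" "v \<noteq> w"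
  then have "v = par w" "w = par v" by (auto simp: doubleton_eq_iff)
  then show False using dep_par[of v] dep_par[of w] vw by simp
qed

lemma edge_in_T: "v \<in> V \<Longrightarrow> v \<noteq> r \<Longrightarrow> {v, par v} \<in> T"
  by (auto simp: T_eq)

lemma T_subset: "T \<subseteq> all_edges V"
  using par_V par_neq by (fastforce simp: T_eq insert_in_all_edges)

lemma iter_V: "v \<in> V \<Longrightarrow> (par ^^ i) v \<in> V"
  by (induction i) (auto simp: par_V)

lemma dep_par': "v \<in> V \<Longrightarrow> dep (par v) = dep v - 1"
  using dep_par by (cases "v = r") auto

lemma dep_iter: "v \<in> V \<Longrightarrow> dep ((par ^^ i) v) = dep v - i"
  by (induction i) (auto simp: dep_par' iter_V)

lemma dep_eq_0: "v \<in> V \<Longrightarrow> dep v = 0 \<Longrightarrow> v = r"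
  using dep_par by (metis nat.distinct(1))

lemma iter_root: "v \<in> V \<Longrightarrow> dep v \<le> i \<Longrightarrow> (par ^^ i) v = r"
  using dep_eq_0[OF iter_V, of v i] dep_iter[of v i] by simp

definition desc :: "nat \<Rightarrow> nat set" where
  "desc w = {v \<in> V. \<exists>i. (par ^^ i) v = w}"

lemma desc_V: "desc w \<subseteq> V"
  by (auto simp: desc_def)

lemma finite_desc: "finite (desc w)"
  using finV desc_V finite_subset by blast

lemma desc_self: "w \<in> V \<Longrightarrow> w \<in> desc w"
  by (auto simp: desc_def intro: exI[of _ 0])

lemma desc_in_V: "v \<in> desc w \<Longrightarrow> w \<in> V"
  using iter_V by (auto simp: desc_def)

lemma desc_trans: "u \<in> desc v \<Longrightarrow> v \<in> desc w \<Longrightarrow> u \<in> desc w"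
  unfolding desc_def by (auto simp flip: funpow_add comp_apply[of "par ^^ _" "par ^^ _"])

lemma iter_desc: "v \<in> V \<Longrightarrow> v \<in> desc ((par ^^ i) v)"
  by (auto simp: desc_def)

lemma desc_iff:
  assumes "v \<in> V" "w \<in> V"
  shows "v \<in> desc w \<longleftrightarrow> dep w \<le> dep v \<and> (par ^^ (dep v - dep w)) v = w"
proof
  assume "v \<in> desc w"
  then obtain i where i: "(par ^^ i) v = w" by (auto simp: desc_def)
  then have d: "dep w = dep v - i" using dep_iter[OF assms(1), of i] by simp
  show "dep w \<le> dep v \<and> (par ^^ (dep v - dep w)) v = w"
  proof (cases "i \<le> dep v")
    case True
    then show ?thesis using d i by simp
  next
    case False
    then have "w = r" using d dep_eq_0 assms(2) by simp
    then show ?thesis using iter_root[OF assms(1), of "dep v"] by simp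
  qed
qed (use assms in \<open>auto simp: desc_def\<close>)

lemma desc_dep: "v \<in> desc w \<Longrightarrow> dep w \<le> dep v"
  using desc_iff[of v w] desc_V desc_in_V by blast

lemma desc_root: "desc r = V"
  using iter_root by (auto simp: desc_def)

lemma par_desc:
  assumes "v \<in> desc w" "v \<noteq> w"
  shows "par v \<in> desc w"
proof -
  obtain i where i: "v \<in> V" "(par ^^ i) v = w" using assms(1) by (auto simp: desc_def)
  then obtain j where "i = Suc j" using assms(2) by (cases i) auto
  then have "(par ^^ j) (par v) = w" using i by (simp add: funpow_swap1)
  then show ?thesis using i par_V by (auto simp: desc_def)
qed

lemma desc_par: "v \<in> V \<Longrightarrow> par v \<in> desc w \<Longrightarrow> v \<in> desc w"
  using desc_trans[of v "par v" w] iter_desc[of v 1] by simp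

text \<open>The ancestors of a vertex form a chain ordered by depth: the longer climb from
  \<open>v\<close> passes through the end of the shorter one.\<close>

lemma desc_comparable:
  assumes "v \<in> desc a" "v \<in> desc b" "dep a \<le> dep b"
  shows "b \<in> desc a"
proof -
  have V: "v \<in> V" "a \<in> V" "b \<in> V" using assms desc_V desc_in_V by blast+
  have a: "dep a \<le> dep v" "(par ^^ (dep v - dep a)) v = a" using desc_iff[OF V(1,2)] assms by auto
  have b: "dep b \<le> dep v" "(par ^^ (dep v - dep b)) v = b" using desc_iff[OF V(1,3)] assms by auto
  have eq: "dep v - dep a = (dep b - dep a) + (dep v - dep b)" using a b assms(3) by simp
  have "(par ^^ (dep v - dep a)) v = (par ^^ (dep b - dep a)) ((par ^^ (dep v - dep b)) v)"
    unfolding eq funpow_add by simp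
  then have "(par ^^ (dep b - dep a)) b = a" unfolding a(2) b(2) by simp
  then show ?thesis using V by (auto simp: desc_def)
qed

lemma desc_antisym: "v \<in> desc w \<Longrightarrow> dep v \<le> dep w \<Longrightarrow> v = w"
  using desc_iff[of v w] desc_V desc_in_V by force

text \<open>The edge above \<open>w\<close> is the only exit of the subtree of \<open>w\<close>.
  Both the description of components in \<open>component_desc\<close> and the confinement of fires
  in \<open>link_desc\<close> rest on this.\<close>

lemma edge_desc:
  assumes g: "g \<in> T" "g \<noteq> {w, par w}" "g \<inter> desc w \<noteq> {}"
  obtains b where "b \<in> desc w" "b \<noteq> w" "b \<noteq> r" "g = {b, par b}" "g \<subseteq> desc w"
proof -
  obtain b where b: "b \<in> V" "b \<noteq> r" "g = {b, par b}" using g(1) by (auto simp: T_eq)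
  then have bw: "b \<noteq> w" using g(2) by auto
  have "b \<in> desc w" using g(3) b desc_par by auto
  then show ?thesis using that[of b] b bw par_desc by auto
qed

lemma component_desc:
  assumes w: "w \<in> V" "w \<noteq> r"
  shows "component V (T - {{w, par w}}) w = desc w"
proof (intro equalityI subsetI)
  fix v assume "v \<in> component V (T - {{w, par w}}) w"
  then have "(w, v) \<in> (adjacency (T - {{w, par w}}))\<^sup>*" by (simp add: component_def)
  then show "v \<in> desc w"
  proof (induction rule: rtrancl_induct)
    case (step a b)
    then have "{a, b} \<in> T" "{a, b} \<noteq> {w, par w}" "{a, b} \<inter> desc w \<noteq> {}"
      by (auto simp: adjacency_def)
    then show ?case by (rule edge_desc) blast
  qed (use w desc_self in simp)
next
  have *: "(w, v) \<in> (adjacency (T - {{w, par w}}))\<^sup>*" if "v \<in> V" "dep v = dep w + i" "(par ^^ i) v = w" for v i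
    using that
  proof (induction i arbitrary: v)
    case (Suc i)
    have vr: "v \<noteq> r" "v \<noteq> w" using Suc.prems by auto
    have "(w, par v) \<in> (adjacency (T - {{w, par w}}))\<^sup>*"
      using Suc.prems vr dep_par[of v] par_V by (intro Suc.IH) (auto simp: funpow_swap1)
    moreover have "{v, par v} \<noteq> {w, par w}"
      using inj_onD[OF edge_inj, of v w] vr Suc.prems(1) w by auto
    then have "(par v, v) \<in> adjacency (T - {{w, par w}})"
      using edge_in_T[of v] vr Suc.prems(1) by (auto simp: adjacency_def insert_commute)
    ultimately show ?case by (rule rtrancl_into_rtrancl)
  qed simp
  fix v assume v: "v \<in> desc w"
  then have "v \<in> V" using desc_V by blast
  moreover have "dep w \<le> dep v" "(par ^^ (dep v - dep w)) v = w"
    using desc_iff[OF \<open>v \<in> V\<close> w(1)] v by auto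
  ultimately show "v \<in> component V (T - {{w, par w}}) w"
    using *[of v "dep v - dep w"] by (simp add: component_def)
qed

text \<open>Translates climbing along \<open>par\<close> into the paths of the counting lemmas,
  inside the subtree of the upper end. The depth bound carries the induction: it shows that the
  appended \<open>v\<close> is new.\<close>

lemma desc_path:
  assumes "v \<in> V" "i \<le> dep v"
  shows "\<exists>xs. length xs = i \<and> distinct ((par ^^ i) v # xs) \<and> last ((par ^^ i) v # xs) = v \<and>
    (\<forall>x\<in>set xs. dep x \<le> dep v) \<and> path_edges ((par ^^ i) v) xs \<subseteq> T \<inter> all_edges (desc ((par ^^ i) v))"
  using assms
proof (induction i arbitrary: v)
  case 0
  show ?case by (intro exI[of _ "[]"]) simp
next
  case (Suc i)
  let ?w = "(par ^^ Suc i) v"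
  have vr: "v \<noteq> r" using Suc.prems by auto
  have w: "?w = (par ^^ i) (par v)" by (simp add: funpow_swap1)
  have dv: "dep v = Suc (dep (par v))" using dep_par Suc.prems vr by blast
  obtain xs where xs: "length xs = i" "distinct (?w # xs)" "last (?w # xs) = par v"
      "\<forall>x\<in>set xs. dep x \<le> dep (par v)" "path_edges ?w xs \<subseteq> T \<inter> all_edges (desc ?w)"
    unfolding w using Suc.IH[of "par v"] par_V Suc.prems dv by auto
  have "dep ?w < dep v" using dep_iter[OF Suc.prems(1), of "Suc i"] dv by simp
  then have "distinct (?w # xs @ [v])" using xs(2,4) dv by fastforce
  moreover have "path_edges ?w (xs @ [v]) \<subseteq> T \<inter> all_edges (desc ?w)"
  proof -
    have "v \<in> desc ?w" "par v \<in> desc ?w"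
      using iter_desc[OF Suc.prems(1), of "Suc i"] iter_desc[of "par v" i] par_V[OF Suc.prems(1)] w by auto
    then have "{par v, v} \<in> T \<inter> all_edges (desc ?w)"
      using edge_in_T[OF Suc.prems(1) vr] par_neq[OF Suc.prems(1) vr]
      by (auto simp: insert_in_all_edges insert_commute)
    then show ?thesis unfolding path_edges_append xs(3) using xs(5) by simp
  qed
  ultimately show ?case
    using xs dv by (intro exI[of _ "xs @ [v]"]) auto
qed

lemma iter_in_ball:
  assumes "v \<in> V" "i \<le> \<rho>"
  shows "v \<in> tree_ball T ((par ^^ i) v) \<rho>"
proof -
  have *: "((par ^^ i) v, v) \<in> (adjacency T) ^^ i" if "i \<le> dep v" "v \<in> V" for i v
    using that
  proof (induction i arbitrary: v)
    case (Suc i)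
    then have vr: "v \<noteq> r" by auto
    have "((par ^^ i) (par v), par v) \<in> (adjacency T) ^^ i"
      using Suc.prems par_V dep_par' by (intro Suc.IH) auto
    moreover have "(par v, v) \<in> adjacency T"
      using edge_in_T[OF Suc.prems(2) vr] by (simp add: adjacency_def insert_commute)
    ultimately show ?case by (auto simp: funpow_swap1)
  qed simp
  show ?thesis
  proof (cases "i \<le> dep v")
    case True
    then show ?thesis using * assms by (auto simp: tree_ball_def)
  next
    case False
    then have "(par ^^ i) v = (par ^^ dep v) v" using iter_root[OF assms(1)] by simp
    then show ?thesis using *[of "dep v" v] assms False unfolding tree_ball_def
      by (metis (mono_tags, lifting) mem_Collect_eq nat_le_linear order_trans order_refl)
  qed
qed

lemma tree_ball_V: "x \<in> V \<Longrightarrow> tree_ball T x \<rho> \<subseteq> V"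
  using reach_closed[OF T_subset] relpow_imp_rtrancl unfolding tree_ball_def by blast

text \<open>Pairs of ancestor and descendant are counted in both orders; a vertex \<open>v\<close>
  has at most \<open>dep v + 1\<close> ancestors, itself included.\<close>

lemma sum_card_desc: "(\<Sum>w\<in>V. card (desc w)) \<le> (\<Sum>v\<in>V. dep v + 1)"
proof -
  have "(\<Sum>w\<in>V. card (desc w)) = (\<Sum>w\<in>V. \<Sum>v\<in>V. if v \<in> desc w then 1 else 0)"
  proof (rule sum.cong)
    fix w
    have "V \<inter> desc w = desc w" using desc_V by blast
    then show "card (desc w) = (\<Sum>v\<in>V. if v \<in> desc w then 1 else 0)"
      using finV by (simp add: sum.If_cases)
  qed simp
  also have "\<dots> = (\<Sum>v\<in>V. \<Sum>w\<in>V. if v \<in> desc w then 1 else 0)" by (rule sum.swap)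
  also have "\<dots> = (\<Sum>v\<in>V. card {w\<in>V. v \<in> desc w})"
    using finV by (simp add: sum.If_cases Int_def)
  also have "\<dots> \<le> (\<Sum>v\<in>V. dep v + 1)"
  proof (rule sum_mono)
    fix v assume v: "v \<in> V"
    have "{w\<in>V. v \<in> desc w} \<subseteq> (\<lambda>i. (par ^^ i) v) ` {..dep v}"
    proof
      fix w assume w: "w \<in> {w\<in>V. v \<in> desc w}"
      then show "w \<in> (\<lambda>i. (par ^^ i) v) ` {..dep v}"
        using desc_iff[OF v, of w] by (intro image_eqI[of _ _ "dep v - dep w"]) auto
    qed
    then have "card {w\<in>V. v \<in> desc w} \<le> card {..dep v}"
      by (rule surj_card_le[rotated]) simp
    then show "card {w\<in>V. v \<in> desc w} \<le> dep v + 1" by simp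
  qed
  finally show ?thesis .
qed

end

section \<open>Counting the vertices with a large subtree\<close>

context rooted_tree
begin

definition heavy :: "nat \<Rightarrow> nat set" where
  "heavy m = {w \<in> V. m \<le> card (desc w)}"

lemma finite_heavy: "finite (heavy m)"
  using finV by (simp add: heavy_def)

lemma heavy_iter: "v \<in> heavy m \<Longrightarrow> (par ^^ i) v \<in> heavy m"
proof -
  assume v: "v \<in> heavy m"
  then have "v \<in> V" by (simp add: heavy_def)
  then have "desc v \<subseteq> desc ((par ^^ i) v)" using desc_trans iter_desc by blast
  then have "card (desc v) \<le> card (desc ((par ^^ i) v))" by (rule card_mono[OF finite_desc])
  then show ?thesis using v iter_V by (auto simp: heavy_def)
qed

text \<open>Markov's inequality for the subtree sizes, whose sum is controlled by the
  depths.\<close>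

lemma card_heavy_mult_le:
  assumes D: "\<And>v. v \<in> V \<Longrightarrow> dep v \<le> D"
  shows "card (heavy m) * m \<le> card V * (D + 1)"
proof -
  have "card (heavy m) * m = (\<Sum>w\<in>heavy m. m)" by simp
  also have "\<dots> \<le> (\<Sum>w\<in>heavy m. card (desc w))" by (rule sum_mono) (simp add: heavy_def)
  also have "\<dots> \<le> (\<Sum>w\<in>V. card (desc w))" by (rule sum_mono2[OF finV]) (auto simp: heavy_def)
  also have "\<dots> \<le> (\<Sum>v\<in>V. dep v + 1)" by (rule sum_card_desc)
  also have "\<dots> \<le> (\<Sum>v\<in>V. D + 1)" using D by (intro sum_mono) auto
  finally show ?thesis by simp
qed

text \<open>Every vertex is within distance \<open>h\<close> of a heavy one, and the heavy vertices are covered by the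
  balls of radius \<open>2h\<close> around the root and the vertices \<open>y\<close> of depth divisible by \<open>h\<close> that have a heavy
  descendant \<open>h\<close> levels below. Each such \<open>y\<close> has its own \<open>h\<close> heavy vertices on the way to that descendant.\<close>

lemma card_le_heavy:
  assumes ball: "\<And>x \<rho>. x \<in> V \<Longrightarrow> 1 \<le> \<rho> \<Longrightarrow> real (card (tree_ball T x \<rho>)) \<le> K * real \<rho> ^ 2"
    and h: "1 \<le> h" and m: "m \<le> card V"
    and light: "\<And>w v i. w \<in> V \<Longrightarrow> card (desc w) < m \<Longrightarrow> v \<in> V \<Longrightarrow> i \<le> dep v \<Longrightarrow> (par ^^ i) v = w \<Longrightarrow> i < h"
  shows "real (card V) \<le> (real (card (heavy m)) / real h + 1) * (K * (3 * real h) ^ 2)"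
proof -
  define Y where "Y = {y \<in> V. h dvd dep y \<and> (\<exists>z\<in>heavy m. dep z = dep y + h \<and> z \<in> desc y)}"
  have finY: "finite Y" and YV: "Y \<subseteq> V" using finV by (auto simp: Y_def)
  have "\<forall>y\<in>Y. \<exists>z. z \<in> heavy m \<and> dep z = dep y + h \<and> z \<in> desc y" by (auto simp: Y_def)
  then obtain z where z: "\<And>y. y \<in> Y \<Longrightarrow> z y \<in> heavy m \<and> dep (z y) = dep y + h \<and> z y \<in> desc y"
    by metis
  have zV: "z y \<in> V" if "y \<in> Y" for y using z[OF that] by (simp add: heavy_def)
  \<comment> \<open>The ancestors used have depths from \<open>dep y\<close> to
    \<open>dep y + h - 1\<close>. Starting at \<open>Suc i\<close> leaves out \<open>z y\<close>
    itself, so that division of the depth by \<open>h\<close> recovers \<open>dep y\<close>, and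
    with it \<open>y\<close> as the ancestor of that depth.\<close>
  let ?f = "\<lambda>(y, i). (par ^^ Suc i) (z y)"
  have f_dep: "dep (?f (y, i)) = dep y + (h - Suc i)" if "y \<in> Y" "i < h" for y i
    using dep_iter[OF zV[OF that(1)], of "Suc i"] z[OF that(1)] that by simp
  have f_desc: "?f (y, i) \<in> desc y" if y: "y \<in> Y" "i < h" for y i
  proof -
    have "z y \<in> desc y" "z y \<in> desc (?f (y, i))" using z[OF y(1)] iter_desc[OF zV[OF y(1)], of "Suc i"] by auto
    then show ?thesis using f_dep[OF y] by (auto intro: desc_comparable)
  qed
  have "inj_on ?f (Y \<times> {..<h})"
  proof (rule inj_onI, clarify)
    fix y i y' i'
    assume y: "y \<in> Y" "i < h" and y': "y' \<in> Y" "i' < h"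
      and eq: "(par ^^ Suc i) (z y) = (par ^^ Suc i') (z y')"
    have dvd: "h dvd dep y" "h dvd dep y'" using y y' by (auto simp: Y_def)
    have d: "dep y + (h - Suc i) = dep y' + (h - Suc i')" using f_dep[OF y] f_dep[OF y'] eq by simp
    have "(a + c) div h = a div h" if "h dvd a" "c < h" for a c
      using that by (simp add: div_plus_div_distrib_dvd_left)
    then have "(dep y + (h - Suc i)) div h = dep y div h" "(dep y' + (h - Suc i')) div h = dep y' div h"
      using dvd h by auto
    then have "dep y div h = dep y' div h" using d by simp
    then have dep: "dep y = dep y'" using dvd by (metis dvd_div_mult_self)
    have "(par ^^ Suc i) (z y) \<in> desc y" "(par ^^ Suc i) (z y) \<in> desc y'"
      using f_desc[OF y] f_desc[OF y'] eq by (simp_all del: funpow.simps)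
    then have "y' \<in> desc y" by (rule desc_comparable) (simp add: dep)
    then have "y' = y" by (rule desc_antisym) (simp add: dep)
    moreover have "i = i'" using d dep y y' by simp
    ultimately show "y = y' \<and> i = i'" by simp
  qed
  moreover have "?f ` (Y \<times> {..<h}) \<subseteq> heavy m"
  proof (rule image_subsetI)
    fix p assume "p \<in> Y \<times> {..<h}"
    then have "z (fst p) \<in> heavy m" using z by auto
    then show "?f p \<in> heavy m"
      using heavy_iter[of "z (fst p)" m "Suc (snd p)"] by (simp add: case_prod_beta del: funpow.simps)
  qed
  ultimately have "card (Y \<times> {..<h}) \<le> card (heavy m)"
    using finite_heavy by (rule card_inj_on_le)
  then have Yh: "card Y * h \<le> card (heavy m)" by (simp add: card_cartesian_product)
  have cover: "V \<subseteq> (\<Union>x\<in>insert r Y. tree_ball T x (3 * h))"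
  proof
    fix v assume v: "v \<in> V"
    have rH: "r \<in> heavy m" using rV m desc_root by (simp add: heavy_def)
    \<comment> \<open>If \<open>i\<close> is positive, the vertex just below the first heavy
      ancestor is light, and \<open>v\<close> hangs \<open>i - 1\<close> levels below it; hence
      \<open>i - 1 < h\<close>.\<close>
    define i where "i = (LEAST i. (par ^^ i) v \<in> heavy m)"
    have ex: "(par ^^ dep v) v \<in> heavy m" using iter_root[OF v, of "dep v"] rH by simp
    have iH: "(par ^^ i) v \<in> heavy m" unfolding i_def by (rule LeastI[of "\<lambda>i. (par ^^ i) v \<in> heavy m", OF ex])
    have i_dep: "i \<le> dep v" unfolding i_def by (rule Least_le[of "\<lambda>i. (par ^^ i) v \<in> heavy m", OF ex])
    have i_h: "i \<le> h"
    proof (cases i)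
      case (Suc j)
      then have "(par ^^ j) v \<notin> heavy m" using not_less_Least[of j "\<lambda>i. (par ^^ i) v \<in> heavy m"] i_def by simp
      then have "card (desc ((par ^^ j) v)) < m" using iter_V[OF v] by (auto simp: heavy_def)
      then have "j < h" using light[OF iter_V[OF v] _ v, of j j] i_dep Suc by simp
      then show ?thesis using Suc by simp
    qed simp
    let ?y = "(par ^^ i) v"
    have yV: "?y \<in> V" using iter_V[OF v] .
    show "v \<in> (\<Union>x\<in>insert r Y. tree_ball T x (3 * h))"
    proof (cases "dep ?y < h")
      case True
      have "(par ^^ (dep ?y + i)) v = r" using iter_root[OF yV, of "dep ?y"] by (simp add: funpow_add)
      then have "v \<in> tree_ball T r (3 * h)" using iter_in_ball[OF v, of "dep ?y + i" "3 * h"] True i_h by simp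
      then show ?thesis by simp
    next
      case False
      \<comment> \<open>Climb to a depth divisible by \<open>h\<close>, and from there
        \<open>h\<close> levels more: \<open>y'\<close> is itself the heavy vertex that puts
        \<open>y''\<close> into \<open>Y\<close>. With the \<open>i\<close> steps before, this makes
        at most \<open>3 * h\<close>.\<close>
      define y' where "y' = (par ^^ (dep ?y mod h)) ?y"
      define y'' where "y'' = (par ^^ h) y'"
      have y'V: "y' \<in> V" "y' \<in> heavy m" unfolding y'_def using iter_V[OF yV] heavy_iter[OF iH] by auto
      have dy': "dep y' = h * (dep ?y div h)" unfolding y'_def dep_iter[OF yV] by (simp add: minus_mod_eq_mult_div)
      have "dep ?y div h \<ge> 1" using False h by (simp add: Suc_le_eq div_greater_zero_iff)
      then have "dep y' \<ge> h" unfolding dy' by simp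
      moreover have dy'': "dep y'' = dep y' - h" unfolding y''_def by (rule dep_iter[OF y'V(1)])
      ultimately have "dep y' = dep y'' + h" by simp
      moreover have "h dvd dep y''" unfolding dy'' dy' by (metis dvd_diff_nat dvd_refl dvd_triv_left)
      moreover have "y' \<in> desc y''" unfolding y''_def by (rule iter_desc[OF y'V(1)])
      moreover have "y'' \<in> V" unfolding y''_def by (rule iter_V[OF y'V(1)])
      ultimately have "y'' \<in> Y" using y'V unfolding Y_def by auto
      moreover have "(par ^^ (h + dep ?y mod h + i)) v = y''"
        unfolding y''_def y'_def by (simp add: funpow_add)
      moreover have "h + dep ?y mod h + i \<le> 3 * h"
        using i_h mod_less_divisor[of h "dep ?y"] h by linarith
      ultimately have "v \<in> tree_ball T y'' (3 * h)" using iter_in_ball[OF v] by metis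
      then show ?thesis using \<open>y'' \<in> Y\<close> by blast
    qed
  qed
  have fin_ball: "finite (tree_ball T x \<rho>)" if "x \<in> V" for x \<rho>
    using tree_ball_V[OF that] finV by (rule finite_subset)
  have "card V \<le> card (\<Union>x\<in>insert r Y. tree_ball T x (3 * h))"
    using cover fin_ball finY YV rV by (intro card_mono) auto
  also have "\<dots> \<le> (\<Sum>x\<in>insert r Y. card (tree_ball T x (3 * h)))"
    using finY by (intro card_UN_le) simp
  finally have "real (card V) \<le> (\<Sum>x\<in>insert r Y. real (card (tree_ball T x (3 * h))))"
    by (simp only: of_nat_sum[symmetric] of_nat_le_iff)
  also have "\<dots> \<le> (\<Sum>x\<in>insert r Y. K * real (3 * h) ^ 2)"
    using YV rV h by (intro sum_mono ball) auto
  also have "\<dots> = real (card (insert r Y)) * (K * real (3 * h) ^ 2)" by simp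
  also have "\<dots> \<le> (real (card (heavy m)) / real h + 1) * (K * real (3 * h) ^ 2)"
  proof (rule mult_right_mono)
    have "real (card Y) * real h \<le> real (card (heavy m))" using Yh by (metis of_nat_le_iff of_nat_mult)
    then have "real (card Y) \<le> real (card (heavy m)) / real h" using h by (simp add: field_simps)
    moreover have "card (insert r Y) \<le> card Y + 1" using finY by (simp add: card_insert_if)
    ultimately show "real (card (insert r Y)) \<le> real (card (heavy m)) / real h + 1" by linarith
    have "0 \<le> real (card (tree_ball T r (3 * h)))" by simp
    also have "\<dots> \<le> K * real (3 * h) ^ 2" using h by (intro ball rV) auto
    finally show "0 \<le> K * real (3 * h) ^ 2" .
  qed
  finally show ?thesis by simp
qed

section \<open>The path from \<open>x\<close> down to \<open>v\<close>, and the distance of the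
  subtree of \<open>x\<close> from it\<close>

definition spine :: "nat \<Rightarrow> nat \<Rightarrow> nat set" where
  "spine x v = {y \<in> V. v \<in> desc y \<and> y \<in> desc x}"

text \<open>The number of edges that a fire lit on the edge above \<open>u\<close> needs in order to reach the spine; the edge
  itself counts, hence the maximum.\<close>

definition hit :: "nat \<Rightarrow> nat \<Rightarrow> nat \<Rightarrow> nat" where
  "hit x v u = max 1 (LEAST i. (par ^^ i) u \<in> spine x v)"

lemma top_in_spine: "v \<in> desc x \<Longrightarrow> x \<in> spine x v"
  using desc_in_V desc_self by (auto simp: spine_def)

lemma spine_eq: "y \<in> spine x v \<Longrightarrow> z \<in> spine x v \<Longrightarrow> dep y = dep z \<Longrightarrow> y = z"
  using desc_comparable[of v z y] desc_antisym[of y z] by (auto simp: spine_def)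

lemma spine_iter:
  assumes y: "y \<in> spine x v" and i: "i \<le> dep y - dep x"
  shows "(par ^^ i) y \<in> spine x v"
proof -
  have yV: "y \<in> V" "v \<in> desc y" "y \<in> desc x" using y by (auto simp: spine_def)
  have "y \<in> desc ((par ^^ i) y)" by (rule iter_desc[OF yV(1)])
  moreover have "dep x \<le> dep ((par ^^ i) y)" using dep_iter[OF yV(1)] i desc_dep[OF yV(3)] by simp
  ultimately have "(par ^^ i) y \<in> desc x" using desc_comparable[OF yV(3)] by blast
  then show ?thesis
    using desc_trans[OF yV(2) \<open>y \<in> desc ((par ^^ i) y)\<close>] iter_V[OF yV(1)] by (simp add: spine_def)
qed

lemma hit_Least:
  assumes "v \<in> desc x" "u \<in> desc x"
  shows "(par ^^ (LEAST i. (par ^^ i) u \<in> spine x v)) u \<in> spine x v"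
    and "(LEAST i. (par ^^ i) u \<in> spine x v) \<le> dep u - dep x"
proof -
  have "(par ^^ (dep u - dep x)) u = x"
    using desc_iff[of u x] assms(2) desc_V desc_in_V[OF assms(2)] by blast
  then have ex: "(par ^^ (dep u - dep x)) u \<in> spine x v" using top_in_spine[OF assms(1)] by simp
  show "(par ^^ (LEAST i. (par ^^ i) u \<in> spine x v)) u \<in> spine x v"
    by (rule LeastI[of "\<lambda>i. (par ^^ i) u \<in> spine x v", OF ex])
  show "(LEAST i. (par ^^ i) u \<in> spine x v) \<le> dep u - dep x"
    by (rule Least_le[of "\<lambda>i. (par ^^ i) u \<in> spine x v", OF ex])
qed

text \<open>The spine has at most \<open>L / \<rho> + 1\<close> vertices at relative depths
  divisible by \<open>\<rho>\<close>, and balls of radius \<open>2 * \<rho>\<close> around them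
  contain every \<open>u\<close> counted. Each has volume at most \<open>4 * K * \<rho>^2\<close>,
  so the total grows only linearly in \<open>\<rho>\<close>.\<close>

lemma card_hit_le:
  assumes ball: "\<And>x \<rho>. x \<in> V \<Longrightarrow> 1 \<le> \<rho> \<Longrightarrow> real (card (tree_ball T x \<rho>)) \<le> K * real \<rho> ^ 2"
    and L: "\<And>u. u \<in> desc x \<Longrightarrow> dep u \<le> dep x + L"
    and v: "v \<in> desc x" and \<rho>: "1 \<le> \<rho>" "\<rho> \<le> L"
  shows "real (card {u \<in> desc x. hit x v u \<le> \<rho>}) \<le> 8 * K * real L * real \<rho>"
proof -
  define Q where "Q = {y \<in> spine x v. \<rho> dvd dep y - dep x}"
  have QV: "Q \<subseteq> V" by (auto simp: Q_def spine_def)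
  have finQ: "finite Q" using QV finV finite_subset by blast
  have fin_ball: "finite (tree_ball T x \<rho>)" if "x \<in> V" for x \<rho>
    using tree_ball_V[OF that] finV by (rule finite_subset)
  have K0: "0 \<le> K"
  proof -
    have "0 \<le> real (card (tree_ball T r 1))" by simp
    also have "\<dots> \<le> K * real 1 ^ 2" by (intro ball rV) auto
    finally show ?thesis by simp
  qed
  have "inj_on (\<lambda>y. (dep y - dep x) div \<rho>) Q"
  proof (rule inj_onI)
    fix y z assume yz: "y \<in> Q" "z \<in> Q" "(dep y - dep x) div \<rho> = (dep z - dep x) div \<rho>"
    then have "dep y - dep x = dep z - dep x" unfolding Q_def by (metis (mono_tags, lifting) dvd_div_mult_self mem_Collect_eq)
    moreover have "dep x \<le> dep y" "dep x \<le> dep z" using yz desc_dep by (auto simp: Q_def spine_def)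
    ultimately have "dep y = dep z" by simp
    then show "y = z" using yz spine_eq by (auto simp: Q_def)
  qed
  moreover have "(\<lambda>y. (dep y - dep x) div \<rho>) ` Q \<subseteq> {..L div \<rho>}"
  proof (rule image_subsetI)
    fix y assume "y \<in> Q"
    then have "dep y \<le> dep x + L" using L by (auto simp: Q_def spine_def)
    then show "(dep y - dep x) div \<rho> \<in> {..L div \<rho>}" by (auto intro!: div_le_mono)
  qed
  ultimately have "card Q \<le> card {..L div \<rho>}" by (rule card_inj_on_le) simp
  then have "real (card Q) \<le> real (L div \<rho>) + 1" by simp
  also have "real (L div \<rho>) \<le> real L / real \<rho>" by (rule of_nat_div_le_of_nat)
  finally have cQ: "real (card Q) \<le> real L / real \<rho> + 1" by simp
  have "{u \<in> desc x. hit x v u \<le> \<rho>} \<subseteq> (\<Union>y\<in>Q. tree_ball T y (2 * \<rho>))"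
  proof
    fix u assume u: "u \<in> {u \<in> desc x. hit x v u \<le> \<rho>}"
    then have uV: "u \<in> V" using desc_V by blast
    define i where "i = (LEAST i. (par ^^ i) u \<in> spine x v)"
    define q where "q = (par ^^ i) u"
    define j where "j = (dep q - dep x) mod \<rho>"
    have i: "i \<le> \<rho>" using u by (simp add: hit_def i_def)
    have q: "q \<in> spine x v" unfolding q_def i_def using hit_Least(1)[OF v] u by blast
    have qV: "q \<in> V" "q \<in> desc x" using q by (auto simp: spine_def)
    have "(par ^^ j) q \<in> spine x v" by (rule spine_iter[OF q]) (simp add: j_def)
    moreover have "dep ((par ^^ j) q) - dep x = (dep q - dep x) - j" using dep_iter[OF qV(1)] by simp
    then have "\<rho> dvd dep ((par ^^ j) q) - dep x" by (simp add: j_def minus_mod_eq_mult_div)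
    ultimately have "(par ^^ j) q \<in> Q" by (simp add: Q_def)
    moreover have "(par ^^ j) q = (par ^^ (j + i)) u" by (simp add: q_def funpow_add)
    moreover have "j + i \<le> 2 * \<rho>" using i mod_less_divisor[of \<rho> "dep q - dep x"] \<rho> unfolding j_def by linarith
    ultimately show "u \<in> (\<Union>y\<in>Q. tree_ball T y (2 * \<rho>))" using iter_in_ball[OF uV] by (metis UN_I)
  qed
  then have "card {u \<in> desc x. hit x v u \<le> \<rho>} \<le> card (\<Union>y\<in>Q. tree_ball T y (2 * \<rho>))"
    using finQ QV fin_ball by (intro card_mono) auto
  also have "\<dots> \<le> (\<Sum>y\<in>Q. card (tree_ball T y (2 * \<rho>)))" by (rule card_UN_le[OF finQ])
  finally have "real (card {u \<in> desc x. hit x v u \<le> \<rho>}) \<le> (\<Sum>y\<in>Q. real (card (tree_ball T y (2 * \<rho>))))"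
    by (simp only: of_nat_sum[symmetric] of_nat_le_iff)
  also have "\<dots> \<le> (\<Sum>y\<in>Q. K * real (2 * \<rho>) ^ 2)"
    using QV \<rho> by (intro sum_mono ball) auto
  also have "\<dots> = real (card Q) * (K * (4 * real \<rho> ^ 2))" by (simp add: power_mult_distrib)
  also have "\<dots> \<le> (2 * real L / real \<rho>) * (K * (4 * real \<rho> ^ 2))"
  proof (rule mult_right_mono)
    have "1 \<le> real L / real \<rho>" using \<rho> by simp
    then show "real (card Q) \<le> 2 * real L / real \<rho>" using cQ by simp
  qed (use K0 in simp)
  also have "\<dots> = 8 * K * real L * real \<rho>" using \<rho> by (simp add: power2_eq_square)
  finally show ?thesis .
qed

text \<open>Summation by parts against the linear bound of \<open>card_hit_le\<close>: the weights
  \<open>1 / (\<rho> * (\<rho> + 1))\<close> leave a harmonic sum, so that the whole subtree costs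
  only its height \<open>L\<close>, up to \<open>K\<close> and a logarithm.\<close>

lemma sum_inverse_hit_le:
  assumes ball: "\<And>x \<rho>. x \<in> V \<Longrightarrow> 1 \<le> \<rho> \<Longrightarrow> real (card (tree_ball T x \<rho>)) \<le> K * real \<rho> ^ 2"
    and L: "\<And>u. u \<in> desc x \<Longrightarrow> dep u \<le> dep x + L" "1 \<le> L"
    and v: "v \<in> desc x"
  shows "(\<Sum>u\<in>desc x. 1 / real (hit x v u)) \<le> 8 * K * real L * (harm L + 1)"
proof -
  let ?g = "\<lambda>\<rho>. 1 / (real \<rho> * (real \<rho> + 1))"
  let ?N = "\<lambda>\<rho>. real (card {u \<in> desc x. hit x v u \<le> \<rho>})"
  note N = card_hit_le[OF ball L(1) v]
  have hit: "1 \<le> hit x v u \<and> hit x v u \<le> L" if "u \<in> desc x" for u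
    using hit_Least(2)[OF v that] L(1)[OF that] L(2) by (auto simp: hit_def)
  \<comment> \<open>The telescoping sum is cut off at \<open>L\<close>. Its remainder
    \<open>1 / (L + 1)\<close> is paid for by the size of the subtree, which is at most
    \<open>8 * K * L * L\<close>.\<close>
  have tele: "1 / real d = (\<Sum>\<rho>\<in>{1..L}. if d \<le> \<rho> then ?g \<rho> else 0) + 1 / (real L + 1)"
    if "1 \<le> d" "d \<le> L" for d
  proof -
    have "(\<Sum>\<rho>\<in>{1..L}. if d \<le> \<rho> then ?g \<rho> else 0) = (\<Sum>\<rho>\<in>{d..L}. ?g \<rho>)"
      using that by (intro sum.mono_neutral_cong_right) auto
    also have "\<dots> = 1 / real d - 1 / (real L + 1)"
      using that(2)
    proof (induction L rule: dec_induct)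
      case base
      then show ?case using that(1) by (simp add: field_simps)
    next
      case (step k)
      then have "(\<Sum>\<rho>\<in>{d..Suc k}. ?g \<rho>) = (\<Sum>\<rho>\<in>{d..k}. ?g \<rho>) + ?g (Suc k)" by simp
      also have "?g (Suc k) = 1 / (real k + 1) - 1 / (real (Suc k) + 1)" by (simp add: field_simps)
      finally show ?case using step by simp
    qed
    finally show ?thesis by simp
  qed
  have "(\<Sum>u\<in>desc x. 1 / real (hit x v u)) =
      (\<Sum>u\<in>desc x. (\<Sum>\<rho>\<in>{1..L}. if hit x v u \<le> \<rho> then ?g \<rho> else 0) + 1 / (real L + 1))"
    using hit tele by (intro sum.cong) auto
  also have "\<dots> = (\<Sum>u\<in>desc x. \<Sum>\<rho>\<in>{1..L}. if hit x v u \<le> \<rho> then ?g \<rho> else 0) + real (card (desc x)) / (real L + 1)"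
    by (simp add: sum.distrib)
  also have "(\<Sum>u\<in>desc x. \<Sum>\<rho>\<in>{1..L}. if hit x v u \<le> \<rho> then ?g \<rho> else 0) =
      (\<Sum>\<rho>\<in>{1..L}. \<Sum>u\<in>desc x. if hit x v u \<le> \<rho> then ?g \<rho> else 0)" by (rule sum.swap)
  also have "\<dots> = (\<Sum>\<rho>\<in>{1..L}. ?N \<rho> * ?g \<rho>)"
    using finite_desc by (simp add: sum.If_cases Int_def)
  also have "\<dots> \<le> (\<Sum>\<rho>\<in>{1..L}. 8 * K * real L * inverse (real \<rho>))"
  proof (rule sum_mono)
    fix \<rho> assume \<rho>: "\<rho> \<in> {1..L}"
    have K0: "0 \<le> K * real L"
    proof -
      have "0 \<le> ?N 1" by simp
      also have "\<dots> \<le> 8 * K * real L * real 1" using L by (intro N) auto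
      finally show ?thesis by simp
    qed
    have "?N \<rho> * ?g \<rho> \<le> 8 * K * real L * real \<rho> * ?g \<rho>"
      using \<rho> by (intro mult_right_mono N) auto
    also have "\<dots> = 8 * (K * real L) * (1 / (real \<rho> + 1))" using \<rho> by simp
    also have "\<dots> \<le> 8 * (K * real L) * inverse (real \<rho>)"
      using K0 \<rho> by (intro mult_left_mono) (auto simp: inverse_eq_divide divide_simps)
    finally show "?N \<rho> * ?g \<rho> \<le> 8 * K * real L * inverse (real \<rho>)" by simp
  qed
  also have "\<dots> = 8 * K * real L * harm L" by (simp add: harm_def sum_distrib_left)
  also have "real (card (desc x)) / (real L + 1) \<le> 8 * K * real L"
  proof -
    have "{u \<in> desc x. hit x v u \<le> L} = desc x" using hit by auto
    then have "real (card (desc x)) \<le> 8 * K * real L * real L" using N[of L] L by simp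
    also have "\<dots> \<le> 8 * K * real L * (real L + 1)"
    proof (rule mult_left_mono)
      have "0 \<le> ?N 1" by simp
      also have "\<dots> \<le> 8 * K * real L * real 1" using L by (intro N) auto
      finally show "0 \<le> 8 * K * real L" by simp
    qed simp
    finally show ?thesis by (simp add: pos_divide_le_eq)
  qed
  finally show ?thesis by (simp add: algebra_simps)
qed

end

subsection \<open>The fire dynamics on a fixed tree\<close>

lemma (in linorder) sorted_key_list_of_set_inj:
  assumes "inj_on f A" "finite A"
  shows "set (sorted_key_list_of_set f A) = A" "sorted (map f (sorted_key_list_of_set f A))"
proof -
  interpret folding_insort_key "(\<le>)" "(<)" A f
    by unfold_locales (rule assms)
  show "set (sorted_key_list_of_set f A) = A" "sorted (map f (sorted_key_list_of_set f A))"
    using assms(2) by auto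
qed

text \<open>The relation behind \<open>fire_cluster\<close>, freed from the configuration so that
  clusters in different edge sets can be compared by \<open>link_mono\<close>.\<close>

definition link :: "edge set \<Rightarrow> (edge \<times> edge) set" where
  "link S = {(g, h). g \<in> S \<and> h \<in> S \<and> g \<inter> h \<noteq> {}}"

lemma link_mono: "S \<subseteq> S' \<Longrightarrow> link S \<subseteq> link S'"
  by (auto simp: link_def)

lemma link_sym: "(f, g) \<in> (link S)\<^sup>* \<Longrightarrow> (g, f) \<in> (link S)\<^sup>*"
  by (rule symD[OF sym_rtrancl]) (auto simp: sym_def link_def)

lemma fire_cluster_eq: "fire_cluster T x e = {f. (e, f) \<in> (link (inflammable_edges T x))\<^sup>*}"
  by (simp add: fire_cluster_def link_def)

text \<open>Contains every edge that can still be inflammable when \<open>f\<close> is lit, whatever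
  other fires have done before. It depends on the order of the clocks only, not on the
  dynamics.\<close>

definition unprotected :: "edge set \<Rightarrow> (fire_event \<Rightarrow> real) \<Rightarrow> edge \<Rightarrow> edge set" where
  "unprotected T c f = {e \<in> T. c (Ignite f) < c (Protect e)}"

definition final_config :: "edge set \<Rightarrow> (fire_event \<Rightarrow> real) \<Rightarrow> config" where
  "final_config T c = fold (apply_event T) (sorted_key_list_of_set c (fire_events T)) (\<lambda>_. Inflammable)"

lemma finite_fire_events: "finite T \<Longrightarrow> finite (fire_events T)"
  by (simp add: fire_events_def)

lemma terminal_state_iff:
  assumes "finite T"
  shows "terminal_state T c e s \<longleftrightarrow> final_config T c e = s"
proof -
  have "eventually (\<lambda>t. \<forall>a\<in>fire_events T. c a \<le> t) at_top"
    using finite_fire_events[OF assms] by (intro eventually_ball_finite ballI eventually_ge_at_top)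
  then have ev: "eventually (\<lambda>t. fire_process T c t = final_config T c) at_top"
  proof eventually_elim
    case (elim t)
    then have "{a \<in> fire_events T. c a \<le> t} = fire_events T" by auto
    then show ?case by (simp add: fire_process_def final_config_def)
  qed
  have "terminal_state T c e s \<longleftrightarrow> eventually (\<lambda>t. final_config T c e = s) (at_top :: real filter)"
    unfolding terminal_state_def by (rule eventually_cong[OF ev]) simp
  then show ?thesis by simp
qed

text \<open>A fire that burns \<open>g\<close> starts at some \<open>f\<close> and runs through
  edges inflammable at that moment, all of which lie in \<open>unprotected T c f\<close>. The
  probability estimates use the dynamics only through this comparison of clocks.\<close>

lemma not_fireproof_imp_link:
  assumes T: "finite T" and inj: "inj_on c (fire_events T)" and g: "g \<in> T"
    and nf: "\<not> terminal_state T c g Fireproof"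
  shows "\<exists>f. f \<in> unprotected T c f \<and> (f, g) \<in> (link (unprotected T c f))\<^sup>*"
proof -
  let ?l = "sorted_key_list_of_set c (fire_events T)"
  have set_l: "set ?l = fire_events T" and sorted_l: "sorted (map c ?l)"
    using sorted_key_list_of_set_inj[OF inj finite_fire_events[OF T]] by auto
  \<comment> \<open>An invariant of the prefixes of the chronological list. Its first half serves
    the second, since an edge that is still inflammable has its protecting clock ahead; for the full
    list it also excludes the final state \<open>Inflammable\<close>.\<close>
  have inv: "(\<forall>e\<in>T. Protect e \<in> set xs \<longrightarrow> fold (apply_event T) xs (\<lambda>_. Inflammable) e \<noteq> Inflammable) \<and>
      (\<forall>g. fold (apply_event T) xs (\<lambda>_. Inflammable) g = Burnt \<longrightarrow>
        (\<exists>f. f \<in> unprotected T c f \<and> (f, g) \<in> (link (unprotected T c f))\<^sup>*))"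
    if "?l = xs @ ys" for xs ys
    using that
  proof (induction xs arbitrary: ys rule: rev_induct)
    case (snoc a xs)
    define x where "x = fold (apply_event T) xs (\<lambda>_. Inflammable)"
    have l: "?l = xs @ a # ys" using snoc.prems by simp
    have IH1: "\<And>e. e \<in> T \<Longrightarrow> Protect e \<in> set xs \<Longrightarrow> x e \<noteq> Inflammable"
      and IH2: "\<And>g. x g = Burnt \<Longrightarrow> \<exists>f. f \<in> unprotected T c f \<and> (f, g) \<in> (link (unprotected T c f))\<^sup>*"
      using snoc.IH[OF l] by (auto simp: x_def)
    have a: "a \<in> fire_events T" using set_l l by auto
    have fold: "fold (apply_event T) (xs @ [a]) (\<lambda>_. Inflammable) = apply_event T a x" by (simp add: x_def)
    show ?case
    proof (cases a)
      case (Protect e)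
      then show ?thesis unfolding fold using IH1 IH2 by auto
    next
      case (Ignite f)
      have fT: "f \<in> T" using a Ignite by (auto simp: fire_events_def)
      have sub: "inflammable_edges T x \<subseteq> unprotected T c f"
      proof
        fix e assume "e \<in> inflammable_edges T x"
        then have e: "e \<in> T" "x e = Inflammable" by (auto simp: inflammable_edges_def)
        then have "Protect e \<notin> set xs" using IH1 by blast
        moreover have ev: "Protect e \<in> fire_events T" using e by (simp add: fire_events_def)
        ultimately have "Protect e \<in> set ys" using l set_l Ignite by auto
        then have "c (Ignite f) \<le> c (Protect e)"
          using sorted_l l Ignite by (auto simp: sorted_append)
        moreover have "c (Ignite f) \<noteq> c (Protect e)"
          using inj_onD[OF inj _ _ ev] a Ignite by auto
        ultimately show "e \<in> unprotected T c f" using e by (simp add: unprotected_def)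
      qed
      show ?thesis
      proof (cases "x f = Inflammable")
        case True
        then have "f \<in> unprotected T c f" using sub fT by (auto simp: inflammable_edges_def)
        moreover have "(f, g) \<in> (link (unprotected T c f))\<^sup>*" if "g \<in> fire_cluster T x f" for g
          using that rtrancl_mono[OF link_mono[OF sub]] by (auto simp: fire_cluster_eq)
        ultimately show ?thesis
          unfolding fold using Ignite True IH1 IH2 by auto
      next
        case False
        then show ?thesis unfolding fold using Ignite IH1 IH2 by auto
      qed
    qed
  qed simp
  have "final_config T c g \<noteq> Inflammable"
    using inv[of ?l "[]"] set_l g by (auto simp: final_config_def fire_events_def)
  moreover have "final_config T c g \<noteq> Fireproof" using nf terminal_state_iff[OF T] by simp
  ultimately have "final_config T c g = Burnt" by (cases "final_config T c g") auto
  then show ?thesis using inv[of ?l "[]"] by (simp add: final_config_def)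
qed

context rooted_tree
begin

lemma finite_T: "finite T"
  using finV by (simp add: T_eq)

lemma link_desc:
  assumes S: "S \<subseteq> T" "{w, par w} \<notin> S" and fg: "(f, g) \<in> (link S)\<^sup>*" and f: "f \<in> S" "f \<inter> desc w \<noteq> {}"
  shows "g \<in> S \<and> g \<inter> desc w \<noteq> {}"
  using fg
proof (induction rule: rtrancl_induct)
  case (step g h)
  then have "g \<in> T" "g \<noteq> {w, par w}" "g \<inter> desc w \<noteq> {}" using S by auto
  then have "g \<subseteq> desc w" by (rule edge_desc) blast
  then show ?case using step by (auto simp: link_def)
qed (use f in simp)

text \<open>A necessary condition for a fire lit below \<open>x\<close> to reach the path from \<open>x\<close> to \<open>v\<close>.\<close>

definition scorched :: "(fire_event \<Rightarrow> real) \<Rightarrow> nat \<Rightarrow> nat \<Rightarrow> bool" where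
  "scorched c x v \<longleftrightarrow> (\<exists>u\<in>desc x - {x}. \<forall>j<hit x v u.
     c (Ignite {u, par u}) < c (Protect {(par ^^ j) u, par ((par ^^ j) u)}))"

text \<open>Two barriers act. The edge above \<open>x\<close>, protected before any fire, keeps
  outside fires out. A fire lit inside is stopped, because \<open>v\<close> is not scorched, at a
  protected edge before its climb reaches the spine. All edges at \<open>q\<close> are treated, not
  only those of the spine, as the definition of a fireproof vertex demands.\<close>

lemma spine_fireproof:
  assumes inj: "inj_on c (fire_events T)"
    and cut: "c (Protect {x, par x}) \<le> s" "\<And>f. f \<in> T \<Longrightarrow> s < c (Ignite f)"
    and v: "v \<in> desc x" "\<not> scorched c x v"
    and g: "q \<in> spine x v" "g \<in> T" "q \<in> g"
  shows "terminal_state T c g Fireproof"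
proof (rule ccontr)
  assume "\<not> terminal_state T c g Fireproof"
  then obtain f where f: "f \<in> unprotected T c f" "(f, g) \<in> (link (unprotected T c f))\<^sup>*"
    using not_fireproof_imp_link[OF finite_T inj g(2)] by blast
  let ?S = "unprotected T c f"
  have ST: "?S \<subseteq> T" by (auto simp: unprotected_def)
  have gS: "g \<in> ?S" using f(2,1) by (induction rule: rtrancl_induct) (auto simp: link_def)
  have qx: "q \<in> V" "q \<in> desc x" "v \<in> desc q" using g(1) by (auto simp: spine_def)
  have xS: "{x, par x} \<notin> ?S" using cut f(1) by (fastforce simp: unprotected_def)
  then have "f \<in> ?S \<and> f \<inter> desc x \<noteq> {}"
    using g(3) qx by (intro link_desc[OF ST xS link_sym[OF f(2)] gS]) auto
  then have "f \<in> T" "f \<noteq> {x, par x}" "f \<inter> desc x \<noteq> {}" using xS ST by auto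
  then obtain u where u: "u \<in> desc x" "u \<noteq> x" "u \<noteq> r" "f = {u, par u}" "f \<subseteq> desc x"
    by (rule edge_desc)
  obtain j where j: "j < hit x v u" "\<not> c (Ignite f) < c (Protect {(par ^^ j) u, par ((par ^^ j) u)})"
    using v(2) u unfolding scorched_def by blast
  have uV: "u \<in> V" using u desc_V by blast
  define w where "w = (par ^^ j) u"
  have wS: "{w, par w} \<notin> ?S" using j by (simp add: unprotected_def w_def)
  \<comment> \<open>The lit edge itself is not protected in time, as \<open>f\<close> lies in
    \<open>unprotected T c f\<close>. This also settles the case where \<open>hit\<close> equals 1
    only because of the maximum.\<close>
  have "j \<noteq> 0"
  proof
    assume "j = 0"
    then have "w = u" by (simp add: w_def)
    then show False using f(1) wS u(4) by metis
  qed
  then have jL: "j < (LEAST i. (par ^^ i) u \<in> spine x v)" using j by (simp add: hit_def)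
  then have w_spine: "w \<notin> spine x v" using not_less_Least w_def by blast
  have uw: "u \<in> desc w" unfolding w_def by (rule iter_desc[OF uV])
  have "g \<in> ?S \<and> g \<inter> desc w \<noteq> {}"
    using u uw by (intro link_desc[OF ST wS f(2) f(1)]) auto
  then have "g \<in> T" "g \<noteq> {w, par w}" "g \<inter> desc w \<noteq> {}" using wS ST by auto
  then have "g \<subseteq> desc w" by (rule edge_desc) blast
  \<comment> \<open>Had the fire reached \<open>q\<close>, then \<open>w\<close> would be an
    ancestor of \<open>q\<close> below \<open>x\<close>, hence on the spine, although the climb from
    \<open>u\<close> has not met the spine at \<open>w\<close> yet.\<close>
  then have "v \<in> desc w" using g(3) qx desc_trans by blast
  moreover have "w \<in> desc x"
  proof (rule desc_comparable[OF u(1) uw])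
    show "dep x \<le> dep w"
      using dep_iter[OF uV, of j] jL hit_Least(2)[OF v(1) u(1)] desc_dep[OF u(1)] by (simp add: w_def)
  qed
  ultimately have "w \<in> spine x v" using iter_V[OF uV] by (auto simp: spine_def w_def)
  then show False using w_spine by simp
qed

text \<open>Every unscorched \<open>v\<close> is joined to \<open>x\<close> by its own spine, whose
  vertices and edges are all fireproof; so one component, that of \<open>x\<close>, contains all of
  them.\<close>

lemma card_component_ge:
  assumes V: "V = {1..n}" and inj: "inj_on c (fire_events T)"
    and cut: "c (Protect {x, par x}) \<le> s" "\<And>f. f \<in> T \<Longrightarrow> s < c (Ignite f)"
    and ne: "{v \<in> desc x. \<not> scorched c x v} \<noteq> {}"
  shows "\<exists>C\<in>forest_components n T c. card {v \<in> desc x. \<not> scorched c x v} \<le> card C"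
proof -
  let ?F = "fireproof_vertices n T c" and ?E = "forest_edges n T c"
  have fp: "q \<in> ?F" if "v \<in> desc x" "\<not> scorched c x v" "q \<in> spine x v" for v q
  proof -
    have "q \<in> {1..n}" using that(3) unfolding spine_def V[symmetric] by blast
    then show ?thesis using spine_fireproof[OF inj cut that] by (simp add: fireproof_vertices_def)
  qed
  have reach: "(x, y) \<in> (adjacency ?E)\<^sup>*"
    if v: "v \<in> desc x" "\<not> scorched c x v" and y: "y \<in> spine x v" for v y
    using y
  proof (induction "dep y" arbitrary: y rule: less_induct)
    case less
    have y: "y \<in> V" "y \<in> desc x" using less.prems by (auto simp: spine_def)
    show ?case
    proof (cases "y = x")
      case False
      have "dep x < dep y" using desc_dep[OF y(2)] desc_antisym[OF y(2)] False by fastforce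
      then have yr: "y \<noteq> r" by auto
      have p: "par y \<in> spine x v" using spine_iter[OF less.prems, of 1] \<open>dep x < dep y\<close> by simp
      have "(x, par y) \<in> (adjacency ?E)\<^sup>*"
        using dep_par[OF y(1) yr] p by (intro less.hyps) auto
      moreover have "{y, par y} \<in> ?E"
        using edge_in_T[OF y(1) yr] spine_fireproof[OF inj cut v less.prems edge_in_T[OF y(1) yr]]
          fp[OF v less.prems] fp[OF v p] by (simp add: forest_edges_def)
      then have "(par y, y) \<in> adjacency ?E" by (simp add: adjacency_def insert_commute)
      ultimately show ?thesis by (rule rtrancl_into_rtrancl)
    qed simp
  qed
  have self: "v \<in> spine x v" if "v \<in> desc x" for v
    using that desc_V desc_self by (auto simp: spine_def)
  let ?C = "{w \<in> ?F. (x, w) \<in> (adjacency ?E)\<^sup>*}"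
  have "{v \<in> desc x. \<not> scorched c x v} \<subseteq> ?C"
    using fp reach self by blast
  moreover have "finite ?C" by (simp add: fireproof_vertices_def)
  ultimately have "card {v \<in> desc x. \<not> scorched c x v} \<le> card ?C" by (rule card_mono[rotated])
  moreover have "x \<in> ?F" using ne fp top_in_spine by blast
  then have "?C \<in> forest_components n T c"
    unfolding forest_components_def components_def by blast
  ultimately show ?thesis by blast
qed

end

subsection \<open>Exponential clocks\<close>

text \<open>A partition of the line into cells of length \<open>\<eta>\<close>, where cell 0 also
  takes the negative numbers, which carry no mass for exponential clocks; thus the cells cover every
  real.\<close>

definition slot :: "real \<Rightarrow> nat \<Rightarrow> real set" where
  "slot \<eta> k = (if k = 0 then {..\<eta>} else {real k * \<eta><..(real k + 1) * \<eta>})"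

lemma slot_exists:
  assumes "\<eta> > 0"
  shows "\<exists>k. x \<in> slot \<eta> k"
proof (cases "x \<le> \<eta>")
  case True
  then show ?thesis by (intro exI[of _ 0]) (simp add: slot_def)
next
  case False
  define k where "k = nat (\<lceil>x / \<eta>\<rceil> - 1)"
  have "x / \<eta> > 1" using False assms by (simp add: field_simps)
  then have "\<lceil>x / \<eta>\<rceil> \<ge> 2" by linarith
  then have k: "real k = real_of_int \<lceil>x / \<eta>\<rceil> - 1" "k \<noteq> 0" by (auto simp: k_def)
  have "real k < x / \<eta>" "x / \<eta> \<le> real k + 1" unfolding k by linarith+
  then have "real k * \<eta> < x" "x \<le> (real k + 1) * \<eta>" using assms by (simp_all add: field_simps)
  then show ?thesis using k by (intro exI[of _ k]) (simp add: slot_def)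
qed

lemma slot_gt: "x \<in> slot \<eta> k \<Longrightarrow> k \<noteq> 0 \<Longrightarrow> real k * \<eta> < x"
  by (simp add: slot_def)

lemma disjoint_slot:
  assumes "\<eta> > 0"
  shows "disjoint_family (slot \<eta>)"
proof -
  have *: "False" if "x \<in> slot \<eta> i" "x \<in> slot \<eta> j" "i < j" for x i j
  proof -
    have "x \<le> (real i + 1) * \<eta>" using that(1) by (auto simp: slot_def split: if_splits)
    also have "\<dots> \<le> real j * \<eta>" using that(3) assms by (intro mult_right_mono) auto
    also have "\<dots> < x" using slot_gt[OF that(2)] that(3) by simp
    finally show False by simp
  qed
  show ?thesis
    unfolding disjoint_family_on_def
  proof (intro ballI impI)
    fix i j :: nat assume "i \<noteq> j"
    then show "slot \<eta> i \<inter> slot \<eta> j = {}" using *[of _ i j] *[of _ j i] by (cases i j rule: linorder_cases) auto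
  qed
qed

lemma sets_slot [measurable]: "slot \<eta> k \<in> sets borel"
  by (simp add: slot_def)

abbreviation exp_measure :: "real \<Rightarrow> real measure" where
  "exp_measure l \<equiv> density lborel (exponential_density l)"

lemma
  assumes l: "l > 0" and a: "0 \<le> a"
  shows measure_exp_le: "measure (exp_measure l) {..a} = 1 - exp (- a * l)"
    and measure_exp_gt: "measure (exp_measure l) {a<..} = exp (- a * l)"
proof -
  interpret prob_space "exp_measure l" by (rule prob_space_exponential_density[OF l])
  have D: "distributed (exp_measure l) lborel (\<lambda>x. x) (exponential_density l)"
    unfolding distributed_def by (simp add: distr_id2)
  have "{x \<in> space (exp_measure l). x \<le> a} = {..a}" "{x \<in> space (exp_measure l). a < x} = {a<..}" by auto
  then show "measure (exp_measure l) {..a} = 1 - exp (- a * l)" "measure (exp_measure l) {a<..} = exp (- a * l)"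
    using exponential_distributedD_le[OF D a l] exponential_distributedD_gt[OF D a l] by simp_all
qed

lemma one_minus_exp_le: "1 - exp (- a) \<le> (a::real)"
  using exp_ge_add_one_self[of "- a"] by simp

lemma measure_slot_le:
  assumes l: "l > 0" and \<eta>: "\<eta> > 0"
  shows "measure (exp_measure l) (slot \<eta> k) \<le> l * \<eta>"
proof (cases "k = 0")
  case True
  then show ?thesis
    using measure_exp_le[OF l, of \<eta>] \<eta> one_minus_exp_le[of "\<eta> * l"] by (simp add: slot_def mult.commute)
next
  case False
  interpret prob_space "exp_measure l" by (rule prob_space_exponential_density[OF l])
  let ?a = "real k * \<eta>" and ?b = "(real k + 1) * \<eta>"
  have "slot \<eta> k = {..?b} - {..?a}" using False by (auto simp: slot_def)
  moreover have "?a \<le> ?b" using \<eta> by (intro mult_right_mono) auto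
  then have "measure (exp_measure l) ({..?b} - {..?a}) = measure (exp_measure l) {..?b} - measure (exp_measure l) {..?a}"
    by (intro finite_measure_Diff) auto
  moreover have "measure (exp_measure l) {..?b} - measure (exp_measure l) {..?a} = exp (- ?a * l) - exp (- ?b * l)"
    using \<eta> measure_exp_le[OF l, of ?a] measure_exp_le[OF l, of ?b] by simp
  moreover have "exp (- ?a * l) - exp (- ?b * l) = exp (- ?a * l) * (1 - exp (- (\<eta> * l)))"
    by (simp add: algebra_simps exp_add[symmetric])
  moreover have "exp (- ?a * l) * (1 - exp (- (\<eta> * l))) \<le> 1 * (\<eta> * l)"
    using \<eta> l one_minus_exp_le[of "\<eta> * l"] by (intro mult_mono) auto
  ultimately show ?thesis by (simp add: mult.commute)
qed

locale clocks =
  fixes n :: nat and r :: real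
  assumes r_pos: "r > 0"
begin

abbreviation "\<Omega> \<equiv> clock_space n r"
abbreviation "clock_events \<equiv> fire_events (all_edges {1..n})"

lemma clock_rate_pos: "clock_rate r a > 0"
  using r_pos by (cases a) auto

sublocale P: product_prob_space "\<lambda>a. exp_measure (clock_rate r a)" clock_events
proof -
  interpret M: prob_space "exp_measure (clock_rate r a)" for a
    using prob_space_exponential_density clock_rate_pos by blast
  show "product_prob_space (\<lambda>a. exp_measure (clock_rate r a))" by unfold_locales
qed

lemma clock_space_eq: "\<Omega> = PiM clock_events (\<lambda>a. exp_measure (clock_rate r a))"
  by (simp add: clock_space_def)

sublocale prob_space \<Omega>
  unfolding clock_space_eq by (rule P.prob_space_axioms)

lemma finite_clock_events: "finite clock_events"
  by (intro finite_fire_events finite_all_edges) simp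

lemma measurable_clock [measurable]: "a \<in> clock_events \<Longrightarrow> (\<lambda>c. c a) \<in> borel_measurable \<Omega>"
  unfolding clock_space_eq using measurable_component_singleton[of a clock_events "\<lambda>a. exp_measure (clock_rate r a)"]
  by simp

lemma sets_box:
  assumes "J \<subseteq> clock_events" "\<And>a. a \<in> J \<Longrightarrow> A a \<in> sets borel"
  shows "{c \<in> space \<Omega>. \<forall>a\<in>J. c a \<in> A a} \<in> sets \<Omega>"
proof -
  have J: "finite J" using assms(1) finite_clock_events finite_subset by blast
  have "{c \<in> space \<Omega>. c a \<in> A a} \<in> sets \<Omega>" if "a \<in> J" for a
  proof -
    have "(\<lambda>c. c a) -` A a \<inter> space \<Omega> \<in> sets \<Omega>"
      using assms that by (intro measurable_sets[OF measurable_clock]) auto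
    moreover have "(\<lambda>c. c a) -` A a \<inter> space \<Omega> = {c \<in> space \<Omega>. c a \<in> A a}" by auto
    ultimately show ?thesis by simp
  qed
  then show ?thesis using J by (intro sets.sets_Collect_finite_All) auto
qed

lemma measure_box:
  assumes "J \<subseteq> clock_events" "\<And>a. a \<in> J \<Longrightarrow> A a \<in> sets borel"
  shows "measure \<Omega> {c \<in> space \<Omega>. \<forall>a\<in>J. c a \<in> A a} = (\<Prod>a\<in>J. measure (exp_measure (clock_rate r a)) (A a))"
proof -
  have J: "finite J" using assms(1) finite_clock_events finite_subset by blast
  have eq: "{c \<in> space \<Omega>. \<forall>a\<in>J. c a \<in> A a} = prod_emb clock_events (\<lambda>a. exp_measure (clock_rate r a)) J (Pi\<^sub>E J A)"
    unfolding prod_emb_def clock_space_eq using assms by (auto simp: space_PiM Pi_iff)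
  show ?thesis
    unfolding eq unfolding clock_space_eq by (rule P.measure_PiM_emb) (use assms J in auto)
qed

text \<open>The time of ignition is localised in a slot of length \<open>1 / card D\<close>, which turns the event into
  a countable union of boxes.\<close>

lemma measure_Protect_Ignite:
  assumes e: "e \<in> all_edges {1..n}" "f \<in> all_edges {1..n}" and D: "D \<subseteq> all_edges {1..n}" "e \<notin> D" "D \<noteq> {}"
    and s: "s \<ge> 0"
  shows "measure \<Omega> {c \<in> space \<Omega>. c (Protect e) \<le> s \<and> (\<forall>g\<in>D. c (Ignite f) < c (Protect g))} \<le> 2 * r * s / real (card D)"
    (is "measure \<Omega> ?E \<le> _")
proof -
  have finD: "finite D" using D(1) finite_all_edges[of "{1..n}"] finite_subset by blast
  define d where "d = card D"
  have d: "d > 0" using D finD by (simp add: d_def card_gt_0_iff)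
  define \<eta> where "\<eta> = 1 / real d"
  have \<eta>: "\<eta> > 0" using d by (simp add: \<eta>_def)
  define J where "J = insert (Protect e) (insert (Ignite f) (Protect ` D))"
  \<comment> \<open>On the cell of the ignition time, the requirement that \<open>Protect g\<close>
    ring after \<open>Ignite f\<close> is relaxed to ringing after the left end of the cell, which
    gives a box. For \<open>k = 0\<close> it is dropped.\<close>
  define A where "A k a = (if a = Protect e then {..s} else if a = Ignite f then slot \<eta> k
    else if k = 0 then UNIV else {real k * \<eta><..})" for k a
  define B where "B k = {c \<in> space \<Omega>. \<forall>a\<in>J. c a \<in> A k a}" for k
  have J: "J \<subseteq> clock_events" using e D by (auto simp: J_def fire_events_def)
  have A: "A k a \<in> sets borel" for k a by (simp add: A_def)
  have ms: "B k \<in> sets \<Omega>" for k unfolding B_def by (rule sets_box[OF J A])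
  have "?E \<subseteq> (\<Union>k. B k)"
  proof
    fix c assume c: "c \<in> ?E"
    obtain k where k: "c (Ignite f) \<in> slot \<eta> k" using slot_exists[OF \<eta>] by blast
    have "c (Protect g) \<in> (if k = 0 then UNIV else {real k * \<eta><..})" if "g \<in> D" for g
    proof -
      have "c (Ignite f) < c (Protect g)" using c that by blast
      then show ?thesis using slot_gt[OF k] by auto
    qed
    then have "c \<in> B k" using c k D(2) by (auto simp: B_def A_def J_def)
    then show "c \<in> (\<Union>k. B k)" by blast
  qed
  then have E_le: "measure \<Omega> ?E \<le> measure \<Omega> (\<Union>k. B k)"
    using ms by (intro finite_measure_mono) auto
  have mB: "measure \<Omega> (B k) \<le> r * s / real d * exp (- 1) ^ k" for k
  proof -
    have prod: "(\<Prod>g\<in>D. measure (exp_measure 1) (if k = 0 then UNIV else {real k * \<eta><..})) \<le> exp (- 1) ^ k"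
    proof (cases "k = 0")
      case True
      interpret E: prob_space "exp_measure 1" by (rule prob_space_exponential_density) simp
      have "measure (exp_measure 1) UNIV = 1" using E.prob_space by simp
      then show ?thesis using True by simp
    next
      case False
      \<comment> \<open>The reason for the cell length \<open>1 / d\<close>: all \<open>d\<close>
        protecting clocks outlast \<open>k\<close> cells with probability \<open>exp (- k)\<close>,
        so the sum over the cells is geometric, while the mass of a cell supplies the factor
        \<open>r / d\<close>.\<close>
      have "real d * (real k * \<eta>) = real k" using d by (simp add: \<eta>_def)
      then show ?thesis
        using False measure_exp_gt[of 1 "real k * \<eta>"] \<eta>
        by (simp add: d_def[symmetric] exp_of_nat_mult[symmetric])
    qed
    have "measure \<Omega> (B k) = (\<Prod>a\<in>J. measure (exp_measure (clock_rate r a)) (A k a))"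
      unfolding B_def using J A by (rule measure_box)
    also have "\<dots> = measure (exp_measure 1) {..s} * (measure (exp_measure r) (slot \<eta> k) *
        (\<Prod>g\<in>D. measure (exp_measure 1) (if k = 0 then UNIV else {real k * \<eta><..})))"
    proof -
      \<comment> \<open>Since \<open>e\<close> is not in \<open>D\<close>, the clock
        \<open>Protect e\<close> is a coordinate of its own; this is where the factor
        \<open>s\<close> comes from.\<close>
      have "Protect e \<notin> insert (Ignite f) (Protect ` D)" "Ignite f \<notin> Protect ` D" using D(2) by auto
      moreover have "(\<Prod>a\<in>Protect ` D. measure (exp_measure (clock_rate r a)) (A k a)) =
          (\<Prod>g\<in>D. measure (exp_measure 1) (if k = 0 then UNIV else {real k * \<eta><..}))"
      proof (subst prod.reindex)
        show "inj_on Protect D" by (simp add: inj_on_def)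
        show "prod ((\<lambda>a. measure (exp_measure (clock_rate r a)) (A k a)) \<circ> Protect) D =
            (\<Prod>g\<in>D. measure (exp_measure 1) (if k = 0 then UNIV else {real k * \<eta><..}))"
          using D(2) by (intro prod.cong) (auto simp: A_def)
      qed
      ultimately show ?thesis unfolding J_def using finD by (simp add: A_def)
    qed
    also have "\<dots> \<le> s * ((r * \<eta>) * exp (- 1) ^ k)"
      using measure_exp_le[of 1 s] one_minus_exp_le[of s] measure_slot_le[OF r_pos \<eta>, of k] s prod r_pos \<eta>
      by (intro mult_mono mult_nonneg_nonneg prod_nonneg) auto
    finally show ?thesis by (simp add: \<eta>_def mult_ac)
  qed
  have summ: "summable (\<lambda>k. r * s / real d * exp (- 1 :: real) ^ k)"
    by (intro summable_mult summable_geometric) simp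
  have summB: "summable (\<lambda>k. measure \<Omega> (B k))"
    by (rule summable_comparison_test'[OF summ, of 0]) (use mB in simp)
  have "measure \<Omega> (\<Union>k. B k) \<le> (\<Sum>k. measure \<Omega> (B k))"
    using ms summB by (intro finite_measure_subadditive_countably) auto
  also have "\<dots> \<le> (\<Sum>k. r * s / real d * exp (- 1) ^ k)"
    by (rule suminf_le[OF mB summB summ])
  also have "\<dots> = r * s / real d * (1 / (1 - exp (- 1)))"
    by (subst suminf_mult) (simp_all add: suminf_geometric summable_geometric)
  also have "\<dots> \<le> r * s / real d * 2"
  proof (rule mult_left_mono)
    have "exp (1::real) \<ge> 2" using exp_ge_add_one_self[of 1] by simp
    then have "exp (- 1 :: real) \<le> 1 / 2" by (simp add: exp_minus field_simps)
    then show "1 / (1 - exp (- 1 :: real)) \<le> 2" by (simp add: field_simps)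
  qed (use r_pos s in simp)
  finally have "measure \<Omega> (\<Union>k. B k) \<le> r * s / real d * 2" .
  with E_le show ?thesis by (simp add: d_def mult_ac)
qed

text \<open>Tied clocks fall into the same cell. By independence this has probability at most the
  largest mass of a cell under the law of \<open>b\<close>, which vanishes with
  \<open>\<eta>\<close>.\<close>

lemma null_tie:
  assumes ab: "a \<in> clock_events" "b \<in> clock_events" "a \<noteq> b"
  shows "measure \<Omega> {c \<in> space \<Omega>. c a = c b} = 0"
proof -
  let ?E = "{c \<in> space \<Omega>. c a = c b}"
  have small: "measure \<Omega> ?E \<le> clock_rate r b * \<eta>" if \<eta>: "\<eta> > 0" for \<eta>
  proof -
    define B where "B k = {c \<in> space \<Omega>. \<forall>i\<in>{a, b}. c i \<in> slot \<eta> k}" for k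
    have ms: "B k \<in> sets \<Omega>" for k
      unfolding B_def using ab by (intro sets_box) auto
    let ?\<mu> = "\<lambda>i k. measure (exp_measure (clock_rate r i)) (slot \<eta> k)"
    have mB: "measure \<Omega> (B k) \<le> ?\<mu> a k * (clock_rate r b * \<eta>)" for k
    proof -
      have "measure \<Omega> (B k) = (\<Prod>i\<in>{a, b}. ?\<mu> i k)"
        unfolding B_def using ab by (intro measure_box) auto
      also have "\<dots> = ?\<mu> a k * ?\<mu> b k" using ab by simp
      finally show ?thesis using measure_slot_le[OF clock_rate_pos \<eta>, of b k] by (simp add: mult_left_mono)
    qed
    have sums: "?\<mu> a sums measure (exp_measure (clock_rate r a)) (\<Union>k. slot \<eta> k)"
      using disjoint_slot[OF \<eta>] by (intro P.M.finite_measure_UNION) auto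
    have sums': "(\<lambda>k. ?\<mu> a k * (clock_rate r b * \<eta>)) sums
        (measure (exp_measure (clock_rate r a)) (\<Union>k. slot \<eta> k) * (clock_rate r b * \<eta>))"
      using sums by (rule sums_mult2)
    have summB: "summable (\<lambda>k. measure \<Omega> (B k))"
      by (rule summable_comparison_test'[OF sums_summable[OF sums'], of 0]) (simp add: mB)
    have "?E \<subseteq> (\<Union>k. B k)" using slot_exists[OF \<eta>] by (auto simp: B_def)
    then have "measure \<Omega> ?E \<le> measure \<Omega> (\<Union>k. B k)" using ms by (intro finite_measure_mono) auto
    also have "\<dots> \<le> (\<Sum>k. measure \<Omega> (B k))"
      using ms summB by (intro finite_measure_subadditive_countably) auto
    also have "\<dots> \<le> (\<Sum>k. ?\<mu> a k * (clock_rate r b * \<eta>))"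
      by (rule suminf_le[OF mB summB sums_summable[OF sums']])
    also have "\<dots> = measure (exp_measure (clock_rate r a)) (\<Union>k. slot \<eta> k) * (clock_rate r b * \<eta>)"
      using sums' by (rule sums_unique[symmetric])
    also have "\<dots> \<le> 1 * (clock_rate r b * \<eta>)"
      using \<eta> clock_rate_pos[of b] by (intro mult_right_mono P.M.prob_le_1) auto
    finally show ?thesis by simp
  qed
  have "measure \<Omega> ?E \<le> 0"
  proof (rule field_le_epsilon)
    fix e :: real assume "e > 0"
    then show "measure \<Omega> ?E \<le> 0 + e"
      using small[of "e / clock_rate r b"] clock_rate_pos[of b] by simp
  qed
  then show ?thesis using measure_nonneg[of \<Omega> ?E] by linarith
qed

lemma measure_Ignite_le:
  assumes "f \<in> all_edges {1..n}" "s \<ge> 0"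
  shows "measure \<Omega> {c \<in> space \<Omega>. c (Ignite f) \<le> s} \<le> r * s"
proof -
  have "measure \<Omega> {c \<in> space \<Omega>. \<forall>a\<in>{Ignite f}. c a \<in> {..s}} = (\<Prod>a\<in>{Ignite f}. measure (exp_measure (clock_rate r a)) {..s})"
    using assms by (intro measure_box) (auto simp: fire_events_def)
  then show ?thesis
    using measure_exp_le[OF r_pos assms(2)] one_minus_exp_le[of "s * r"] by (simp add: mult.commute)
qed

lemma measure_no_cut:
  assumes "D \<subseteq> all_edges {1..n}" "s \<ge> 0"
  shows "measure \<Omega> {c \<in> space \<Omega>. \<forall>e\<in>D. s < c (Protect e)} = exp (- (s * real (card D)))"
proof -
  have "measure \<Omega> {c \<in> space \<Omega>. \<forall>a\<in>Protect ` D. c a \<in> {s<..}} = (\<Prod>a\<in>Protect ` D. measure (exp_measure (clock_rate r a)) {s<..})"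
    using assms by (intro measure_box) (auto simp: fire_events_def)
  also have "\<dots> = (\<Prod>e\<in>D. exp (- s))"
    using measure_exp_gt[of 1 s] assms by (subst prod.reindex) (auto simp: inj_on_def)
  also have "\<dots> = exp (- (s * real (card D)))"
    by (simp add: exp_of_nat_mult[symmetric] mult.commute)
  finally show ?thesis by simp
qed

text \<open>Markov's inequality for the number of \<open>v\<close> satisfying \<open>E v\<close>:
  bounds for single vertices control the event that more than half of \<open>D\<close> is
  affected.\<close>

lemma markov_count:
  assumes D: "finite D" "D \<noteq> {}" and E: "\<And>v. v \<in> D \<Longrightarrow> {c \<in> space \<Omega>. E v c} \<in> sets \<Omega>"
    and p: "\<And>v. v \<in> D \<Longrightarrow> measure \<Omega> {c \<in> space \<Omega>. E v c} \<le> p"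
  shows "{c \<in> space \<Omega>. real (card D) < 2 * real (card {v \<in> D. E v c})} \<in> sets \<Omega>"
    and "measure \<Omega> {c \<in> space \<Omega>. real (card D) < 2 * real (card {v \<in> D. E v c})} \<le> 2 * p"
proof -
  let ?ind = "\<lambda>v. indicator {c \<in> space \<Omega>. E v c} :: _ \<Rightarrow> real"
  have count: "real (card {v \<in> D. E v c}) = (\<Sum>v\<in>D. ?ind v c)" if "c \<in> space \<Omega>" for c
    using that D(1) by (simp add: indicator_def sum.If_cases Int_def)
  have meas: "(\<lambda>c. \<Sum>v\<in>D. ?ind v c) \<in> borel_measurable \<Omega>"
    using E by (intro borel_measurable_sum borel_measurable_indicator)
  have eq: "{c \<in> space \<Omega>. real (card D) < 2 * real (card {v \<in> D. E v c})} =
      {c \<in> space \<Omega>. real (card D) < 2 * (\<Sum>v\<in>D. ?ind v c)}" (is "?B = _")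
    using count by auto
  show B: "?B \<in> sets \<Omega>" unfolding eq using meas by measurable
  have int: "integrable \<Omega> (?ind v)" if "v \<in> D" for v
    using E[OF that] by (intro integrable_real_indicator) (auto simp: less_top[symmetric])
  have d: "real (card D) > 0" using D by (simp add: card_gt_0_iff)
  have "measure \<Omega> ?B = (\<integral>c. indicator ?B c \<partial>\<Omega>)" using B by simp
  also have "\<dots> \<le> (\<integral>c. 2 / real (card D) * (\<Sum>v\<in>D. ?ind v c) \<partial>\<Omega>)"
  proof (rule integral_mono)
    show "integrable \<Omega> (indicator ?B :: _ \<Rightarrow> real)" using B by (intro integrable_real_indicator) (auto simp: less_top[symmetric])
    show "integrable \<Omega> (\<lambda>c. 2 / real (card D) * (\<Sum>v\<in>D. ?ind v c))"
      using int by (intro integrable_mult_right Bochner_Integration.integrable_sum) auto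
    fix c assume c: "c \<in> space \<Omega>"
    show "indicator ?B c \<le> 2 / real (card D) * (\<Sum>v\<in>D. ?ind v c)"
    proof (cases "c \<in> ?B")
      case True
      then have "real (card D) < 2 * (\<Sum>v\<in>D. ?ind v c)" unfolding eq by blast
      then have "1 \<le> 2 / real (card D) * (\<Sum>v\<in>D. ?ind v c)" using d by (simp add: field_simps)
      then show ?thesis using True by simp
    next
      case False
      moreover have "0 \<le> 2 / real (card D) * (\<Sum>v\<in>D. ?ind v c)" by (intro mult_nonneg_nonneg sum_nonneg) auto
      ultimately show ?thesis by simp
    qed
  qed
  also have "\<dots> = 2 / real (card D) * (\<Sum>v\<in>D. measure \<Omega> {c \<in> space \<Omega>. E v c})"
  proof -
    have "(\<integral>c. (\<Sum>v\<in>D. ?ind v c) \<partial>\<Omega>) = (\<Sum>v\<in>D. \<integral>c. ?ind v c \<partial>\<Omega>)"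
      using int by (rule Bochner_Integration.integral_sum)
    also have "\<dots> = (\<Sum>v\<in>D. measure \<Omega> {c \<in> space \<Omega>. E v c})"
      using E by (intro sum.cong) (auto simp: Int_absorb2 intro!: arg_cong[where f = "measure \<Omega>"])
    finally show ?thesis by simp
  qed
  also have "\<dots> \<le> 2 / real (card D) * (\<Sum>v\<in>D. p)"
    using p d by (intro mult_left_mono sum_mono) auto
  also have "\<dots> = 2 * p" using d by simp
  finally show "measure \<Omega> ?B \<le> 2 * p" .
qed

end

subsection \<open>Measurability\<close>

text \<open>The sorted list of a key function with ties is an unspecified value, but it is still determined
  by the order relation between the keys.\<close>

lemma fold_graph_insort_key_cong:
  assumes "fold_graph (insort_key c) [] B ys" "B \<subseteq> A"
    and "\<And>a b. a \<in> A \<Longrightarrow> b \<in> A \<Longrightarrow> c a \<le> c b \<longleftrightarrow> c' a \<le> c' b"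
  shows "fold_graph (insort_key c') [] B ys \<and> set ys \<subseteq> B"
  using assms(1,2)
proof (induction rule: fold_graph.induct)
  case emptyI
  then show ?case by (simp add: fold_graph.emptyI)
next
  case (insertI a B ys)
  have "insort_key c a ys = insort_key c' a ys" if "set ys \<subseteq> A" "a \<in> A" for ys
    using that by (induction ys) (auto simp: assms(3))
  then have "insort_key c a ys = insort_key c' a ys" using insertI by auto
  then show ?case
    using insertI fold_graph.insertI[of a B "insort_key c'" "[]" ys] by (auto simp: set_insort_key)
qed

lemma sorted_key_list_of_set_cong:
  fixes c c' :: "'a \<Rightarrow> 'b :: linorder"
  assumes "\<And>a b. a \<in> A \<Longrightarrow> b \<in> A \<Longrightarrow> c a \<le> c b \<longleftrightarrow> c' a \<le> c' b"
  shows "sorted_key_list_of_set c A = sorted_key_list_of_set c' A"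
proof -
  have fold: "sorted_key_list_of_set k A = Finite_Set.fold (insort_key k) [] A" for k :: "'a \<Rightarrow> 'b"
  proof -
    \<comment> \<open>Only the defining equation by \<open>Finite_Set.fold\<close> is wanted. Over
      the empty set the commutation law is vacuous, so that keys with ties are included.\<close>
    have "folding_on {} (insort_key k)" by unfold_locales simp
    then show ?thesis unfolding sorted_key_list_of_set_def by (rule folding_on.eq_fold)
  qed
  \<comment> \<open>\<open>Finite_Set.fold\<close> is a definite description over this relation, so
    equal relations give equal values even where ties make the result ambiguous.\<close>
  have "fold_graph (insort_key c) [] A = fold_graph (insort_key c') [] A"
    using fold_graph_insort_key_cong[of c A _ A c'] fold_graph_insort_key_cong[of c' A _ A c] assms by auto
  then show ?thesis unfolding fold Finite_Set.fold_def by simp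
qed

context clocks
begin

text \<open>The order pattern \<open>R c\<close> takes finitely many values, and the event is a
  union of the measurable cells on which the pattern is constant.\<close>

lemma sets_order_determined:
  assumes E: "E \<subseteq> clock_events"
    and Q: "\<And>c c'. (\<And>a b. a \<in> E \<Longrightarrow> b \<in> E \<Longrightarrow> c a \<le> c b \<longleftrightarrow> c' a \<le> c' b) \<Longrightarrow> Q c \<longleftrightarrow> Q c'"
  shows "{c \<in> space \<Omega>. Q c} \<in> sets \<Omega>"
proof -
  define R where "R c = {(a, b) \<in> E \<times> E. c a \<le> (c b :: real)}" for c
  have finE: "finite E" using E finite_clock_events finite_subset by blast
  have meas: "{c \<in> space \<Omega>. R c = R0} \<in> sets \<Omega>" for R0
  proof (cases "R0 \<subseteq> E \<times> E")
    case True
    have 1: "{c \<in> space \<Omega>. c (fst p) \<le> c (snd p) \<longleftrightarrow> p \<in> R0} \<in> sets \<Omega>" if "p \<in> E \<times> E" for p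
    proof -
      have "(\<lambda>c. c (fst p)) \<in> borel_measurable \<Omega>" "(\<lambda>c. c (snd p)) \<in> borel_measurable \<Omega>"
        using that E by (auto intro!: measurable_clock)
      then have "{c \<in> space \<Omega>. c (fst p) \<le> c (snd p)} \<in> sets \<Omega>" "{c \<in> space \<Omega>. c (snd p) < c (fst p)} \<in> sets \<Omega>"
        by measurable
      then show ?thesis by (cases "p \<in> R0") (simp_all add: not_le)
    qed
    have "{c \<in> space \<Omega>. R c = R0} = {c \<in> space \<Omega>. \<forall>p\<in>E \<times> E. c (fst p) \<le> c (snd p) \<longleftrightarrow> p \<in> R0}"
      using True unfolding R_def by fastforce
    then show ?thesis using 1 finE by (auto intro!: sets.sets_Collect_finite_All)
  next
    case False
    then have "{c \<in> space \<Omega>. R c = R0} = {}" by (auto simp: R_def)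
    then show ?thesis by (simp only: sets.empty_sets)
  qed
  have "{c \<in> space \<Omega>. Q c} = (\<Union>R0\<in>{R0 \<in> Pow (E \<times> E). \<exists>c. Q c \<and> R c = R0}. {c \<in> space \<Omega>. R c = R0})"
  proof (intro equalityI subsetI)
    fix c assume "c \<in> {c \<in> space \<Omega>. Q c}"
    moreover have "R c \<subseteq> E \<times> E" by (auto simp: R_def)
    ultimately show "c \<in> (\<Union>R0\<in>{R0 \<in> Pow (E \<times> E). \<exists>c. Q c \<and> R c = R0}. {c \<in> space \<Omega>. R c = R0})"
      by blast
  next
    fix c assume "c \<in> (\<Union>R0\<in>{R0 \<in> Pow (E \<times> E). \<exists>c. Q c \<and> R c = R0}. {c \<in> space \<Omega>. R c = R0})"
    then obtain c' where c: "c \<in> space \<Omega>" "Q c'" "R c' = R c" by auto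
    have "c' a \<le> c' b \<longleftrightarrow> c a \<le> c b" if "a \<in> E" "b \<in> E" for a b
      using c(3) that unfolding R_def by (auto simp: set_eq_iff)
    then show "c \<in> {c \<in> space \<Omega>. Q c}" using Q[of c' c] c by simp
  qed
  then show ?thesis using meas finE by (auto intro!: sets.finite_UN)
qed

lemma sets_forest_components:
  assumes T: "T \<subseteq> all_edges {1..n}"
  shows "{c \<in> space \<Omega>. \<exists>C\<in>forest_components n T c. Q C} \<in> sets \<Omega>"
proof (rule sets_order_determined)
  have finT: "finite T" using T finite_all_edges[of "{1..n}"] finite_subset by blast
  show "fire_events T \<subseteq> clock_events" using T by (auto simp: fire_events_def)
  fix c c' :: "fire_event \<Rightarrow> real"
  assume "\<And>a b. a \<in> fire_events T \<Longrightarrow> b \<in> fire_events T \<Longrightarrow> c a \<le> c b \<longleftrightarrow> c' a \<le> c' b"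
  then have "final_config T c = final_config T c'"
    unfolding final_config_def by (subst sorted_key_list_of_set_cong) auto
  then have "terminal_state T c = terminal_state T c'"
    using terminal_state_iff[OF finT] by (intro ext) simp
  then have "forest_components n T c = forest_components n T c'"
    by (simp add: forest_components_def forest_edges_def fireproof_vertices_def)
  then show "(\<exists>C\<in>forest_components n T c. Q C) \<longleftrightarrow> (\<exists>C\<in>forest_components n T c'. Q C)" by simp
qed

lemma sets_Protect_Ignite:
  assumes e: "e \<in> all_edges {1..n}" "f \<in> all_edges {1..n}" and D: "D \<subseteq> all_edges {1..n}"
  shows "{c \<in> space \<Omega>. c (Protect e) \<le> s \<and> (\<forall>g\<in>D. c (Ignite f) < c (Protect g))} \<in> sets \<Omega>"
proof -
  have finD: "finite D" using D finite_all_edges[of "{1..n}"] finite_subset by blast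
  have in_ev: "Protect g \<in> clock_events" "Ignite g \<in> clock_events" if "g \<in> all_edges {1..n}" for g
    using that by (auto simp: fire_events_def)
  have "{c \<in> space \<Omega>. c (Ignite f) < c (Protect g)} \<in> sets \<Omega>" if "g \<in> D" for g
  proof -
    have "(\<lambda>c. c (Protect g)) \<in> borel_measurable \<Omega>" "(\<lambda>c. c (Ignite f)) \<in> borel_measurable \<Omega>"
      using that D e in_ev by (auto intro!: measurable_clock)
    then show ?thesis by measurable
  qed
  moreover have "{c \<in> space \<Omega>. c (Protect e) \<le> s} \<in> sets \<Omega>"
    using measurable_clock[OF in_ev(1)[OF e(1)]] by measurable
  ultimately show ?thesis
    by (intro sets.sets_Collect_conj sets.sets_Collect_finite_All finD) auto
qed

text \<open>A union bound over four bad events: two clocks tie; some fire starts by time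
  \<open>s\<close>; no candidate is protected by time \<open>s\<close>; some candidate is protected
  by then although more than half of its subtree is scorched. Outside of these, the unscorched half
  provides the component.\<close>

lemma tree_success:
  assumes RT: "rooted_tree {1..n} T 1 par dep"
    and C: "C \<subseteq> {1..n} - {1}"
    and size: "\<And>x. x \<in> C \<Longrightarrow> m \<le> real (card (rooted_tree.desc {1..n} par x))" and m: "m > 0"
    and W: "\<And>x v. x \<in> C \<Longrightarrow> v \<in> rooted_tree.desc {1..n} par x \<Longrightarrow>
      (\<Sum>u\<in>rooted_tree.desc {1..n} par x. 1 / real (rooted_tree.hit {1..n} par x v u)) \<le> W"
    and s: "s \<ge> 0"
  shows "measure \<Omega> {c \<in> space \<Omega>. \<exists>K\<in>forest_components n T c. m / 2 \<le> real (card K)} \<ge>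
    1 - (real n * (r * s) + exp (- (s * real (card C))) + real (card C) * (4 * r * s * W))"
proof -
  interpret rooted_tree "{1..n}" T 1 par dep by (rule RT)
  let ?V = "{1..n}"
  let ?e = "\<lambda>x. {x, par x}"
  have e_in: "?e x \<in> all_edges ?V" if "x \<in> ?V" "x \<noteq> 1" for x
    using edge_in_T[OF that] T_subset by blast
  have finC: "finite C" using C finite_subset by blast
  define B0 where "B0 = (\<Union>p\<in>{p \<in> clock_events \<times> clock_events. fst p \<noteq> snd p}. {c \<in> space \<Omega>. c (fst p) = c (snd p)})"
  define B1 where "B1 = (\<Union>f\<in>T. {c \<in> space \<Omega>. c (Ignite f) \<le> s})"
  define B2 where "B2 = {c \<in> space \<Omega>. \<forall>e\<in>?e ` C. s < c (Protect e)}"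
  \<comment> \<open>Protection by time \<open>s\<close> is part of the event, so that each term of
    the union bound over the candidates \<open>x\<close> keeps the factor \<open>s\<close>.\<close>
  define E where "E x v c \<longleftrightarrow> c (Protect (?e x)) \<le> s \<and> scorched c x v" for x v c
  define B3 where "B3 x = {c \<in> space \<Omega>. real (card (desc x)) < 2 * real (card {v \<in> desc x. E x v c})}" for x
  have fin_pairs: "finite {p \<in> clock_events \<times> clock_events. fst p \<noteq> snd p}"
    using finite_clock_events by (intro finite_subset[OF _ finite_cartesian_product]) auto
  have B0_sets: "{c \<in> space \<Omega>. c (fst p) = c (snd p)} \<in> sets \<Omega>" if "p \<in> clock_events \<times> clock_events" for p
  proof -
    have "(\<lambda>c. c (fst p)) \<in> borel_measurable \<Omega>" "(\<lambda>c. c (snd p)) \<in> borel_measurable \<Omega>"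
      using that by (auto intro!: measurable_clock)
    then show ?thesis by measurable
  qed
  have B0: "B0 \<in> sets \<Omega>" unfolding B0_def using fin_pairs B0_sets by (intro sets.finite_UN) auto
  have mB0: "measure \<Omega> B0 \<le> 0"
  proof -
    have "measure \<Omega> B0 \<le> (\<Sum>p\<in>{p \<in> clock_events \<times> clock_events. fst p \<noteq> snd p}. measure \<Omega> {c \<in> space \<Omega>. c (fst p) = c (snd p)})"
      unfolding B0_def using fin_pairs B0_sets by (intro finite_measure_subadditive_finite) auto
    also have "\<dots> = 0" using null_tie by (intro sum.neutral) auto
    finally show ?thesis .
  qed
  have TE: "T \<subseteq> all_edges ?V" by (rule T_subset)
  have B1_sets: "{c \<in> space \<Omega>. c (Ignite f) \<le> s} \<in> sets \<Omega>" if "f \<in> T" for f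
  proof -
    have "(\<lambda>c. c (Ignite f)) \<in> borel_measurable \<Omega>"
      using that TE by (intro measurable_clock) (auto simp: fire_events_def)
    then show ?thesis by measurable
  qed
  have B1: "B1 \<in> sets \<Omega>" unfolding B1_def using finite_T B1_sets by (intro sets.finite_UN) auto
  have mB1: "measure \<Omega> B1 \<le> real n * (r * s)"
  proof -
    have "measure \<Omega> B1 \<le> (\<Sum>f\<in>T. measure \<Omega> {c \<in> space \<Omega>. c (Ignite f) \<le> s})"
      unfolding B1_def using finite_T B1_sets by (intro finite_measure_subadditive_finite) auto
    also have "\<dots> \<le> (\<Sum>f\<in>T. r * s)"
      using TE s by (intro sum_mono measure_Ignite_le) auto
    also have "\<dots> = real (card T) * (r * s)" by simp
    also have "\<dots> \<le> real n * (r * s)"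
    proof (rule mult_right_mono)
      have "card T \<le> card (?V - {1})" unfolding T_eq by (rule card_image_le) simp
      also have "\<dots> \<le> card ?V" by (rule card_mono) auto
      finally show "real (card T) \<le> real n" by simp
    qed (use r_pos s in simp)
    finally show ?thesis .
  qed
  have eC: "?e ` C \<subseteq> all_edges ?V" using e_in C by blast
  have card_eC: "card (?e ` C) = card C"
    using inj_on_subset[OF edge_inj C] by (rule card_image)
  have mB2: "measure \<Omega> B2 \<le> exp (- (s * real (card C)))"
    unfolding B2_def using measure_no_cut[OF eC s] card_eC by simp
  have B2: "B2 \<in> sets \<Omega>"
  proof -
    have "{c \<in> space \<Omega>. \<forall>a\<in>Protect ` ?e ` C. c a \<in> {s<..}} \<in> sets \<Omega>"
      using eC by (intro sets_box) (auto simp: fire_events_def)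
    then show ?thesis by (simp add: B2_def)
  qed
  have B3: "B3 x \<in> sets \<Omega> \<and> measure \<Omega> (B3 x) \<le> 4 * r * s * W" if x: "x \<in> C" for x
  proof -
    have xV: "x \<in> ?V" "x \<noteq> 1" using x C by auto
    have ev: "{c \<in> space \<Omega>. E x v c} \<in> sets \<Omega> \<and> measure \<Omega> {c \<in> space \<Omega>. E x v c} \<le> 2 * r * s * W"
      if v: "v \<in> desc x" for v
    proof -
      \<comment> \<open>The edges to be climbed from \<open>u\<close>. They are the edges above
        distinct vertices strictly below \<open>x\<close>, so there are \<open>hit x v u\<close> of
        them, and the edge above \<open>x\<close> is not among them.\<close>
      define D where "D u = (\<lambda>j. ?e ((par ^^ j) u)) ` {..<hit x v u}" for u
      define F where "F u = {c \<in> space \<Omega>. c (Protect (?e x)) \<le> s \<and> (\<forall>g\<in>D u. c (Ignite (?e u)) < c (Protect g))}" for u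
      have eq: "{c \<in> space \<Omega>. E x v c} = (\<Union>u\<in>desc x - {x}. F u)"
        unfolding E_def scorched_def F_def D_def by auto
      have D: "D u \<subseteq> all_edges ?V \<and> ?e x \<notin> D u \<and> D u \<noteq> {} \<and> card (D u) = hit x v u \<and> ?e u \<in> all_edges ?V"
        if u: "u \<in> desc x - {x}" for u
      proof -
        have uV: "u \<in> ?V" using u desc_V by blast
        have dep_xu: "dep x < dep u" using u desc_dep desc_antisym by (metis DiffE insertI1 le_neq_implies_less order_refl)
        have below: "dep x < dep ((par ^^ j) u) \<and> (par ^^ j) u \<noteq> x \<and> dep ((par ^^ j) u) = dep u - j \<and> j < dep u"
          if j: "j < hit x v u" for j
        proof (cases "j = 0")
          case True
          then show ?thesis using dep_xu u by auto
        next
          case False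
          then have "j < (LEAST i. (par ^^ i) u \<in> spine x v)" using j unfolding hit_def less_max_iff_disj by linarith
          then have "j < dep u - dep x" using hit_Least(2)[OF v] u by fastforce
          then show ?thesis using dep_iter[OF uV, of j] by auto
        qed
        have inV: "(par ^^ j) u \<in> ?V - {1}" if "j < hit x v u" for j
          using below[OF that] iter_V[OF uV, of j] dep_r by (metis DiffI not_less_zero singletonD)
        have "inj_on (\<lambda>j. ?e ((par ^^ j) u)) {..<hit x v u}"
        proof (rule inj_onI)
          fix i j assume ij: "i \<in> {..<hit x v u}" "j \<in> {..<hit x v u}" "?e ((par ^^ i) u) = ?e ((par ^^ j) u)"
          then have "(par ^^ i) u = (par ^^ j) u"
            using inV by (intro inj_onD[OF edge_inj]) auto
          then have "dep u - i = dep u - j" using below[of i] below[of j] ij by auto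
          then show "i = j" using below[of i] below[of j] ij by auto
        qed
        then have "card (D u) = hit x v u" unfolding D_def by (simp add: card_image)
        moreover have "?e x \<notin> D u"
        proof
          assume "?e x \<in> D u"
          then obtain j where j: "j < hit x v u" "?e x = ?e ((par ^^ j) u)" by (auto simp: D_def)
          then have "x = (par ^^ j) u" using inV[OF j(1)] xV by (intro inj_onD[OF edge_inj]) auto
          then show False using below[OF j(1)] by simp
        qed
        moreover have "hit x v u \<ge> 1" unfolding hit_def by (rule max.cobounded1)
        moreover have "D u \<subseteq> all_edges ?V" unfolding D_def using inV e_in by blast
        moreover have "?e u \<in> all_edges ?V" using inV[of 0] e_in[of u] \<open>hit x v u \<ge> 1\<close> by auto
        ultimately show ?thesis by auto
      qed
      have F: "F u \<in> sets \<Omega>" "measure \<Omega> (F u) \<le> 2 * r * s * (1 / real (hit x v u))" if "u \<in> desc x - {x}" for u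
        using sets_Protect_Ignite[of "?e x" "?e u" "D u" s] measure_Protect_Ignite[of "?e x" "?e u" "D u" s]
          D[OF that] e_in[OF xV] s by (auto simp: F_def)
      have fin: "finite (desc x - {x})" using finite_desc by blast
      have "measure \<Omega> (\<Union>u\<in>desc x - {x}. F u) \<le> (\<Sum>u\<in>desc x - {x}. measure \<Omega> (F u))"
        using fin F by (intro finite_measure_subadditive_finite) auto
      also have "\<dots> \<le> (\<Sum>u\<in>desc x - {x}. 2 * r * s * (1 / real (hit x v u)))"
        by (intro sum_mono F)
      also have "\<dots> \<le> (\<Sum>u\<in>desc x. 2 * r * s * (1 / real (hit x v u)))"
        using finite_desc r_pos s by (intro sum_mono2) auto
      also have "\<dots> = 2 * r * s * (\<Sum>u\<in>desc x. 1 / real (hit x v u))" by (simp add: sum_distrib_left)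
      also have "\<dots> \<le> 2 * r * s * W" using W[OF x v] r_pos s by (intro mult_left_mono) auto
      finally show ?thesis unfolding eq using fin F by (auto intro!: sets.finite_UN)
    qed
    have ne: "desc x \<noteq> {}" using desc_self[OF xV(1)] by auto
    note markov = markov_count[OF finite_desc ne conjunct1[OF ev] conjunct2[OF ev]]
    have "B3 x \<in> sets \<Omega>" unfolding B3_def by (rule markov(1))
    moreover have "measure \<Omega> (B3 x) \<le> 2 * (2 * r * s * W)" unfolding B3_def by (rule markov(2))
    ultimately show ?thesis by simp
  qed
  let ?U = "\<Union>x\<in>C. B3 x"
  have U: "?U \<in> sets \<Omega>" using finC B3 by (intro sets.finite_UN) auto
  have mU: "measure \<Omega> ?U \<le> real (card C) * (4 * r * s * W)"
  proof -
    have "measure \<Omega> ?U \<le> (\<Sum>x\<in>C. measure \<Omega> (B3 x))"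
      using finC B3 by (intro finite_measure_subadditive_finite) auto
    also have "\<dots> \<le> (\<Sum>x\<in>C. 4 * r * s * W)" using B3 by (intro sum_mono) auto
    finally show ?thesis by simp
  qed
  let ?B = "B0 \<union> B1 \<union> B2 \<union> ?U"
  have B: "?B \<in> sets \<Omega>" using B0 B1 B2 U by auto
  have "measure \<Omega> ?B \<le> measure \<Omega> (B0 \<union> B1 \<union> B2) + measure \<Omega> ?U"
    using B0 B1 B2 U by (intro measure_Un_le) auto
  also have "measure \<Omega> (B0 \<union> B1 \<union> B2) \<le> measure \<Omega> (B0 \<union> B1) + measure \<Omega> B2"
    using B0 B1 B2 by (intro measure_Un_le) auto
  also have "measure \<Omega> (B0 \<union> B1) \<le> measure \<Omega> B0 + measure \<Omega> B1"
    using B0 B1 by (intro measure_Un_le) auto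
  finally have mB: "measure \<Omega> ?B \<le> real n * (r * s) + exp (- (s * real (card C))) + real (card C) * (4 * r * s * W)"
    using mB0 mB1 mB2 mU by linarith
  have "space \<Omega> - ?B \<subseteq> {c \<in> space \<Omega>. \<exists>K\<in>forest_components n T c. m / 2 \<le> real (card K)}"
  proof
    fix c assume c: "c \<in> space \<Omega> - ?B"
    have inj: "inj_on c (fire_events T)"
    proof (rule inj_onI, rule ccontr)
      fix a b assume ab: "a \<in> fire_events T" "b \<in> fire_events T" "c a = c b" "a \<noteq> b"
      then have "(a, b) \<in> {p \<in> clock_events \<times> clock_events. fst p \<noteq> snd p}"
        using TE by (auto simp: fire_events_def)
      then have "c \<in> B0" unfolding B0_def using c ab by fastforce
      then show False using c by blast
    qed
    have nofire: "s < c (Ignite f)" if "f \<in> T" for f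
      using c that unfolding B1_def by fastforce
    obtain x where x: "x \<in> C" "c (Protect (?e x)) \<le> s"
      using c unfolding B2_def by fastforce
    then have "c \<notin> B3 x" using c by blast
    then have "2 * card {v \<in> desc x. E x v c} \<le> card (desc x)" using c unfolding B3_def by simp
    moreover have "{v \<in> desc x. E x v c} = {v \<in> desc x. scorched c x v}" using x by (simp add: E_def)
    moreover have "card (desc x) = card {v \<in> desc x. scorched c x v} + card {v \<in> desc x. \<not> scorched c x v}"
      using finite_desc by (subst card_Un_disjoint[symmetric]) (auto intro!: arg_cong[where f = card])
    ultimately have "card (desc x) \<le> 2 * card {v \<in> desc x. \<not> scorched c x v}" by simp
    then have half: "m / 2 \<le> real (card {v \<in> desc x. \<not> scorched c x v})" using size[OF x(1)] by linarith
    then have "{v \<in> desc x. \<not> scorched c x v} \<noteq> {}" using m by (metis card.empty half_gt_zero not_less of_nat_0)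
    then obtain K where "K \<in> forest_components n T c" "card {v \<in> desc x. \<not> scorched c x v} \<le> card K"
      using card_component_ge[OF refl inj x(2) nofire] by blast
    then have "\<exists>K\<in>forest_components n T c. m / 2 \<le> real (card K)"
      using half by (intro bexI[of _ K]) auto
    then show "c \<in> {c \<in> space \<Omega>. \<exists>K\<in>forest_components n T c. m / 2 \<le> real (card K)}" using c by blast
  qed
  then have "measure \<Omega> (space \<Omega> - ?B) \<le> measure \<Omega> {c \<in> space \<Omega>. \<exists>K\<in>forest_components n T c. m / 2 \<le> real (card K)}"
    using sets_forest_components[OF TE] by (rule finite_measure_mono)
  moreover have "measure \<Omega> (space \<Omega> - ?B) = 1 - measure \<Omega> ?B" using B by (rule prob_compl)
  ultimately show ?thesis using mB by linarith
qed

end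

subsection \<open>Typical trees\<close>

text \<open>No root occurs: a branch is the side of \<open>w\<close> after cutting an edge at
  \<open>w\<close>, in either direction, which is the form that the count over unrooted trees
  treats. In a rooted tree this covers the subtree of every vertex except the root.\<close>

definition tall_branch :: "nat set \<Rightarrow> edge set \<Rightarrow> nat \<Rightarrow> nat \<Rightarrow> bool" where
  "tall_branch V T k h \<longleftrightarrow> (\<exists>w y. {w, y} \<in> T \<and> card (component V (T - {{w, y}}) w) \<le> k \<and>
     (\<exists>xs. length xs = h \<and> distinct (w # xs) \<and>
       path_edges w xs \<subseteq> T \<inter> all_edges (component V (T - {{w, y}}) w)))"

text \<open>Markov's inequality for the \<open>p\<close>-th moment. In \<open>n^3\<close>, two
  factors come from the union over \<open>x\<close> and \<open>\<rho>\<close>, the third from the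
  one spare \<open>\<rho>\<close> in the moment bound, which is of order
  \<open>\<rho>^(2 * p + 1)\<close>.\<close>

lemma card_large_ball:
  assumes V: "finite V" "V \<noteq> {}" and K: "K > 0"
  shows "real (card {T. is_tree V T \<and> (\<exists>x\<in>V. \<exists>\<rho>\<in>{1..card V}. K * real \<rho> ^ 2 < real (card (tree_ball T x \<rho>)))}) \<le>
    real (card {T. is_tree V T}) * (2 ^ p * (real p + 1) ^ Suc p * real (card V) ^ 3 / K ^ p)"
proof -
  let ?n = "card V" and ?N = "real (card {T. is_tree V T})"
  define c where "c = (2 ^ p * (real p + 1) ^ Suc p :: real)"
  define S where "S x \<rho> = {T. is_tree V T \<and> K * real \<rho> ^ 2 < real (card (tree_ball T x \<rho>))}" for x \<rho>
  have finS: "finite (S x \<rho>)" for x \<rho>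
    unfolding S_def by (rule finite_subset[OF _ finite_trees[OF V(1)]]) auto
  have S: "real (card (S x \<rho>)) \<le> ?N * (c * real ?n / K ^ p)" if x: "x \<in> V" and \<rho>: "\<rho> \<in> {1..?n}" for x \<rho>
  proof -
    have pos: "(K * real \<rho> ^ 2) ^ p > 0" using K \<rho> by simp
    have "real (card (S x \<rho>)) * (K * real \<rho> ^ 2) ^ p = (\<Sum>T\<in>S x \<rho>. (K * real \<rho> ^ 2) ^ p)" by simp
    also have "\<dots> \<le> (\<Sum>T\<in>S x \<rho>. real (card (tree_ball T x \<rho>)) ^ p)"
      using K by (intro sum_mono power_mono) (auto simp: S_def)
    also have "\<dots> \<le> (\<Sum>T\<in>{T. is_tree V T}. real (card (tree_ball T x \<rho>)) ^ p)"
      using finite_trees[OF V(1)] by (intro sum_mono2) (auto simp: S_def)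
    also have "\<dots> \<le> ?N * (real \<rho> + 1) ^ p * (1 + real p * real \<rho>) ^ Suc p"
      using tree_ball_moment[OF V(1) is_tree_singleton[of x], of x \<rho> p] x by simp
    also have "\<dots> \<le> ?N * (2 * real \<rho>) ^ p * ((real p + 1) * real \<rho>) ^ Suc p"
      using \<rho> by (intro mult_mono power_mono) (auto simp: algebra_simps)
    also have "\<dots> = ?N * c * real \<rho> * (real \<rho> ^ 2) ^ p"
      by (simp add: c_def power_mult_distrib power2_eq_square mult_ac)
    also have "\<dots> \<le> ?N * c * real ?n * (real \<rho> ^ 2) ^ p"
      using \<rho> by (intro mult_right_mono mult_left_mono) (auto simp: c_def)
    finally have "real (card (S x \<rho>)) * K ^ p * (real \<rho> ^ 2) ^ p \<le> ?N * c * real ?n * (real \<rho> ^ 2) ^ p"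
      by (simp add: power_mult_distrib mult_ac)
    then have "real (card (S x \<rho>)) * K ^ p \<le> ?N * c * real ?n"
      using \<rho> by (simp add: mult_le_cancel_right)
    then show ?thesis using K by (simp add: field_simps)
  qed
  have "{T. is_tree V T \<and> (\<exists>x\<in>V. \<exists>\<rho>\<in>{1..?n}. K * real \<rho> ^ 2 < real (card (tree_ball T x \<rho>)))} =
      (\<Union>x\<in>V. \<Union>\<rho>\<in>{1..?n}. S x \<rho>)" by (auto simp: S_def)
  also have "card \<dots> \<le> (\<Sum>x\<in>V. \<Sum>\<rho>\<in>{1..?n}. card (S x \<rho>))"
    by (intro order_trans[OF card_UN_le] sum_mono V finite_atLeastAtMost order_refl)
  finally have "real (card {T. is_tree V T \<and> (\<exists>x\<in>V. \<exists>\<rho>\<in>{1..?n}. K * real \<rho> ^ 2 < real (card (tree_ball T x \<rho>)))}) \<le>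
      (\<Sum>x\<in>V. \<Sum>\<rho>\<in>{1..?n}. real (card (S x \<rho>)))"
    by (simp only: of_nat_sum[symmetric] of_nat_le_iff)
  also have "\<dots> \<le> (\<Sum>x\<in>V. \<Sum>\<rho>\<in>{1..?n}. ?N * (c * real ?n / K ^ p))"
    by (intro sum_mono S)
  also have "\<dots> = ?N * (c * real ?n ^ 3 / K ^ p)" by (simp add: power3_eq_cube)
  finally show ?thesis by (simp only: c_def)
qed

context rooted_tree
begin

lemma not_tall_branch:
  assumes nt: "\<not> tall_branch V T k h" and w: "w \<noteq> r" "card (desc w) \<le> k"
    and v: "v \<in> V" "i \<le> dep v" "(par ^^ i) v = w"
  shows "i < h"
proof (rule ccontr)
  assume "\<not> i < h"
  then have h: "h \<le> i" by simp
  \<comment> \<open>\<open>tall_branch\<close> speaks of paths of length exactly \<open>h\<close>,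
    so the climb is shortened to begin \<open>h\<close> levels below \<open>w\<close>.\<close>
  define u where "u = (par ^^ (i - h)) v"
  have uV: "u \<in> V" unfolding u_def by (rule iter_V[OF v(1)])
  have wV: "w \<in> V" using iter_V[OF v(1)] v(3) by auto
  have w_eq: "(par ^^ h) u = w" unfolding u_def using v(3) h by (simp flip: funpow_add comp_apply[of "par ^^ _" "par ^^ _"])
  have "h \<le> dep u" using dep_iter[OF v(1), of "i - h"] v(2) h by (simp add: u_def)
  then obtain xs where "length xs = h" "distinct (w # xs)" "path_edges w xs \<subseteq> T \<inter> all_edges (desc w)"
    using desc_path[OF uV, of h] unfolding w_eq by blast
  moreover have "component V (T - {{w, par w}}) w = desc w" by (rule component_desc[OF wV w(1)])
  ultimately have "tall_branch V T k h"
    unfolding tall_branch_def using edge_in_T[OF wV w(1)] w(2)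
    by (intro exI[of _ w] exI[of _ "par w"]) auto
  then show False using nt by simp
qed

lemma dep_less:
  assumes "\<not> (\<exists>xs. length xs = D \<and> distinct (r # xs) \<and> path_edges r xs \<subseteq> T)" and v: "v \<in> V"
  shows "dep v < D"
proof (rule ccontr)
  assume "\<not> dep v < D"
  define u where "u = (par ^^ (dep v - D)) v"
  have uV: "u \<in> V" unfolding u_def by (rule iter_V[OF v])
  have "dep u = D" using dep_iter[OF v, of "dep v - D"] \<open>\<not> dep v < D\<close> by (simp add: u_def)
  then have "(par ^^ D) u = r" "D \<le> dep u" using iter_root[OF uV] by auto
  then show False using desc_path[OF uV, of D] assms(1) by auto
qed

end

section \<open>Combining typical trees with the clocks\<close>

context clocks
begin

text \<open>The candidates are the vertices with subtree size between \<open>m\<close> and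
  \<open>M\<close>: the covering by balls gives at least \<open>n / (9 * K * h) - h\<close> vertices
  in \<open>heavy m\<close>, and the bound on the depths at most \<open>n * (D + 1) / M\<close> in
  \<open>heavy M\<close>.\<close>

lemma good_tree_success:
  assumes tree: "is_tree {1..n} T" and n: "n \<ge> 1"
    and ball: "\<And>x \<rho>. x \<in> {1..n} \<Longrightarrow> \<rho> \<in> {1..n} \<Longrightarrow> real (card (tree_ball T x \<rho>)) \<le> K * real \<rho> ^ 2" and K: "K \<ge> 1"
    and D: "\<not> (\<exists>xs. length xs = D \<and> distinct (1 # xs) \<and> path_edges 1 xs \<subseteq> T)"
    and m: "\<not> tall_branch {1..n} T m h" "1 \<le> m" "m \<le> n" "1 \<le> h"
    and M: "\<not> tall_branch {1..n} T M L" "1 \<le> M" "M \<le> n" "1 \<le> L"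
    and q: "real q \<le> real n / (9 * K * real h) - real h - real n * (real D + 1) / real M"
    and s: "s \<ge> 0"
  shows "measure \<Omega> {c \<in> space \<Omega>. \<exists>C\<in>forest_components n T c. real m / 2 \<le> real (card C)} \<ge>
    1 - (real n * (r * s) + exp (- (s * real q)) + real q * (4 * r * s * (8 * K * real L * (harm L + 1))))"
proof -
  have "finite {1..n}" "1 \<in> {1..n}" using n by auto
  then obtain par dep where RT: "rooted_tree {1..n} T 1 par dep"
    using tree by (rule_tac is_tree_imp_rooted_tree[of "{1..n}" T 1]) auto
  interpret rooted_tree "{1..n}" T 1 par dep by (rule RT)
  \<comment> \<open>Beyond radius \<open>n\<close> the trivial bound by the number of vertices is
    enough, because \<open>K \<ge> 1\<close>.\<close>
  have ball': "real (card (tree_ball T x \<rho>)) \<le> K * real \<rho> ^ 2" if x: "x \<in> {1..n}" and \<rho>: "1 \<le> \<rho>" for x \<rho>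
  proof (cases "\<rho> \<le> n")
    case True
    then show ?thesis using ball x \<rho> by simp
  next
    case False
    have "card (tree_ball T x \<rho>) \<le> card {1..n}" using tree_ball_V[OF x] by (rule card_mono[rotated]) simp
    then have "real (card (tree_ball T x \<rho>)) \<le> real \<rho>" using False by simp
    also have "\<dots> \<le> 1 * real \<rho> ^ 2" using \<rho> by (simp add: power2_eq_square)
    also have "\<dots> \<le> K * real \<rho> ^ 2" using K by (intro mult_right_mono) auto
    finally show ?thesis .
  qed
  have root_big: "card (desc 1) = n" using desc_root by simp
  have light: "i < h" if "w \<in> {1..n}" "card (desc w) < m" "v \<in> {1..n}" "i \<le> dep v" "(par ^^ i) v = w" for w v i
  proof -
    have "w \<noteq> 1" using that(2) m root_big by auto
    then show ?thesis using not_tall_branch[OF m(1)] that by simp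
  qed
  have depD: "dep v \<le> D" if "v \<in> {1..n}" for v using dep_less[OF D that] by simp
  have "real (card {1..n}) \<le> (real (card (heavy m)) / real h + 1) * (K * (3 * real h) ^ 2)"
  proof (rule card_le_heavy[OF ball' m(4)])
    show "m \<le> card {1..n}" using m by simp
    show "i < h" if "w \<in> {1..n}" "card (desc w) < m" "v \<in> {1..n}" "i \<le> dep v" "(par ^^ i) v = w" for w v i
      using that by (rule light)
  qed
  then have "real n \<le> (real (card (heavy m)) / real h + 1) * (9 * K * real h * real h)"
    by (simp add: power2_eq_square mult_ac)
  also have "\<dots> = (real (card (heavy m)) + real h) * (9 * K * real h)"
    using m(4) by (simp add: field_simps)
  finally have heavy_m: "real n / (9 * K * real h) \<le> real (card (heavy m)) + real h"
    using K m(4) by (simp add: pos_divide_le_eq)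
  have "card (heavy M) * M \<le> card {1..n} * (D + 1)" by (rule card_heavy_mult_le[OF depD])
  then have "real (card (heavy M)) * real M \<le> real n * (real D + 1)"
  proof -
    assume "card (heavy M) * M \<le> card {1..n} * (D + 1)"
    then have "real (card (heavy M) * M) \<le> real (n * (D + 1))" unfolding of_nat_le_iff by simp
    then show ?thesis unfolding of_nat_mult by (simp add: add.commute)
  qed
  then have heavy_M: "real (card (heavy M)) \<le> real n * (real D + 1) / real M"
    using M(2) by (simp add: pos_le_divide_eq)
  have "real (card (heavy m)) - real (card (heavy M)) \<le> real (card (heavy m - heavy M))"
    using diff_card_le_card_Diff[OF finite_heavy[of M], of "heavy m"] by linarith
  then have "real q \<le> real (card (heavy m - heavy M))"
    using q heavy_m heavy_M by linarith
  then have "q \<le> card (heavy m - heavy M)" by simp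
  \<comment> \<open>Exactly \<open>q\<close> candidates are kept: enough for one to be protected by
    time \<open>s\<close>, but no more, because the union bound for scorching grows with their
    number.\<close>
  then obtain C where C: "C \<subseteq> heavy m - heavy M" "card C = q"
    by (metis obtain_subset_with_card_n)
  have CV: "x \<in> {1..n} \<and> x \<noteq> 1 \<and> m \<le> card (desc x) \<and> card (desc x) < M" if "x \<in> C" for x
  proof -
    have "x \<in> heavy m" "x \<notin> heavy M" using that C by auto
    then have x: "x \<in> {1..n}" "m \<le> card (desc x)" "card (desc x) < M" by (auto simp only: heavy_def mem_Collect_eq not_le)
    then have "x \<noteq> 1" using root_big M(3) by auto
    then show ?thesis using x by simp
  qed
  have "measure \<Omega> {c \<in> space \<Omega>. \<exists>C\<in>forest_components n T c. real m / 2 \<le> real (card C)} \<ge>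
    1 - (real n * (r * s) + exp (- (s * real (card C))) + real (card C) * (4 * r * s * (8 * K * real L * (harm L + 1))))"
  proof (rule tree_success[OF RT])
    show "C \<subseteq> {1..n} - {1}" using CV by blast
    show "real m \<le> real (card (desc x))" if "x \<in> C" for x using CV[OF that] by simp
    show "(\<Sum>u\<in>desc x. 1 / real (hit x v u)) \<le> 8 * K * real L * (harm L + 1)" if x: "x \<in> C" and v: "v \<in> desc x" for x v
    proof (rule sum_inverse_hit_le[OF ball' _ M(4) v])
      fix u assume u: "u \<in> desc x"
      have xV: "x \<in> {1..n}" "x \<noteq> 1" "card (desc x) \<le> M" using CV[OF x] by auto
      have uV: "u \<in> {1..n}" using u desc_V by blast
      have "dep x \<le> dep u" "(par ^^ (dep u - dep x)) u = x" using desc_iff[OF uV xV(1)] u by auto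
      then have "dep u - dep x < L" using not_tall_branch[OF M(1) xV(2,3) uV] by simp
      then show "dep u \<le> dep x + L" by simp
    qed
  qed (use m s in auto)
  then show ?thesis using C by simp
qed

end

text \<open>There are finitely many trees, so the event is a finite disjoint union of rectangles and
  its probability is the average over \<open>T\<close> of the probabilities for fixed
  \<open>T\<close>. Bad trees cost at most \<open>e1\<close>, good ones at most
  \<open>e2\<close>.\<close>

lemma measure_fire_space_ge:
  assumes r: "r > 0" and n: "n \<ge> 1" and good: "good \<subseteq> cayley_trees n"
    and bad: "real (card (cayley_trees n - good)) \<le> real (card (cayley_trees n)) * e1"
    and e2: "\<And>T. T \<in> good \<Longrightarrow> measure (clock_space n r) {c \<in> space (clock_space n r). Q T c} \<ge> 1 - e2" "e2 \<ge> 0"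
    and sets: "\<And>T. T \<in> cayley_trees n \<Longrightarrow> {c \<in> space (clock_space n r). Q T c} \<in> sets (clock_space n r)"
  shows "\<P>((T, c) in fire_space n r. Q T c) \<ge> 1 - e1 - e2"
    and "\<P>((T, c) in fire_space n r. Q T c) \<le> 1"
proof -
  interpret C: clocks n r by unfold_locales (rule r)
  let ?A = "cayley_trees n" and ?\<Omega> = "clock_space n r"
  have finA: "finite ?A" unfolding cayley_trees_def by (rule finite_trees) simp
  have cardA: "card ?A > 0" unfolding cayley_trees_def by (rule card_trees_pos) (use n in auto)
  interpret U: prob_space "uniform_count_measure ?A"
    using finA cardA by (intro prob_space_uniform_count_measure) auto
  interpret P: pair_prob_space "uniform_count_measure ?A" ?\<Omega> ..
  have fire_space: "fire_space n r = uniform_count_measure ?A \<Otimes>\<^sub>M ?\<Omega>" by (simp add: fire_space_def)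
  show "\<P>((T, c) in fire_space n r. Q T c) \<le> 1" unfolding fire_space by (rule P.prob_le_1)
  let ?S = "\<lambda>T. {c \<in> space ?\<Omega>. Q T c}"
  have eq: "{(T, c) \<in> space (fire_space n r). Q T c} = (\<Union>T\<in>?A. {T} \<times> ?S T)"
    unfolding fire_space space_pair_measure space_uniform_count_measure by auto
  have set1: "{T} \<in> sets (uniform_count_measure ?A)" if "T \<in> ?A" for T
    using that by (simp add: sets_uniform_count_measure)
  have "measure (fire_space n r) (\<Union>T\<in>?A. {T} \<times> ?S T) = (\<Sum>T\<in>?A. measure (fire_space n r) ({T} \<times> ?S T))"
    unfolding fire_space using finA set1 sets
    by (intro P.finite_measure_finite_Union) (auto simp: disjoint_family_on_def)
  also have "\<dots> = (\<Sum>T\<in>?A. 1 / real (card ?A) * measure ?\<Omega> (?S T))"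
  proof (rule sum.cong)
    fix T assume T: "T \<in> ?A"
    have "measure (fire_space n r) ({T} \<times> ?S T) = measure (uniform_count_measure ?A) {T} * measure ?\<Omega> (?S T)"
      unfolding fire_space using set1[OF T] sets[OF T]
      by (simp add: measure_def C.emeasure_pair_measure_Times enn2real_mult)
    then show "measure (fire_space n r) ({T} \<times> ?S T) = 1 / real (card ?A) * measure ?\<Omega> (?S T)"
      using T finA by (simp add: measure_uniform_count_measure)
  qed simp
  also have "\<dots> \<ge> (\<Sum>T\<in>good. 1 / real (card ?A) * (1 - e2))"
  proof -
    have "(\<Sum>T\<in>good. 1 / real (card ?A) * (1 - e2)) \<le> (\<Sum>T\<in>good. 1 / real (card ?A) * measure ?\<Omega> (?S T))"
      using e2(1) by (intro sum_mono mult_left_mono) auto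
    also have "\<dots> \<le> (\<Sum>T\<in>?A. 1 / real (card ?A) * measure ?\<Omega> (?S T))"
      using finA good by (intro sum_mono2) auto
    finally show ?thesis .
  qed
  finally have "\<P>((T, c) in fire_space n r. Q T c) \<ge> real (card good) / real (card ?A) * (1 - e2)"
    unfolding eq by simp
  moreover have "real (card good) / real (card ?A) * (1 - e2) \<ge> 1 - e1 - e2"
  proof -
    have fg: "finite good" using good finA finite_subset by blast
    have "real (card (?A - good)) = real (card ?A) - real (card good)"
      using card_mono[OF finA good] by (simp add: card_Diff_subset[OF fg good] of_nat_diff)
    then have "1 - e1 \<le> real (card good) / real (card ?A)"
      using bad cardA by (simp add: field_simps)
    moreover have "real (card good) / real (card ?A) * e2 \<le> 1 * e2"
      using card_mono[OF finA good] cardA e2(2) by (intro mult_right_mono) auto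
    moreover have "real (card good) / real (card ?A) * (1 - e2) =
        real (card good) / real (card ?A) - real (card good) / real (card ?A) * e2"
      by (simp only: right_diff_distrib mult_1_right)
    ultimately show ?thesis by linarith
  qed
  ultimately show "\<P>((T, c) in fire_space n r. Q T c) \<ge> 1 - e1 - e2" by linarith
qed

lemma card_bad_trees:
  fixes n p D m h M L :: nat and K :: real
  assumes n: "n \<ge> 1" and K: "K > 0"
  defines "good \<equiv> {T \<in> cayley_trees n.
      (\<forall>x\<in>{1..n}. \<forall>\<rho>\<in>{1..n}. real (card (tree_ball T x \<rho>)) \<le> K * real \<rho> ^ 2) \<and>
      \<not> (\<exists>xs. length xs = D \<and> distinct (1 # xs) \<and> path_edges 1 xs \<subseteq> T) \<and>
      \<not> tall_branch {1..n} T m h \<and> \<not> tall_branch {1..n} T M L}"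
  shows "real (card (cayley_trees n - good)) \<le> real (card (cayley_trees n)) *
    (2 ^ p * (real p + 1) ^ Suc p * real n ^ 3 / K ^ p
     + (real D + 1) * exp (- (real D * (real D + 1) / (2 * real n)))
     + real n ^ 2 * ((real h + 1) * exp (- (real h * (real h + 1) / (2 * real m))))
     + real n ^ 2 * ((real L + 1) * exp (- (real L * (real L + 1) / (2 * real M)))))"
proof -
  let ?V = "{1..n}"
  have V: "finite ?V" "?V \<noteq> {}" "1 \<in> ?V" "card ?V = n" using n by auto
  let ?B1 = "{T. is_tree ?V T \<and> (\<exists>x\<in>?V. \<exists>\<rho>\<in>{1..card ?V}. K * real \<rho> ^ 2 < real (card (tree_ball T x \<rho>)))}"
  let ?B2 = "{T. is_tree ?V T \<and> (\<exists>xs. length xs = D \<and> distinct (1 # xs) \<and> path_edges 1 xs \<subseteq> T)}"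
  let ?B3 = "\<lambda>k h. {T. is_tree ?V T \<and> tall_branch ?V T k h}"
  have fin: "finite {T. is_tree ?V T \<and> P T}" for P
    by (rule finite_subset[OF _ finite_trees[OF V(1)]]) auto
  have "cayley_trees n - good \<subseteq> (?B1 \<union> ?B2) \<union> (?B3 m h \<union> ?B3 M L)"
    unfolding good_def cayley_trees_def V(4) not_le[symmetric] by blast
  then have "card (cayley_trees n - good) \<le> card ((?B1 \<union> ?B2) \<union> (?B3 m h \<union> ?B3 M L))"
    using fin by (intro card_mono) auto
  also have "\<dots> \<le> (card ?B1 + card ?B2) + (card (?B3 m h) + card (?B3 M L))"
    by (intro order_trans[OF card_Un_le] add_mono card_Un_le)
  finally have "real (card (cayley_trees n - good)) \<le>
      (real (card ?B1) + real (card ?B2)) + (real (card (?B3 m h)) + real (card (?B3 M L)))"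
    by (simp only: of_nat_add[symmetric] of_nat_le_iff)
  also have "real (card ?B1) \<le> real (card {T. is_tree ?V T}) * (2 ^ p * (real p + 1) ^ Suc p * real n ^ 3 / K ^ p)"
    using card_large_ball[OF V(1,2) K, of p] unfolding V(4) .
  also have "real (card ?B2) \<le> real (card {T. is_tree ?V T}) * ((real D + 1) * exp (- (real D * (real D + 1) / (2 * real n))))"
    using card_trees_with_path[OF V(1,3), of D] unfolding V(4) .
  also have "real (card (?B3 m h)) \<le> real n ^ 2 * (real (card {T. is_tree ?V T}) * ((real h + 1) * exp (- (real h * (real h + 1) / (2 * real m)))))"
    using card_trees_with_tall_branch[OF V(1), of m h] unfolding V(4) tall_branch_def .
  also have "real (card (?B3 M L)) \<le> real n ^ 2 * (real (card {T. is_tree ?V T}) * ((real L + 1) * exp (- (real L * (real L + 1) / (2 * real M)))))"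
    using card_trees_with_tall_branch[OF V(1), of M L] unfolding V(4) tall_branch_def .
  finally show ?thesis by (simp add: cayley_trees_def algebra_simps)
qed

text \<open>The difference of the harmonic number and the logarithm decreases from its value 1 at
  \<open>n = 1\<close>.\<close>

lemma harm_le_ln:
  assumes "1 \<le> L" "L \<le> n"
  shows "harm L \<le> ln (real n) + 1"
proof -
  have "harm L \<le> (harm n :: real)" using assms(2) by (rule harm_mono)
  also have "harm n - ln (real n) \<le> harm 1 - ln (real 1)"
    by (rule euler_mascheroni_sequence_decreasing) (use assms in auto)
  finally show ?thesis by (simp add: harm_def)
qed

theorem proposition1:
  fixes \<epsilon> :: real
  assumes "\<epsilon> > 0"
  shows "(\<lambda>n::nat. \<P>((T, c) in fire_space n (real n powr (- 1/2)).
            \<exists>C\<in>forest_components n T c. real (card C) > real n powr (1 - \<epsilon>)))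
         \<longlonglongrightarrow> 1"
proof -
  \<comment> \<open>The component found has size at least \<open>m / 2\<close>, with
    \<open>m\<close> of order \<open>n^(1 - 150 \<delta>)\<close>; the margin up to
    \<open>160 \<delta>\<close> absorbs the factor 2. The minimum with \<open>1/2\<close> keeps the
    exponents of all sizes and heights positive.\<close>
  define \<delta> where "\<delta> = min \<epsilon> (1/2) / 160"
  have \<delta>: "\<delta> > 0" "\<delta> \<le> 1/320" "160 * \<delta> \<le> \<epsilon>" using assms by (auto simp: \<delta>_def)
  \<comment> \<open>Makes \<open>K^p = n^(p * \<delta>)\<close> outgrow the factor
    \<open>n^3\<close> of \<open>card_large_ball\<close>.\<close>
  define p where "p = nat \<lceil>4 / \<delta>\<rceil>"
  have "real p \<ge> 4 / \<delta>" unfolding p_def by linarith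
  then have p: "\<delta> * real p > 3" using \<delta>(1) by (simp add: field_simps)
  define c0 :: real where "c0 = 2 ^ p * (real p + 1) ^ Suc p"
  have c0: "c0 > 0" by (simp add: c0_def)
  define up where "up y = nat \<lceil>y :: real\<rceil>" for y
  define r where "r n = real n powr (- 1/2)" for n :: nat
  \<comment> \<open>Slightly below \<open>n^(-1/2)\<close>: since
    \<open>n * r * s = n^(-10 \<delta>)\<close>, there is typically no fire by time
    \<open>s\<close>.\<close>
  define s where "s n = real n powr (- 1/2 - 10 * \<delta>)" for n :: nat
  define K where "K n = real n powr \<delta>" for n :: nat
  define D where "D n = up (real n powr (1/2 + \<delta>))" for n :: nat
  \<comment> \<open>\<open>h\<close> and \<open>L\<close> exceed the square roots of
    \<open>m\<close> and \<open>M\<close> by a factor \<open>n^\<delta>\<close>, as \<open>D\<close>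
    does for \<open>n\<close>. So the height tails are about
    \<open>exp (- n^(2 * \<delta>) / 2)\<close>, which beats the polynomial factors of the union
    bounds.\<close>
  define m where "m n = up (real n powr (1 - 150 * \<delta>))" for n :: nat
  define h where "h n = up (real n powr (1/2 - 74 * \<delta>))" for n :: nat
  define M where "M n = up (real n powr (1 - 60 * \<delta>))" for n :: nat
  define L where "L n = up (real n powr (1/2 - 29 * \<delta>))" for n :: nat
  \<comment> \<open>Up to rounding, \<open>s * q = n^(20 \<delta>)\<close>, so that some candidate
    is protected in time, while \<open>q * r * s * K * L = n^(-8 \<delta>)\<close> beats the
    remaining logarithm.\<close>
  define q where "q n = up (real n powr (1/2 + 30 * \<delta>))" for n :: nat
  note defs = r_def s_def K_def D_def m_def h_def M_def L_def q_def up_def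
  define e1 where "e1 n = c0 * real n ^ 3 / K n ^ p
     + (real (D n) + 1) * exp (- (real (D n) * (real (D n) + 1) / (2 * real n)))
     + real n ^ 2 * ((real (h n) + 1) * exp (- (real (h n) * (real (h n) + 1) / (2 * real (m n)))))
     + real n ^ 2 * ((real (L n) + 1) * exp (- (real (L n) * (real (L n) + 1) / (2 * real (M n)))))" for n
  define e2 where "e2 n = real n * (r n * s n) + exp (- (s n * real (q n)))
     + real (q n) * (4 * r n * s n * (8 * K n * real (L n) * (ln (real n) + 2)))" for n
  have e1: "e1 \<longlonglongrightarrow> 0"
  proof -
    have "(\<lambda>n. c0 * real n ^ 3 / real n powr (\<delta> * real p)) \<longlonglongrightarrow> 0"
      using p c0 by real_asymp
    moreover have "eventually (\<lambda>n. c0 * real n ^ 3 / real n powr (\<delta> * real p) = c0 * real n ^ 3 / K n ^ p) at_top"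
      using eventually_gt_at_top[of 0]
      by eventually_elim (simp add: K_def powr_powr[symmetric] powr_realpow)
    ultimately have 1: "(\<lambda>n. c0 * real n ^ 3 / K n ^ p) \<longlonglongrightarrow> 0"
      by (rule Lim_transform_eventually)
    have 2: "(\<lambda>n. (real (D n) + 1) * exp (- (real (D n) * (real (D n) + 1) / (2 * real n)))) \<longlonglongrightarrow> 0"
      unfolding defs using \<delta>(1,2) by real_asymp
    have 3: "(\<lambda>n. real n ^ 2 * ((real (h n) + 1) * exp (- (real (h n) * (real (h n) + 1) / (2 * real (m n)))))) \<longlonglongrightarrow> 0"
      unfolding defs using \<delta>(1,2) by real_asymp
    have 4: "(\<lambda>n. real n ^ 2 * ((real (L n) + 1) * exp (- (real (L n) * (real (L n) + 1) / (2 * real (M n)))))) \<longlonglongrightarrow> 0"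
      unfolding defs using \<delta>(1,2) by real_asymp
    show ?thesis unfolding e1_def by (rule tendsto_add_zero[OF tendsto_add_zero[OF tendsto_add_zero[OF 1 2] 3] 4])
  qed
  have e2: "e2 \<longlonglongrightarrow> 0"
  proof -
    have 1: "(\<lambda>n. real n * (r n * s n)) \<longlonglongrightarrow> 0" unfolding defs using \<delta>(1,2) by real_asymp
    have 2: "(\<lambda>n. exp (- (s n * real (q n)))) \<longlonglongrightarrow> 0" unfolding defs using \<delta>(1,2) by real_asymp
    have 3: "(\<lambda>n. real (q n) * (4 * r n * s n * (8 * K n * real (L n) * (ln (real n) + 2)))) \<longlonglongrightarrow> 0"
      unfolding defs using \<delta>(1,2) by real_asymp
    show ?thesis unfolding e2_def by (rule tendsto_add_zero[OF tendsto_add_zero[OF 1 2] 3])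
  qed
  have ev_le: "eventually (\<lambda>n. real (m n) \<le> real n) at_top" "eventually (\<lambda>n. real (M n) \<le> real n) at_top"
      "eventually (\<lambda>n. real (L n) \<le> real n) at_top"
    unfolding defs using \<delta>(1,2) by real_asymp+
  \<comment> \<open>The exponents on the right are \<open>1/2 + 73 \<delta>\<close>,
    \<open>1/2 - 74 \<delta>\<close> and \<open>1/2 + 61 \<delta>\<close>, against
    \<open>1/2 + 30 \<delta>\<close> for \<open>q\<close>. The gap between \<open>m\<close> and
    \<open>M\<close> is what lets the lower bound for \<open>heavy m\<close> win over the upper
    bound for \<open>heavy M\<close>.\<close>
  have ev_q: "eventually (\<lambda>n. real (q n) \<le> real n / (9 * K n * real (h n)) - real (h n) - real n * (real (D n) + 1) / real (M n)) at_top"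
    unfolding defs using \<delta>(1,2) by real_asymp
  have ev_m: "eventually (\<lambda>n. real n powr (1 - 160 * \<delta>) < real (m n) / 2) at_top"
    unfolding defs using \<delta>(1,2) by real_asymp
  let ?P = "\<lambda>n::nat. \<P>((T, c) in fire_space n (real n powr (- 1/2)).
            \<exists>C\<in>forest_components n T c. real (card C) > real n powr (1 - \<epsilon>))"
  have bounds: "eventually (\<lambda>n. 1 - e1 n - e2 n \<le> ?P n \<and> ?P n \<le> 1) at_top"
    using eventually_ge_at_top[of 1] ev_le ev_q ev_m
  proof eventually_elim
    case (elim n)
    then have n: "n \<ge> 1" "real n > 0" by auto
    have pos: "up (real n powr a) \<ge> 1" for a
    proof -
      have "real n powr a > 0" using n by simp
      then show ?thesis unfolding up_def by linarith
    qed
    have pos': "1 \<le> m n" "1 \<le> h n" "1 \<le> M n" "1 \<le> L n" using pos by (auto simp: m_def h_def M_def L_def)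
    have r: "r n > 0" and s: "s n \<ge> 0" using n by (auto simp: r_def s_def)
    have K: "K n \<ge> 1" using n \<delta> by (simp add: K_def ge_one_powr_ge_zero)
    interpret clocks n "r n" by unfold_locales (rule r)
    define good where "good = {T \<in> cayley_trees n.
      (\<forall>x\<in>{1..n}. \<forall>\<rho>\<in>{1..n}. real (card (tree_ball T x \<rho>)) \<le> K n * real \<rho> ^ 2) \<and>
      \<not> (\<exists>xs. length xs = D n \<and> distinct (1 # xs) \<and> path_edges 1 xs \<subseteq> T) \<and>
      \<not> tall_branch {1..n} T (m n) (h n) \<and> \<not> tall_branch {1..n} T (M n) (L n)}"
    have bad: "real (card (cayley_trees n - good)) \<le> real (card (cayley_trees n)) * e1 n"
      unfolding good_def e1_def c0_def using K by (intro card_bad_trees n) auto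
    have harm: "harm (L n) + 1 \<le> ln (real n) + 2" using harm_le_ln[of "L n" n] pos' elim by simp
    have sets: "{c \<in> space \<Omega>. \<exists>C\<in>forest_components n T c. real n powr (1 - \<epsilon>) < real (card C)} \<in> sets \<Omega>"
      if "T \<in> cayley_trees n" for T
      using that by (intro sets_forest_components) (auto simp: cayley_trees_def is_tree_def)
    have succ: "measure \<Omega> {c \<in> space \<Omega>. \<exists>C\<in>forest_components n T c. real n powr (1 - \<epsilon>) < real (card C)} \<ge> 1 - e2 n"
      if T: "T \<in> good" for T
    proof -
      have "1 - e2 n \<le> 1 - (real n * (r n * s n) + exp (- (s n * real (q n))) +
          real (q n) * (4 * r n * s n * (8 * K n * real (L n) * (harm (L n) + 1))))"
      proof -
        have "real (q n) * (4 * r n * s n * (8 * K n * real (L n) * (harm (L n) + 1))) \<le>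
            real (q n) * (4 * r n * s n * (8 * K n * real (L n) * (ln (real n) + 2)))"
          using r s K harm by (intro mult_left_mono) auto
        then show ?thesis unfolding e2_def by linarith
      qed
      also have "\<dots> \<le> measure \<Omega> {c \<in> space \<Omega>. \<exists>C\<in>forest_components n T c. real (m n) / 2 \<le> real (card C)}"
      proof (rule good_tree_success)
        show "is_tree {1..n} T" using T by (simp add: good_def cayley_trees_def)
        show "real (card (tree_ball T x \<rho>)) \<le> K n * real \<rho> ^ 2" if "x \<in> {1..n}" "\<rho> \<in> {1..n}" for x \<rho>
          using T that by (simp add: good_def)
        show "\<not> (\<exists>xs. length xs = D n \<and> distinct (1 # xs) \<and> path_edges 1 xs \<subseteq> T)"
          "\<not> tall_branch {1..n} T (m n) (h n)" "\<not> tall_branch {1..n} T (M n) (L n)"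
          using T unfolding good_def by blast+
      qed (use n K pos' s elim in auto)
      also have "\<dots> \<le> measure \<Omega> {c \<in> space \<Omega>. \<exists>C\<in>forest_components n T c. real n powr (1 - \<epsilon>) < real (card C)}"
      proof (rule finite_measure_mono)
        have "real n powr (1 - \<epsilon>) \<le> real n powr (1 - 160 * \<delta>)" using n \<delta>(3) by (intro powr_mono) auto
        then have "real n powr (1 - \<epsilon>) < real (m n) / 2" using elim by linarith
        then have "real n powr (1 - \<epsilon>) < real (card C)" if "real (m n) / 2 \<le> real (card C)" for C :: "nat set"
          using that by linarith
        then show "{c \<in> space \<Omega>. \<exists>C\<in>forest_components n T c. real (m n) / 2 \<le> real (card C)} \<subseteq>
            {c \<in> space \<Omega>. \<exists>C\<in>forest_components n T c. real n powr (1 - \<epsilon>) < real (card C)}"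
          by blast
        show "{c \<in> space \<Omega>. \<exists>C\<in>forest_components n T c. real n powr (1 - \<epsilon>) < real (card C)} \<in> sets \<Omega>"
          using T by (intro sets) (simp add: good_def)
      qed
      finally show ?thesis .
    qed
    have e2_nonneg: "e2 n \<ge> 0" unfolding e2_def using n r s K by (intro add_nonneg_nonneg mult_nonneg_nonneg) auto
    have "good \<subseteq> cayley_trees n" by (auto simp: good_def)
    note measure_fire_space_ge[where Q = "\<lambda>T c. \<exists>C\<in>forest_components n T c. real n powr (1 - \<epsilon>) < real (card C)",
        OF r n(1) this bad succ e2_nonneg sets]
    then show ?case unfolding r_def by blast
  qed
  show ?thesis
  proof (rule tendsto_sandwich)
    show "eventually (\<lambda>n. 1 - e1 n - e2 n \<le> ?P n) at_top" "eventually (\<lambda>n. ?P n \<le> 1) at_top"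
      using bounds by (auto elim: eventually_mono)
    show "(\<lambda>n. 1 - e1 n - e2 n) \<longlonglongrightarrow> 1" using e1 e2 by (auto intro!: tendsto_eq_intros)
  qed simp
qed

end
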